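(* Consider the quasilinear system $(\mathbb{A}^\alpha(\mathbf U)\partial_\alpha+\mathbb{B})\mathbf U=\mathbf 0$ (the augmented Israel–Stewart/DNMR fluid equations described in the context), at states $\mathbf U$ subject to the constraints $u^\alpha u_\alpha=-1$, $\pi^{[\mu\nu]}=0$, $u_\alpha\pi^{\alpha\mu}=0$, $\pi^\alpha{}_\alpha=0$. Let $\tau_\Pi,\tau_\pi\neq0$ and $E+\Lambda_A\neq0$ for $A=0,1,2,3$. Let $\mathcal A_0,\mathcal A_1,\mathcal A_2$ (functions of $(\chi^2,\kappa^2)$) be the coefficients of the cubic $\mathcal P_3$ defined in the context and let $$\Delta(\mathcal P_3;\chi^2,\kappa^2)=-27\Big[2\big(\tfrac{\mathcal A_2}{3}\big)^3-\tfrac{\mathcal A_2}{3}\mathcal A_1+\mathcal A_0\Big]^2-4\Big[\mathcal A_1-3\big(\tfrac{\mathcal A_2}{3}\big)^2\Big]^3 .$$ Then the system is causal if and only if all of the following inequalities hold for all $\chi^2,\kappa^2\in[0,1]$: $$0\le\Delta(\mathcal P_3;\chi^2,\kappa^2),$$ $$0\le\tfrac{\mathcal A_2}{3}\le1,\qquad 0\le\mathcal A_1,\qquad 0\le\mathcal A_0,$$ $$0\le 1-\mathcal A_2+\mathcal A_1-\mathcal A_0,$$ $$0\le 1-\tfrac23\mathcal A_2+\tfrac13\mathcal A_1,$$ $$0\le\frac{\frac12(2\eta+\lambda_{\pi\Pi}\Pi)+\frac14\tau_{\pi\pi}\Lambda_{\hat v^2}}{\tau_\pi E}\le1 .$$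
   Context: **Setting.** $(\mathcal M,g)$ is a 4-dimensional Lorentzian manifold of signature $(-,+,+,+)$ with a fixed metric; $\nabla$ is its Levi-Civita connection; Greek indices run over $0,\dots,3$; $A^{(\mu\nu)}=\frac12(A^{\mu\nu}+A^{\nu\mu})$, $A^{[\mu\nu]}=\frac12(A^{\mu\nu}-A^{\nu\mu})$. The unknowns are $\mathbf U=(u^\nu,\varepsilon,n,\Pi,\pi^{\nu0},\pi^{\nu1},\pi^{\nu2},\pi^{\nu3})^T\in\mathbb R^{23}$, all components (4 of $u$, 16 of $\pi$) being independent variables. The pressure is $P=P(\varepsilon,n)$, a given sufficiently smooth function with $P_\varepsilon=(\partial P/\partial\varepsilon)_n$, $P_n=(\partial P/\partial n)_\varepsilon$. The transport coefficients $\tau_\Pi,\zeta,\delta_{\Pi\Pi},\lambda_{\Pi\pi},\tau_\pi,\eta,\delta_{\pi\pi},\tau_{\pi\pi},\lambda_{\pi\Pi}$ are given functions of $(\varepsilon,n,\Pi,\pi_{\alpha\beta}\pi^{\alpha\beta})$. Put $E=\varepsilon+P+\Pi$ and $\Delta^{\mu\nu}=g^{\mu\nu}+u^\mu u^\nu$. **The system** $(\mathbb A^\alpha\partial_\alpha+\mathbb B)\mathbf U=\mathbf 0$ is $$\begin{aligned} 0&=u^\alpha\nabla_\alpha\varepsilon+E\nabla_\alpha u^\alpha+\pi^\alpha{}_\nu\nabla_\alpha u^\nu,\\ 0&=Eu^\alpha\nabla_\alpha u^\mu+\Delta^{\mu\alpha}\nabla_\alpha(P+\Pi)+\nabla_\alpha\pi^{\mu\alpha}-u^\mu\pi^{\alpha\beta}\nabla_\beta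 u_\alpha,\\ 0&=n\nabla_\alpha u^\alpha+u^\alpha\nabla_\alpha n,\\ \Pi+\tau_\Pi u^\alpha\nabla_\alpha\Pi&=-[(\zeta+\delta_{\Pi\Pi}\Pi)g^\alpha{}_\nu+\lambda_{\Pi\pi}\pi^\alpha{}_\nu]\nabla_\alpha u^\nu,\\ \pi^{\mu\beta}+\tau_\pi u^\alpha\nabla_\alpha\pi^{\mu\beta}&=-\mathcal C_\pi{}^{\mu\beta\alpha}{}_\nu\nabla_\alpha u^\nu, \end{aligned}$$ with $$\begin{aligned}\mathcal C_\pi{}^{\mu\beta\alpha}{}_\nu=&\big(\eta+\tfrac12\lambda_{\pi\Pi}\Pi\big)\big(\Delta^{\mu\alpha}g^\beta{}_\nu+\Delta^{\beta\alpha}g^\mu{}_\nu-\tfrac23\Delta^{\mu\beta}\Delta^\alpha{}_\nu\big)-2\tau_\pi u^\alpha\pi^{(\mu}{}_\nu u^{\beta)}+\big(\delta_{\pi\pi}-\tfrac{\tau_{\pi\pi}}3\big)\pi^{\mu\beta}g^\alpha{}_\nu\\&+\tfrac{\tau_{\pi\pi}}2\big(\Delta^{\alpha(\beta}\pi^{\mu)}{}_\nu+\pi^{\alpha(\mu}g^{\beta)}{}_\nu\big)-\tfrac{\tau_{\pi\pi}}3\Delta^{\mu\beta}\pi^\alpha{}_\nu .\end{aligned}$$ **Principal part.** For a covector $\phi_\mu$ put $z=u^\alpha\phi_\alpha$, $v^\mu=\Delta^{\mu\alpha}\phi_\alpha$, $w^\mu=\pi^{\mu\alpha}\phi_\alpha$.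 The $23\times23$ matrix $\mathbb A^\alpha\phi_\alpha$ maps $(\delta u^\nu,\delta\varepsilon,\delta n,\delta\Pi,\delta\pi^{\nu\beta})$ to the tuple with entries (i) $Ez\,\delta u^\mu-u^\mu w_\nu\delta u^\nu+v^\mu(P_\varepsilon\delta\varepsilon+P_n\delta n+\delta\Pi)+\phi_\beta\delta\pi^{\mu\beta}$; (ii) $(E\phi_\nu+w_\nu)\delta u^\nu+z\,\delta\varepsilon$; (iii) $n\phi_\nu\delta u^\nu+z\,\delta n$; (iv) $[(\zeta+\delta_{\Pi\Pi}\Pi)\phi_\nu+\lambda_{\Pi\pi}w_\nu]\delta u^\nu+\tau_\Pi z\,\delta\Pi$; (v) $\phi_\alpha\mathcal C_\pi{}^{\mu\beta\alpha}{}_\nu\delta u^\nu+\tau_\pi z\,\delta\pi^{\mu\beta}$. **Eigenvalues and the cubic.** At a state satisfying the constraints, $\pi^\mu{}_\nu$ has an orthonormal eigenbasis $e_0=u,e_1,e_2,e_3$ with $\pi^\mu{}_\alpha e_A^\alpha=\Lambda_Ae_A^\mu$, $\Lambda_0=0$, $\Lambda_1+\Lambda_2+\Lambda_3=0$. Write $v^2=v_\alpha v^\alpha$, $v_a=v_\alpha e_a^\alpha$, $\hat z=z/v$, $\hat v_a^2=v_a^2/v^2$; the direction is parametrized by $\chi^2,\kappa^2\in[0,1]$ via $\hat v_1^2=\chi^2(1-\kappa^2)$, $\hat v_2^2=(1-\chi^2)(1-\kappa^2)$, $\hat v_3^2=\kappa^2$; and $\Lambda_{\hat v^2}=\sum_{k=1}^3\Lambda_k\hat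 v_k^2$. The characteristic determinant factorizes as $$\det(\mathbb A^\alpha\phi_\alpha)=\Big[\prod_{k=0}^3(E+\Lambda_k)\Big]v^{23}\tau_\Pi\tau_\pi^{16}\hat z^{15}\Big[\hat z^2-\tfrac{\frac12(2\eta+\lambda_{\pi\Pi}\Pi)+\frac14\tau_{\pi\pi}\Lambda_{\hat v^2}}{\tau_\pi E}\Big]\mathcal P_3(\hat z^2,\chi^2,\kappa^2),$$ $$\mathcal P_3=\hat z^6-\mathcal A_2(\chi^2,\kappa^2)\hat z^4+\mathcal A_1(\chi^2,\kappa^2)\hat z^2-\mathcal A_0(\chi^2,\kappa^2),$$ which (for nonvanishing prefactors) defines $\mathcal A_0,\mathcal A_1,\mathcal A_2$. **Causality.** The system is *causal* if (CI) the roots $\phi_0=\phi_0(\phi_i)$ of $\det(\mathbb A^\alpha\phi_\alpha)=0$ (for real spatial components $\phi_i$, with respect to coordinates whose level sets of $x^0$ are spacelike) are all real, and (CII) every characteristic covector $\phi$ so obtained is non-timelike, $\phi^\alpha\phi_\alpha\ge0$. *)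

theory Defs
  imports "HOL-Analysis.Analysis"
begin

subsection \<open>Spacetime\<close>

definition minkowski :: "real^4^4" where
  "minkowski = (\<chi> \<mu> \<nu>. if \<mu> = \<nu> then (if \<mu> = 0 then -1 else 1) else 0)"

definition lorentzian :: "real^4^4 \<Rightarrow> bool" where
  "lorentzian G \<longleftrightarrow>
     transpose G = G \<and> (\<exists>S. invertible S \<and> transpose S ** G ** S = minkowski)"

text \<open>The metric \<open>G\<close> is positive definite on the span of the coordinate vectors
  \<open>\<partial>\<^sub>1, \<partial>\<^sub>2, \<partial>\<^sub>3\<close>, the tangent space of the level set of \<open>x\<^sup>0\<close>.\<close>

definition spacelike_time_slices :: "real^4^4 \<Rightarrow> bool" where
  "spacelike_time_slices G \<longleftrightarrow> (\<forall>X. X $ 0 = 0 \<and> X \<noteq> 0 \<longrightarrow> X \<bullet> (G *v X) > 0)"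

definition partial :: "(real^4 \<Rightarrow> 'b::real_normed_vector) \<Rightarrow> real^4 \<Rightarrow> 4 \<Rightarrow> 'b" where
  "partial f x \<alpha> = frechet_derivative f (at x) (axis \<alpha> 1)"

text \<open>\<open>christoffel g x \<mu> \<alpha> \<lambda>\<close> is \<open>\<Gamma>\<^sup>\<mu>\<^sub>\<alpha>\<^sub>\<lambda>\<close>.\<close>

definition christoffel :: "(real^4 \<Rightarrow> real^4^4) \<Rightarrow> real^4 \<Rightarrow> 4 \<Rightarrow> 4 \<Rightarrow> 4 \<Rightarrow> real" where
  "christoffel g x \<mu> \<alpha> \<kappa> =
     (1/2) * (\<Sum>\<sigma>\<in>UNIV. matrix_inv (g x) $ \<mu> $ \<sigma> *
        (partial g x \<alpha> $ \<sigma> $ \<kappa> + partial g x \<kappa> $ \<sigma> $ \<alpha> - partial g x \<sigma> $ \<alpha> $ \<kappa>))"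

definition kron :: "4 \<Rightarrow> 4 \<Rightarrow> real" where
  "kron \<mu> \<nu> = (if \<mu> = \<nu> then 1 else 0)"


subsection \<open>Fluid states\<close>

text \<open>The 23 scalar unknowns \<open>u\<^sup>\<nu>\<close>, \<open>\<epsilon>\<close>, \<open>n\<close>, \<open>\<Pi>\<close>, \<open>\<pi>\<^sup>\<mu>\<^sup>\<nu>\<close>. The same type indexes the 23 equations:
  \<open>Vel \<mu>\<close> is the momentum equation, \<open>Energy\<close> and \<open>Particle\<close> are the conservation laws, and
  \<open>Bulk\<close> and \<open>Shear \<mu> \<beta>\<close> are the relaxation equations.\<close>

datatype fld = Vel 4 | Energy | Particle | Bulk | Shear 4 4

lemma UNIV_fld:
  "UNIV = range Vel \<union> {Energy, Particle, Bulk} \<union> range (\<lambda>(\<mu>, \<nu>). Shear \<mu> \<nu>)"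
proof -
  have "i \<in> range Vel \<union> {Energy, Particle, Bulk} \<union> range (\<lambda>(\<mu>, \<nu>). Shear \<mu> \<nu>)" for i
    by (cases i) auto
  thus ?thesis by blast
qed

instance fld :: finite
  by standard (simp add: UNIV_fld)

type_synonym state = "real^fld"

abbreviation vel :: "state \<Rightarrow> 4 \<Rightarrow> real" where "vel U \<nu> \<equiv> U $ Vel \<nu>"
abbreviation energy :: "state \<Rightarrow> real" where "energy U \<equiv> U $ Energy"
abbreviation particle :: "state \<Rightarrow> real" where "particle U \<equiv> U $ Particle"
abbreviation bulk :: "state \<Rightarrow> real" where "bulk U \<equiv> U $ Bulk"
abbreviation shear :: "state \<Rightarrow> 4 \<Rightarrow> 4 \<Rightarrow> real" where "shear U \<mu> \<nu> \<equiv> U $ Shear \<mu> \<nu>"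

definition vel_low :: "real^4^4 \<Rightarrow> state \<Rightarrow> 4 \<Rightarrow> real" where
  "vel_low G U \<nu> = (\<Sum>\<mu>\<in>UNIV. G $ \<nu> $ \<mu> * vel U \<mu>)"

text \<open>\<open>\<pi>\<^sup>\<mu>\<^sub>\<nu>\<close>, the second index lowered.\<close>

definition shear_mix :: "real^4^4 \<Rightarrow> state \<Rightarrow> 4 \<Rightarrow> 4 \<Rightarrow> real" where
  "shear_mix G U \<mu> \<nu> = (\<Sum>\<kappa>\<in>UNIV. shear U \<mu> \<kappa> * G $ \<kappa> $ \<nu>)"

text \<open>\<open>\<pi>\<^sub>\<alpha>\<^sub>\<beta> \<pi>\<^sup>\<alpha>\<^sup>\<beta>\<close>.\<close>

definition shear_sq :: "real^4^4 \<Rightarrow> state \<Rightarrow> real" where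
  "shear_sq G U = (\<Sum>\<alpha>\<in>UNIV. \<Sum>\<beta>\<in>UNIV. \<Sum>\<mu>\<in>UNIV. \<Sum>\<nu>\<in>UNIV.
      G $ \<alpha> $ \<mu> * G $ \<beta> $ \<nu> * shear U \<mu> \<nu> * shear U \<alpha> \<beta>)"

text \<open>\<open>\<Delta>\<^sup>\<mu>\<^sup>\<nu>\<close> and \<open>\<Delta>\<^sup>\<mu>\<^sub>\<nu>\<close>.\<close>

definition Proj :: "real^4^4 \<Rightarrow> state \<Rightarrow> 4 \<Rightarrow> 4 \<Rightarrow> real" where
  "Proj G U \<mu> \<nu> = matrix_inv G $ \<mu> $ \<nu> + vel U \<mu> * vel U \<nu>"

definition Proj_mix :: "real^4^4 \<Rightarrow> state \<Rightarrow> 4 \<Rightarrow> 4 \<Rightarrow> real" where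
  "Proj_mix G U \<mu> \<nu> = kron \<mu> \<nu> + vel U \<mu> * vel_low G U \<nu>"

definition constrained :: "real^4^4 \<Rightarrow> state \<Rightarrow> bool" where
  "constrained G U \<longleftrightarrow>
     (\<Sum>\<alpha>\<in>UNIV. vel U \<alpha> * vel_low G U \<alpha>) = -1 \<and>
     (\<forall>\<mu> \<nu>. (1/2) * (shear U \<mu> \<nu> - shear U \<nu> \<mu>) = 0) \<and>
     (\<forall>\<mu>. (\<Sum>\<alpha>\<in>UNIV. vel_low G U \<alpha> * shear U \<alpha> \<mu>) = 0) \<and>
     (\<Sum>\<alpha>\<in>UNIV. shear_mix G U \<alpha> \<alpha>) = 0"

text \<open>The equation of state \<open>P(\<epsilon>, n)\<close> and the transport coefficients as functions of
  \<open>(\<epsilon>, n, \<Pi>, \<pi>\<^sub>\<alpha>\<^sub>\<beta> \<pi>\<^sup>\<alpha>\<^sup>\<beta>)\<close>. The fields are, in order, \<open>P\<close>, \<open>\<tau>\<^sub>\<Pi>\<close>, \<open>\<zeta>\<close>, \<open>\<delta>\<^sub>\<Pi>\<^sub>\<Pi>\<close>, \<open>\<lambda>\<^sub>\<Pi>\<^sub>\<pi>\<close>, \<open>\<tau>\<^sub>\<pi>\<close>, \<open>\<eta>\<close>, \<open>\<delta>\<^sub>\<pi>\<^sub>\<pi>\<close>,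
  \<open>\<tau>\<^sub>\<pi>\<^sub>\<pi>\<close>, \<open>\<lambda>\<^sub>\<pi>\<^sub>\<Pi>\<close>.\<close>

type_synonym transport = "real \<Rightarrow> real \<Rightarrow> real \<Rightarrow> real \<Rightarrow> real"

record fluid =
  pressure_fn :: "real \<Rightarrow> real \<Rightarrow> real"
  tau_bulk :: transport
  zeta :: transport
  delta_bulk :: transport
  lam_bulk_shear :: transport
  tau_shear :: transport
  eta :: transport
  delta_shear :: transport
  tau_shear_shear :: transport
  lam_shear_bulk :: transport

definition val :: "transport \<Rightarrow> real^4^4 \<Rightarrow> state \<Rightarrow> real" where
  "val c G U = c (energy U) (particle U) (bulk U) (shear_sq G U)"

definition P_energy :: "fluid \<Rightarrow> state \<Rightarrow> real" where
  "P_energy M U = deriv (\<lambda>s. pressure_fn M s (particle U)) (energy U)"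

definition P_particle :: "fluid \<Rightarrow> state \<Rightarrow> real" where
  "P_particle M U = deriv (\<lambda>s. pressure_fn M (energy U) s) (particle U)"

text \<open>\<open>E = \<epsilon> + P + \<Pi>\<close>.\<close>

definition enth :: "fluid \<Rightarrow> state \<Rightarrow> real" where
  "enth M U = energy U + pressure_fn M (energy U) (particle U) + bulk U"


subsection \<open>The quasilinear system\<close>

text \<open>\<open>Cpi G M U \<mu> \<beta> \<alpha> \<nu>\<close> is \<open>\<C>\<^sub>\<pi>\<^sup>\<mu>\<^sup>\<beta>\<^sup>\<alpha>\<^sub>\<nu>\<close>.\<close>

definition Cpi :: "real^4^4 \<Rightarrow> fluid \<Rightarrow> state \<Rightarrow> 4 \<Rightarrow> 4 \<Rightarrow> 4 \<Rightarrow> 4 \<Rightarrow> real" where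
  "Cpi G M U \<mu> \<beta> \<alpha> \<nu> =
     (val (eta M) G U + (1/2) * val (lam_shear_bulk M) G U * bulk U) *
       (Proj G U \<mu> \<alpha> * kron \<beta> \<nu> + Proj G U \<beta> \<alpha> * kron \<mu> \<nu>
          - (2/3) * Proj G U \<mu> \<beta> * Proj_mix G U \<alpha> \<nu>)
     - 2 * val (tau_shear M) G U * vel U \<alpha> *
         ((1/2) * (shear_mix G U \<mu> \<nu> * vel U \<beta> + shear_mix G U \<beta> \<nu> * vel U \<mu>))
     + (val (delta_shear M) G U - val (tau_shear_shear M) G U / 3) * shear U \<mu> \<beta> * kron \<alpha> \<nu>
     + val (tau_shear_shear M) G U / 2 *
         ((1/2) * (Proj G U \<alpha> \<beta> * shear_mix G U \<mu> \<nu> + Proj G U \<alpha> \<mu> * shear_mix G U \<beta> \<nu>)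
        + (1/2) * (shear U \<alpha> \<mu> * kron \<beta> \<nu> + shear U \<alpha> \<beta> * kron \<mu> \<nu>))
     - val (tau_shear_shear M) G U / 3 * Proj G U \<mu> \<beta> * shear_mix G U \<alpha> \<nu>"

text \<open>First jets: \<open>dU \<alpha>\<close> stands for \<open>\<partial>\<^sub>\<alpha> U\<close>, and \<open>\<Gamma>\<close> for the connection coefficients.
  \<open>cov_vel \<Gamma> U dU \<alpha> \<nu>\<close> is \<open>\<nabla>\<^sub>\<alpha> u\<^sup>\<nu>\<close> and \<open>cov_shear \<Gamma> U dU \<alpha> \<mu> \<beta>\<close> is \<open>\<nabla>\<^sub>\<alpha> \<pi>\<^sup>\<mu>\<^sup>\<beta>\<close>.\<close>

definition cov_vel :: "(4 \<Rightarrow> 4 \<Rightarrow> 4 \<Rightarrow> real) \<Rightarrow> state \<Rightarrow> (4 \<Rightarrow> state) \<Rightarrow> 4 \<Rightarrow> 4 \<Rightarrow> real" where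
  "cov_vel \<Gamma> U dU \<alpha> \<nu> = vel (dU \<alpha>) \<nu> + (\<Sum>\<kappa>\<in>UNIV. \<Gamma> \<nu> \<alpha> \<kappa> * vel U \<kappa>)"

definition cov_shear ::
    "(4 \<Rightarrow> 4 \<Rightarrow> 4 \<Rightarrow> real) \<Rightarrow> state \<Rightarrow> (4 \<Rightarrow> state) \<Rightarrow> 4 \<Rightarrow> 4 \<Rightarrow> 4 \<Rightarrow> real" where
  "cov_shear \<Gamma> U dU \<alpha> \<mu> \<beta> = shear (dU \<alpha>) \<mu> \<beta>
     + (\<Sum>\<kappa>\<in>UNIV. \<Gamma> \<mu> \<alpha> \<kappa> * shear U \<kappa> \<beta>) + (\<Sum>\<kappa>\<in>UNIV. \<Gamma> \<beta> \<alpha> \<kappa> * shear U \<mu> \<kappa>)"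

text \<open>Left-hand sides of the field equations, all terms having been moved to one side. The
  gradient of \<open>P(\<epsilon>, n)\<close> is expanded by the chain rule.\<close>

definition residual ::
    "real^4^4 \<Rightarrow> (4 \<Rightarrow> 4 \<Rightarrow> 4 \<Rightarrow> real) \<Rightarrow> fluid \<Rightarrow> state \<Rightarrow> (4 \<Rightarrow> state) \<Rightarrow> state" where
  "residual G \<Gamma> M U dU = (\<chi> i. case i of
     Vel \<mu> \<Rightarrow>
       enth M U * (\<Sum>\<alpha>\<in>UNIV. vel U \<alpha> * cov_vel \<Gamma> U dU \<alpha> \<mu>)
       + (\<Sum>\<alpha>\<in>UNIV. Proj G U \<mu> \<alpha> *
            (P_energy M U * energy (dU \<alpha>) + P_particle M U * particle (dU \<alpha>) + bulk (dU \<alpha>)))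
       + (\<Sum>\<alpha>\<in>UNIV. cov_shear \<Gamma> U dU \<alpha> \<mu> \<alpha>)
       - vel U \<mu> * (\<Sum>\<alpha>\<in>UNIV. \<Sum>\<beta>\<in>UNIV. shear U \<alpha> \<beta> *
            (\<Sum>\<nu>\<in>UNIV. G $ \<alpha> $ \<nu> * cov_vel \<Gamma> U dU \<beta> \<nu>))
   | Energy \<Rightarrow>
       (\<Sum>\<alpha>\<in>UNIV. vel U \<alpha> * energy (dU \<alpha>))
       + enth M U * (\<Sum>\<alpha>\<in>UNIV. cov_vel \<Gamma> U dU \<alpha> \<alpha>)
       + (\<Sum>\<alpha>\<in>UNIV. \<Sum>\<nu>\<in>UNIV. shear_mix G U \<alpha> \<nu> * cov_vel \<Gamma> U dU \<alpha> \<nu>)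
   | Particle \<Rightarrow>
       particle U * (\<Sum>\<alpha>\<in>UNIV. cov_vel \<Gamma> U dU \<alpha> \<alpha>)
       + (\<Sum>\<alpha>\<in>UNIV. vel U \<alpha> * particle (dU \<alpha>))
   | Bulk \<Rightarrow>
       bulk U + val (tau_bulk M) G U * (\<Sum>\<alpha>\<in>UNIV. vel U \<alpha> * bulk (dU \<alpha>))
       + (\<Sum>\<alpha>\<in>UNIV. \<Sum>\<nu>\<in>UNIV.
            ((val (zeta M) G U + val (delta_bulk M) G U * bulk U) * kron \<alpha> \<nu>
              + val (lam_bulk_shear M) G U * shear_mix G U \<alpha> \<nu>) * cov_vel \<Gamma> U dU \<alpha> \<nu>)
   | Shear \<mu> \<beta> \<Rightarrow>
       shear U \<mu> \<beta> + val (tau_shear M) G U * (\<Sum>\<alpha>\<in>UNIV. vel U \<alpha> * cov_shear \<Gamma> U dU \<alpha> \<mu> \<beta>)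
       + (\<Sum>\<alpha>\<in>UNIV. \<Sum>\<nu>\<in>UNIV. Cpi G M U \<mu> \<beta> \<alpha> \<nu> * cov_vel \<Gamma> U dU \<alpha> \<nu>))"

text \<open>The field equations for a field of states \<open>V\<close>.\<close>

definition solves_on ::
    "(real^4) set \<Rightarrow> (real^4 \<Rightarrow> real^4^4) \<Rightarrow> fluid \<Rightarrow> (real^4 \<Rightarrow> state) \<Rightarrow> bool" where
  "solves_on D g M V \<longleftrightarrow>
     (\<forall>x\<in>D. residual (g x) (christoffel g x) M (V x) (partial V x) = 0)"

text \<open>\<open>residual\<close> is affine in \<open>dU\<close>; its value at \<open>dU = 0\<close> is the zeroth-order term \<open>B U\<close>, and
  the coefficient matrix of \<open>\<partial>\<^sub>\<alpha> U\<close> is \<open>A\<^sup>\<alpha>(U)\<close>, see \<open>residual_quasilinear\<close>;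
  \<open>princ_explicit\<close> spells out the action of \<open>A\<^sup>\<alpha> \<phi>\<^sub>\<alpha>\<close>.\<close>

definition Amat :: "(real^4 \<Rightarrow> real^4^4) \<Rightarrow> real^4 \<Rightarrow> fluid \<Rightarrow> state \<Rightarrow> 4 \<Rightarrow> real^fld^fld" where
  "Amat g x M U \<alpha> = matrix (\<lambda>\<delta>.
     residual (g x) (christoffel g x) M U (\<lambda>\<beta>. if \<beta> = \<alpha> then \<delta> else 0)
     - residual (g x) (christoffel g x) M U (\<lambda>\<beta>. 0))"

definition princ ::
    "(real^4 \<Rightarrow> real^4^4) \<Rightarrow> real^4 \<Rightarrow> fluid \<Rightarrow> state \<Rightarrow>
      'a::{real_algebra_1, comm_ring_1}^4 \<Rightarrow> 'a^fld^fld" where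
  "princ g x M U \<phi> = (\<chi> i j. \<Sum>\<alpha>\<in>UNIV. of_real (Amat g x M U \<alpha> $ i $ j) * \<phi> $ \<alpha>)"


subsection \<open>Causality\<close>

text \<open>First conjunct (CI): the roots \<open>\<phi>\<^sub>0\<close> are sought in the complex numbers, with
  \<open>\<phi>\<^sub>1, \<phi>\<^sub>2, \<phi>\<^sub>3\<close> real. Second conjunct (CII): characteristic covectors are not timelike.\<close>

definition causal :: "(real^4 \<Rightarrow> real^4^4) \<Rightarrow> real^4 \<Rightarrow> fluid \<Rightarrow> state \<Rightarrow> bool" where
  "causal g x M U \<longleftrightarrow>
     (\<forall>\<phi>::complex^4. (\<forall>i. i \<noteq> 0 \<longrightarrow> \<phi> $ i \<in> \<real>) \<and> det (princ g x M U \<phi>) = 0 \<longrightarrow> \<phi> $ 0 \<in> \<real>) \<and>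
     (\<forall>\<phi>::real^4. det (princ g x M U \<phi>) = 0 \<longrightarrow> \<phi> \<bullet> (matrix_inv (g x) *v \<phi>) \<ge> 0)"


subsection \<open>The characteristic cubic\<close>

text \<open>\<open>e 0, \<dots>, e 3\<close> is an orthonormal eigenbasis of \<open>\<pi>\<^sup>\<mu>\<^sub>\<nu>\<close> with \<open>e 0 = u\<close> and eigenvalues
  \<open>\<Lambda>\<close>. At constrained states \<open>\<Lambda> 0 = 0\<close> and \<open>\<Lambda> 1 + \<Lambda> 2 + \<Lambda> 3 = 0\<close> are consequences.\<close>

definition eigenframe :: "real^4^4 \<Rightarrow> state \<Rightarrow> (4 \<Rightarrow> real^4) \<Rightarrow> (4 \<Rightarrow> real) \<Rightarrow> bool" where
  "eigenframe G U e \<Lambda> \<longleftrightarrow>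
     (\<forall>\<mu>. e 0 $ \<mu> = vel U \<mu>) \<and>
     (\<forall>A B. e A \<bullet> (G *v e B) = minkowski $ A $ B) \<and>
     (\<forall>A \<mu>. (\<Sum>\<alpha>\<in>UNIV. shear_mix G U \<mu> \<alpha> * e A $ \<alpha>) = \<Lambda> A * e A $ \<mu>)"

definition zc :: "state \<Rightarrow> real^4 \<Rightarrow> real" where
  "zc U \<phi> = (\<Sum>\<alpha>\<in>UNIV. vel U \<alpha> * \<phi> $ \<alpha>)"

definition vvec :: "real^4^4 \<Rightarrow> state \<Rightarrow> real^4 \<Rightarrow> real^4" where
  "vvec G U \<phi> = (\<chi> \<mu>. \<Sum>\<alpha>\<in>UNIV. Proj G U \<mu> \<alpha> * \<phi> $ \<alpha>)"

definition vsq :: "real^4^4 \<Rightarrow> state \<Rightarrow> real^4 \<Rightarrow> real" where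
  "vsq G U \<phi> = vvec G U \<phi> \<bullet> (G *v vvec G U \<phi>)"

text \<open>\<open>dirsq c k a\<close> is the squared direction cosine \<open>v\<^sub>a\<^sup>2 / v\<^sup>2\<close> for \<open>\<chi>\<^sup>2 = c\<close>,
  \<open>\<kappa>\<^sup>2 = k\<close>; only \<open>a = 1, 2, 3\<close> matter.\<close>

definition dirsq :: "real \<Rightarrow> real \<Rightarrow> 4 \<Rightarrow> real" where
  "dirsq c k a = (if a = 1 then c * (1 - k) else if a = 2 then (1 - c) * (1 - k)
                  else if a = 3 then k else 0)"

definition Lam_dir :: "(4 \<Rightarrow> real) \<Rightarrow> real \<Rightarrow> real \<Rightarrow> real" where
  "Lam_dir \<Lambda> c k = (\<Sum>a\<in>{1, 2, 3}. \<Lambda> a * dirsq c k a)"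

text \<open>The root \<open>(z/v)\<^sup>2\<close> of the quadratic factor of the characteristic determinant.\<close>

definition quad_root ::
    "real^4^4 \<Rightarrow> fluid \<Rightarrow> state \<Rightarrow> (4 \<Rightarrow> real) \<Rightarrow> real \<Rightarrow> real \<Rightarrow> real" where
  "quad_root G M U \<Lambda> c k =
     ((1/2) * (2 * val (eta M) G U + val (lam_shear_bulk M) G U * bulk U)
        + (1/4) * val (tau_shear_shear M) G U * Lam_dir \<Lambda> c k)
     / (val (tau_shear M) G U * enth M U)"

definition cubic_factorization ::
    "(real^4 \<Rightarrow> real^4^4) \<Rightarrow> real^4 \<Rightarrow> fluid \<Rightarrow> state \<Rightarrow> (4 \<Rightarrow> real^4) \<Rightarrow> (4 \<Rightarrow> real) \<Rightarrow>
      real \<Rightarrow> real \<Rightarrow> real \<Rightarrow> real \<Rightarrow> real \<Rightarrow> bool" where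
  "cubic_factorization g x M U e \<Lambda> c k a0 a1 a2 \<longleftrightarrow>
     (\<forall>\<phi>::real^4. vsq (g x) U \<phi> > 0 \<and>
        (\<forall>a\<in>{1, 2, 3}.
           (vvec (g x) U \<phi> \<bullet> (g x *v e a))\<^sup>2 / vsq (g x) U \<phi> = dirsq c k a) \<longrightarrow>
        (let v = sqrt (vsq (g x) U \<phi>); zh = zc U \<phi> / v in
         det (princ g x M U \<phi>) =
           (\<Prod>A\<in>UNIV. enth M U + \<Lambda> A) * v ^ 23
           * val (tau_bulk M) (g x) U * val (tau_shear M) (g x) U ^ 16 * zh ^ 15
           * (zh\<^sup>2 - quad_root (g x) M U \<Lambda> c k)
           * (zh ^ 6 - a2 * zh ^ 4 + a1 * zh\<^sup>2 - a0)))"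

text \<open>The triple \<open>(\<A>\<^sub>0, \<A>\<^sub>1, \<A>\<^sub>2)\<close> at \<open>\<chi>\<^sup>2 = c\<close>, \<open>\<kappa>\<^sup>2 = k\<close>, defined by the
  factorization of the characteristic determinant.\<close>

definition cubic_coeffs ::
    "(real^4 \<Rightarrow> real^4^4) \<Rightarrow> real^4 \<Rightarrow> fluid \<Rightarrow> state \<Rightarrow> (4 \<Rightarrow> real^4) \<Rightarrow> (4 \<Rightarrow> real) \<Rightarrow>
      real \<Rightarrow> real \<Rightarrow> real \<times> real \<times> real" where
  "cubic_coeffs g x M U e \<Lambda> c k =
     (THE (a0, a1, a2). cubic_factorization g x M U e \<Lambda> c k a0 a1 a2)"

definition cubic_disc :: "real \<Rightarrow> real \<Rightarrow> real \<Rightarrow> real" where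
  "cubic_disc a0 a1 a2 =
     - 27 * (2 * (a2 / 3) ^ 3 - a2 / 3 * a1 + a0)\<^sup>2 - 4 * (a1 - 3 * (a2 / 3)\<^sup>2) ^ 3"


subsection \<open>The principal part in coordinates\<close>

lemma residual_diff_conn:
  "residual G \<Gamma> M U dU - residual G \<Gamma> M U (\<lambda>_. 0)
   = residual G (\<lambda>_ _ _. 0) M U dU - residual G (\<lambda>_ _ _. 0) M U (\<lambda>_. 0)"
proof -
  have "(residual G \<Gamma> M U dU - residual G \<Gamma> M U (\<lambda>_. 0)) $ i
   = (residual G (\<lambda>_ _ _. 0) M U dU - residual G (\<lambda>_ _ _. 0) M U (\<lambda>_. 0)) $ i" for i
    by (cases i) (simp_all add: residual_def cov_vel_def cov_shear_def sum.distrib distrib_left)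
  thus ?thesis by (simp add: vec_eq_iff)
qed

definition lin_res :: "real^4^4 \<Rightarrow> fluid \<Rightarrow> state \<Rightarrow> (4 \<Rightarrow> state) \<Rightarrow> state" where
  "lin_res G M U dU = residual G (\<lambda>_ _ _. 0) M U dU - residual G (\<lambda>_ _ _. 0) M U (\<lambda>_. 0)"

lemma lin_res_add: "lin_res G M U (\<lambda>\<beta>. dU \<beta> + dV \<beta>) = lin_res G M U dU + lin_res G M U dV"
proof -
  have "lin_res G M U (\<lambda>\<beta>. dU \<beta> + dV \<beta>) $ i = (lin_res G M U dU + lin_res G M U dV) $ i" for i
    by (cases i) (simp_all add: lin_res_def residual_def cov_vel_def cov_shear_def sum.distrib
        distrib_left sum_distrib_left)
  thus ?thesis by (simp add: vec_eq_iff)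
qed

lemma lin_res_scale: "lin_res G M U (\<lambda>\<beta>. r *\<^sub>R dU \<beta>) = r *\<^sub>R lin_res G M U dU"
proof -
  have "lin_res G M U (\<lambda>\<beta>. r *\<^sub>R dU \<beta>) $ i = (r *\<^sub>R lin_res G M U dU) $ i" for i
    by (cases i) (simp_all add: lin_res_def residual_def cov_vel_def cov_shear_def
        sum_distrib_left distrib_left right_diff_distrib mult_ac)
  thus ?thesis by (simp add: vec_eq_iff)
qed

lemma lin_res_zero: "lin_res G M U (\<lambda>_. 0) = 0"
  by (simp add: lin_res_def)

lemma lin_res_sum:
  assumes "finite S"
  shows "lin_res G M U (\<lambda>\<beta>. \<Sum>s\<in>S. h s \<beta>) = (\<Sum>s\<in>S. lin_res G M U (h s))"
  using assms by (induction) (simp_all add: lin_res_zero lin_res_add)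

lemma Amat_mult: "Amat g x M U \<alpha> *v \<delta> = lin_res (g x) M U (\<lambda>\<beta>. if \<beta> = \<alpha> then \<delta> else 0)"
proof -
  have "linear (\<lambda>\<delta>. lin_res (g x) M U (\<lambda>\<beta>. if \<beta> = \<alpha> then \<delta> else 0))"
  proof (rule linearI)
    fix a b :: state and r :: real
    have 1: "(\<lambda>\<beta>. if \<beta> = \<alpha> then a + b else 0)
      = (\<lambda>\<beta>. (if \<beta> = \<alpha> then a else 0) + (if \<beta> = \<alpha> then b else 0))"
      by auto
    have 2: "(\<lambda>\<beta>. if \<beta> = \<alpha> then r *\<^sub>R a else 0) = (\<lambda>\<beta>. r *\<^sub>R (if \<beta> = \<alpha> then a else 0))"
      by auto
    show "lin_res (g x) M U (\<lambda>\<beta>. if \<beta> = \<alpha> then a + b else 0) =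
      lin_res (g x) M U (\<lambda>\<beta>. if \<beta> = \<alpha> then a else 0)
      + lin_res (g x) M U (\<lambda>\<beta>. if \<beta> = \<alpha> then b else 0)"
      unfolding 1 by (rule lin_res_add)
    show "lin_res (g x) M U (\<lambda>\<beta>. if \<beta> = \<alpha> then r *\<^sub>R a else 0) =
      r *\<^sub>R lin_res (g x) M U (\<lambda>\<beta>. if \<beta> = \<alpha> then a else 0)"
      unfolding 2 by (rule lin_res_scale)
  qed
  hence "matrix (\<lambda>\<delta>. lin_res (g x) M U (\<lambda>\<beta>. if \<beta> = \<alpha> then \<delta> else 0)) *v \<delta>
      = lin_res (g x) M U (\<lambda>\<beta>. if \<beta> = \<alpha> then \<delta> else 0)"
    by (intro matrix_works) (simp add: linear_matrix_vector_mul_eq)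
  thus ?thesis
    unfolding Amat_def residual_diff_conn[of "g x" "christoffel g x"] lin_res_def[symmetric] .
qed

lemma sum_Amat_mult: "(\<Sum>\<alpha>\<in>UNIV. Amat g x M U \<alpha> *v dU \<alpha>) = lin_res (g x) M U dU"
proof -
  have "(\<lambda>\<beta>. \<Sum>\<alpha>\<in>UNIV. if \<beta> = \<alpha> then dU \<alpha> else 0) = dU"
    by (auto simp: sum.delta)
  thus ?thesis
    using lin_res_sum[of "UNIV :: 4 set" "g x" M U "\<lambda>\<alpha> \<beta>. if \<beta> = \<alpha> then dU \<alpha> else 0"]
    by (simp add: Amat_mult)
qed

lemma residual_quasilinear:
  "residual (g x) (christoffel g x) M U dU =
     (\<Sum>\<alpha>\<in>UNIV. Amat g x M U \<alpha> *v dU \<alpha>) + residual (g x) (christoffel g x) M U (\<lambda>_. 0)"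
  by (simp add: sum_Amat_mult lin_res_def residual_diff_conn[of _ "christoffel g x", symmetric])

lemma princ_mult: "princ g x M U (\<phi> :: real^4) *v \<delta> = lin_res (g x) M U (\<lambda>\<alpha>. \<phi> $ \<alpha> *\<^sub>R \<delta>)"
proof -
  have "princ g x M U \<phi> *v \<delta> = (\<Sum>\<alpha>\<in>UNIV. Amat g x M U \<alpha> *v (\<phi> $ \<alpha> *\<^sub>R \<delta>))"
    by (simp add: vec_eq_iff princ_def matrix_vector_mult_def sum_distrib_left sum_distrib_right
        mult_ac sum.swap[of _ "UNIV :: 4 set"])
  thus ?thesis by (simp add: sum_Amat_mult)
qed

text \<open>\<open>\<pi>\<^sup>\<alpha>\<^sub>\<nu> \<phi>\<^sub>\<alpha>\<close>; this is \<open>w\<^sub>\<nu>\<close> for symmetric \<open>\<pi>\<close>.\<close>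

definition wlow :: "real^4^4 \<Rightarrow> state \<Rightarrow> real^4 \<Rightarrow> 4 \<Rightarrow> real" where
  "wlow G U \<phi> \<nu> = (\<Sum>\<alpha>\<in>UNIV. shear_mix G U \<alpha> \<nu> * \<phi> $ \<alpha>)"

lemma princ_explicit:
  fixes \<phi> :: "real^4"
  assumes "constrained (g x) U"
  defines "z \<equiv> zc U \<phi>" and "w \<equiv> wlow (g x) U \<phi>" and "G \<equiv> g x"
  shows
    "(princ g x M U \<phi> *v \<delta>) $ Vel \<mu> = enth M U * z * vel \<delta> \<mu> - vel U \<mu> * (\<Sum>\<nu>\<in>UNIV. w \<nu> * vel \<delta> \<nu>)
       + vvec G U \<phi> $ \<mu> * (P_energy M U * energy \<delta> + P_particle M U * particle \<delta> + bulk \<delta>)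
       + (\<Sum>\<beta>\<in>UNIV. \<phi> $ \<beta> * shear \<delta> \<mu> \<beta>)"
    "(princ g x M U \<phi> *v \<delta>) $ Energy =
       (\<Sum>\<nu>\<in>UNIV. (enth M U * \<phi> $ \<nu> + w \<nu>) * vel \<delta> \<nu>) + z * energy \<delta>"
    "(princ g x M U \<phi> *v \<delta>) $ Particle =
       (\<Sum>\<nu>\<in>UNIV. particle U * \<phi> $ \<nu> * vel \<delta> \<nu>) + z * particle \<delta>"
    "(princ g x M U \<phi> *v \<delta>) $ Bulk =
       (\<Sum>\<nu>\<in>UNIV. ((val (zeta M) G U + val (delta_bulk M) G U * bulk U) * \<phi> $ \<nu>
                    + val (lam_bulk_shear M) G U * w \<nu>) * vel \<delta> \<nu>)
       + val (tau_bulk M) G U * z * bulk \<delta>"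
    "(princ g x M U \<phi> *v \<delta>) $ Shear \<mu> \<beta> =
       (\<Sum>\<nu>\<in>UNIV. (\<Sum>\<alpha>\<in>UNIV. \<phi> $ \<alpha> * Cpi G M U \<mu> \<beta> \<alpha> \<nu>) * vel \<delta> \<nu>)
       + val (tau_shear M) G U * z * shear \<delta> \<mu> \<beta>"
proof -
  have sym: "shear U \<mu> \<nu> = shear U \<nu> \<mu>" for \<mu> \<nu>
    using assms(1) by (simp add: constrained_def)
  show "(princ g x M U \<phi> *v \<delta>) $ Vel \<mu> = enth M U * z * vel \<delta> \<mu>
       - vel U \<mu> * (\<Sum>\<nu>\<in>UNIV. w \<nu> * vel \<delta> \<nu>)
       + vvec G U \<phi> $ \<mu> * (P_energy M U * energy \<delta> + P_particle M U * particle \<delta> + bulk \<delta>)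
       + (\<Sum>\<beta>\<in>UNIV. \<phi> $ \<beta> * shear \<delta> \<mu> \<beta>)"
  proof -
    have "(\<Sum>\<alpha>\<in>UNIV. \<Sum>\<beta>\<in>UNIV. shear U \<alpha> \<beta> * (\<Sum>\<nu>\<in>UNIV. g x $ \<alpha> $ \<nu> * (\<phi> $ \<beta> * vel \<delta> \<nu>)))
      = (\<Sum>\<nu>\<in>UNIV. w \<nu> * vel \<delta> \<nu>)"
    proof -
      have "(\<Sum>\<nu>\<in>UNIV. w \<nu> * vel \<delta> \<nu>)
        = (\<Sum>\<nu>\<in>UNIV. \<Sum>\<beta>\<in>UNIV. \<Sum>\<alpha>\<in>UNIV. shear U \<alpha> \<beta> * (g x $ \<alpha> $ \<nu> * (\<phi> $ \<beta> * vel \<delta> \<nu>)))"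
        unfolding w_def wlow_def shear_mix_def sum_distrib_right
        by (intro sum.cong refl) (simp add: sym mult_ac)
      also have "\<dots> = (\<Sum>\<beta>\<in>UNIV. \<Sum>\<alpha>\<in>UNIV. \<Sum>\<nu>\<in>UNIV. shear U \<alpha> \<beta> * (g x $ \<alpha> $ \<nu> * (\<phi> $ \<beta> * vel \<delta> \<nu>)))"
        by (rule trans[OF sum.swap], rule sum.cong[OF refl], rule sum.swap)
      also have "\<dots> = (\<Sum>\<alpha>\<in>UNIV. \<Sum>\<beta>\<in>UNIV. \<Sum>\<nu>\<in>UNIV. shear U \<alpha> \<beta> * (g x $ \<alpha> $ \<nu> * (\<phi> $ \<beta> * vel \<delta> \<nu>)))"
        by (rule sum.swap)
      finally show ?thesis by (simp add: sum_distrib_left)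
    qed
    thus ?thesis
      by (simp add: princ_mult lin_res_def residual_def cov_vel_def cov_shear_def z_def G_def
        zc_def vvec_def sum_distrib_left sum_distrib_right distrib_left distrib_right sum.distrib mult_ac)
  qed
  show "(princ g x M U \<phi> *v \<delta>) $ Energy =
       (\<Sum>\<nu>\<in>UNIV. (enth M U * \<phi> $ \<nu> + w \<nu>) * vel \<delta> \<nu>) + z * energy \<delta>"
    apply (simp add: princ_mult lin_res_def residual_def cov_vel_def z_def w_def G_def
        zc_def wlow_def sum_distrib_left sum_distrib_right distrib_left distrib_right sum.distrib mult_ac)
    by (rule sum.swap)
  show "(princ g x M U \<phi> *v \<delta>) $ Particle =
       (\<Sum>\<nu>\<in>UNIV. particle U * \<phi> $ \<nu> * vel \<delta> \<nu>) + z * particle \<delta>"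
    by (simp add: princ_mult lin_res_def residual_def cov_vel_def z_def G_def
        zc_def sum_distrib_left sum_distrib_right mult_ac)
  show "(princ g x M U \<phi> *v \<delta>) $ Bulk =
       (\<Sum>\<nu>\<in>UNIV. ((val (zeta M) G U + val (delta_bulk M) G U * bulk U) * \<phi> $ \<nu>
                    + val (lam_bulk_shear M) G U * w \<nu>) * vel \<delta> \<nu>)
       + val (tau_bulk M) G U * z * bulk \<delta>"
  proof -
    have "(\<Sum>\<alpha>\<in>UNIV. \<Sum>\<nu>\<in>UNIV. (a * kron \<alpha> \<nu> + b * shear_mix (g x) U \<alpha> \<nu>) * (\<phi> $ \<alpha> * vel \<delta> \<nu>))
      = (\<Sum>\<nu>\<in>UNIV. (a * \<phi> $ \<nu> + b * w \<nu>) * vel \<delta> \<nu>)" for a b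
    proof (subst sum.swap, intro sum.cong refl)
      fix \<nu>
      have "(\<Sum>\<alpha>\<in>UNIV. (a * kron \<alpha> \<nu> + b * shear_mix (g x) U \<alpha> \<nu>) * (\<phi> $ \<alpha> * vel \<delta> \<nu>))
        = (\<Sum>\<alpha>\<in>UNIV. if \<alpha> = \<nu> then a * \<phi> $ \<alpha> * vel \<delta> \<nu> else 0)
          + (\<Sum>\<alpha>\<in>UNIV. b * (shear_mix (g x) U \<alpha> \<nu> * \<phi> $ \<alpha>) * vel \<delta> \<nu>)"
        unfolding sum.distrib[symmetric]
        by (intro sum.cong refl) (simp add: kron_def algebra_simps)
      thus "(\<Sum>\<alpha>\<in>UNIV. (a * kron \<alpha> \<nu> + b * shear_mix (g x) U \<alpha> \<nu>) * (\<phi> $ \<alpha> * vel \<delta> \<nu>))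
        = (a * \<phi> $ \<nu> + b * w \<nu>) * vel \<delta> \<nu>"
        by (simp add: w_def wlow_def sum_distrib_left sum_distrib_right distrib_right)
    qed
    note swap = this[of "val (zeta M) (g x) U + val (delta_bulk M) (g x) U * bulk U"
        "val (lam_bulk_shear M) (g x) U"]
    show ?thesis
      by (simp add: princ_mult lin_res_def residual_def cov_vel_def G_def swap)
         (simp add: z_def zc_def sum_distrib_left sum_distrib_right mult_ac)
  qed
  show "(princ g x M U \<phi> *v \<delta>) $ Shear \<mu> \<beta> =
       (\<Sum>\<nu>\<in>UNIV. (\<Sum>\<alpha>\<in>UNIV. \<phi> $ \<alpha> * Cpi G M U \<mu> \<beta> \<alpha> \<nu>) * vel \<delta> \<nu>)
       + val (tau_shear M) G U * z * shear \<delta> \<mu> \<beta>"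
    apply (simp add: princ_mult lin_res_def residual_def cov_vel_def cov_shear_def z_def G_def
        zc_def sum_distrib_left sum_distrib_right mult_ac)
    by (rule sum.swap)
qed

end

theory Submission
  imports Defs "HOL-Computational_Algebra.Fundamental_Theorem_Algebra"
begin

text \<open>In the eigenframe of the shear tensor, eliminating all unknowns but \<open>u\<close> (their equations
  are diagonal in them) reduces the \<open>23 \<times> 23\<close> determinant to a \<open>4 \<times> 4\<close> one. Its time
  row is diagonal and gives the quadratic factor; the spatial \<open>3 \<times> 3\<close> block is diagonal plus a
  matrix with entries \<open>v\<^sub>a v\<^sub>b K\<^sub>a\<^sub>b\<close> and gives the cubic, which depends on the direction through the
  \<open>v\<^sub>a\<^sup>2\<close> only. The inequalities say that all roots of the cubic, and the root of the quadratic
  factor, lie in \<open>[0, 1]\<close>, that is, that in the rest frame all roots \<open>z\<close> are real and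
  \<open>z\<^sup>2 \<le> v\<^sup>2\<close>. Condition (CI) refers to the coordinate time direction instead of the rest frame;
  since no timelike covector is characteristic, Garding's theorem on hyperbolic polynomials moves
  hyperbolicity from either of these two timelike directions to the other.\<close>


subsection \<open>Determinants\<close>

text \<open>Two cancellations shape the reduced matrix. The term \<open>- u w\<close> of the
  momentum equation meets its opposite from the shear equations, which clears the time row; the same
  part of \<open>Cpi\<close>, the one with \<tau>_\<pi>, raises E z^2 to (E + \<Lambda>_a) z^2 in
  the spatial rows, whence the prefactors E + \<Lambda>_a. The obstacle is (CI): it asks for complex
  roots along dx^0, while the coefficients of the cubic are defined by a factorization at real
  covectors split along u. The determinant is therefore computed over any field of characteristic 0,
  and complex covectors reduce to real ones because the symbol is linear in the covector with real
  coefficients. The real factorization still fixes the coefficients, as it can be tested at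
  infinitely many ratios z/v. For the change of time direction, (CII) is at hand on both sides: it
  is part of causality, and in the rest frame it is the bound z^2 \<le> v^2.\<close>

definition subdet :: "('n::finite \<Rightarrow> 'n \<Rightarrow> 'a::comm_ring_1) \<Rightarrow> 'n set \<Rightarrow> 'a" where
  "subdet A T = (\<Sum>p | p permutes T. of_int (sign p) * (\<Prod>i\<in>T. A i (p i)))"

lemma det_subdet: "det A = subdet (\<lambda>i j. A $ i $ j) UNIV"
  by (simp add: det_def subdet_def)

text \<open>A permutation of \<open>T\<close> that moves a point of \<open>S\<close> picks an
  off-diagonal entry of a diagonal row, so only permutations of \<open>T - S\<close> survive.
  Indexing minors by subsets of one type lets the matrix shrink from 23 to 4 to 3 indices without
  reindexing.\<close>

lemma subdet_diag_rows:
  assumes "S \<subseteq> T" and diag: "\<And>i j. i \<in> S \<Longrightarrow> j \<in> T \<Longrightarrow> i \<noteq> j \<Longrightarrow> A i j = 0"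
  shows "subdet A T = (\<Prod>i\<in>S. A i i) * subdet A (T - S)"
proof -
  have fin: "finite T" by simp
  have "subdet A T = (\<Sum>p | p permutes (T - S). of_int (sign p) * (\<Prod>i\<in>T. A i (p i)))"
    unfolding subdet_def
  proof (rule sum.mono_neutral_right)
    show "finite {p. p permutes T}" by (simp add: finite_permutations)
    show "{p. p permutes T - S} \<subseteq> {p. p permutes T}"
      by (auto intro: permutes_subset)
    show "\<forall>p\<in>{p. p permutes T} - {p. p permutes T - S}. of_int (sign p) * (\<Prod>i\<in>T. A i (p i)) = 0"
    proof
      fix p assume "p \<in> {p. p permutes T} - {p. p permutes T - S}"
      hence p: "p permutes T" and np: "\<not> p permutes T - S" by auto
      obtain i where i: "i \<in> S" "p i \<noteq> i"
        using p np permutes_superset[of p T "T - S"] by auto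
      have "A i (p i) = 0"
        using i \<open>S \<subseteq> T\<close> p by (intro diag) (auto simp: permutes_in_image)
      thus "of_int (sign p) * (\<Prod>i\<in>T. A i (p i)) = 0"
        using i \<open>S \<subseteq> T\<close> prod_zero[OF fin] by (metis mult_zero_right subsetD)
    qed
  qed
  also have "\<dots> = (\<Sum>p | p permutes (T - S). (\<Prod>i\<in>S. A i i)
      * (of_int (sign p) * (\<Prod>i\<in>T - S. A i (p i))))"
  proof (rule sum.cong[OF refl])
    fix p assume "p \<in> {p. p permutes (T - S)}"
    hence p: "p permutes (T - S)" by simp
    have "(\<Prod>i\<in>T. A i (p i)) = (\<Prod>i\<in>T - S. A i (p i)) * (\<Prod>i\<in>S. A i (p i))"
      by (rule prod.subset_diff[OF \<open>S \<subseteq> T\<close> fin])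
    also have "(\<Prod>i\<in>S. A i (p i)) = (\<Prod>i\<in>S. A i i)"
      using p by (intro prod.cong) (auto simp: permutes_not_in)
    finally show "of_int (sign p) * (\<Prod>i\<in>T. A i (p i))
      = (\<Prod>i\<in>S. A i i) * (of_int (sign p) * (\<Prod>i\<in>T - S. A i (p i)))"
      by (simp add: mult_ac)
  qed
  finally show ?thesis by (simp add: subdet_def sum_distrib_left)
qed

lemma subdet_empty [simp]: "subdet A {} = 1"
  by (simp add: subdet_def)

lemma subdet_three:
  assumes "a \<noteq> b" "a \<noteq> c" "b \<noteq> c"
  shows "subdet A {a, b, c} =
    A a a * A b b * A c c + A a b * A b c * A c a + A a c * A b a * A c b
    - A a a * A b c * A c b - A a b * A b a * A c c - A a c * A b b * A c a"
proof -
  have f: "finite {b, c}" "a \<notin> {b, c}" "finite {c}" "b \<notin> {c}"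
    using assms by auto
  show ?thesis
    unfolding subdet_def sum_over_permutations_insert[OF f(1,2)]
      sum_over_permutations_insert[OF f(3,4)] permutes_sing
    using assms by (simp add: sign_swap_id permutation_swap_id sign_compose sign_id
        swap_id_eq transpose_def algebra_simps)
qed

text \<open>Elimination by column operations: the unipotent matrix \<open>R\<close> clears the rows
  of \<open>S\<close> outside the pivot block. As that block is diagonal, it is inverted entrywise
  and the Schur complement is an explicit sum.\<close>

lemma det_Schur_diag:
  fixes A :: "'a::field^'n^'n"
  assumes diag: "\<And>i j. i \<in> S \<Longrightarrow> j \<in> S \<Longrightarrow> i \<noteq> j \<Longrightarrow> A $ i $ j = 0"
    and nz: "\<And>i. i \<in> S \<Longrightarrow> A $ i $ i \<noteq> 0"
  shows "det A = (\<Prod>i\<in>S. A $ i $ i)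
    * subdet (\<lambda>i j. A $ i $ j - (\<Sum>k\<in>S. A $ i $ k * A $ k $ j / A $ k $ k)) (- S)"
proof -
  define R :: "'a^'n^'n" where "R = (\<chi> i j. if i = j then 1
    else if i \<in> S \<and> j \<notin> S then - A $ i $ j / A $ i $ i else 0)"
  \<comment> \<open>The rows of \<open>R\<close> outside \<open>S\<close> are rows of the identity;
    once they are removed, the block on \<open>S\<close> is the identity as well.\<close>
  have "det R = (\<Prod>i\<in>-S. R $ i $ i) * subdet (\<lambda>i j. R $ i $ j) (UNIV - - S)"
    unfolding det_subdet by (rule subdet_diag_rows) (auto simp: R_def)
  also have "subdet (\<lambda>i j. R $ i $ j) (UNIV - - S) =
     (\<Prod>i\<in>S. R $ i $ i) * subdet (\<lambda>i j. R $ i $ j) (UNIV - - S - S)"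
    by (rule subdet_diag_rows) (auto simp: R_def)
  finally have "det R = 1" by (simp add: R_def)
  have AR: "(A ** R) $ i $ j = (if j \<in> S then A $ i $ j
     else A $ i $ j - (\<Sum>k\<in>S. A $ i $ k * A $ k $ j / A $ k $ k))" for i j
  proof (cases "j \<in> S")
    case True
    have "(A ** R) $ i $ j = (\<Sum>k\<in>UNIV. if k = j then A $ i $ j else 0)"
      unfolding matrix_matrix_mult_def vec_lambda_beta
      using True by (intro sum.cong refl) (auto simp: R_def)
    thus ?thesis using True by simp
  next
    case False
    have "(A ** R) $ i $ j = (\<Sum>k\<in>UNIV. (if k = j then A $ i $ j else 0)
        + (if k \<in> S then - (A $ i $ k * A $ k $ j / A $ k $ k) else 0))"
      unfolding matrix_matrix_mult_def vec_lambda_beta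
      using False by (intro sum.cong refl) (auto simp: R_def)
    also have "\<dots> = A $ i $ j + (\<Sum>k\<in>S. - (A $ i $ k * A $ k $ j / A $ k $ k))"
      by (simp add: sum.distrib sum.If_cases)
    finally show ?thesis using False by (simp add: sum_negf)
  qed
  have row: "A $ i $ j - (\<Sum>k\<in>S. A $ i $ k * A $ k $ j / A $ k $ k) = 0" if "i \<in> S" for i j
  proof -
    have "(\<Sum>k\<in>S. A $ i $ k * A $ k $ j / A $ k $ k) = (\<Sum>k\<in>S. if k = i then A $ i $ j else 0)"
      using that diag[OF that] nz by (intro sum.cong refl) auto
    thus ?thesis using that by simp
  qed
  have "det A = det (A ** R)" by (simp add: det_mul \<open>det R = 1\<close>)
  also have "\<dots> = (\<Prod>i\<in>S. (A ** R) $ i $ i) * subdet (\<lambda>i j. (A ** R) $ i $ j) (UNIV - S)"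
    unfolding det_subdet by (rule subdet_diag_rows) (auto simp: AR row diag)
  also have "(\<Prod>i\<in>S. (A ** R) $ i $ i) = (\<Prod>i\<in>S. A $ i $ i)"
    by (intro prod.cong) (auto simp: AR)
  also have "subdet (\<lambda>i j. (A ** R) $ i $ j) (UNIV - S)
     = subdet (\<lambda>i j. A $ i $ j - (\<Sum>k\<in>S. A $ i $ k * A $ k $ j / A $ k $ k)) (- S)"
    unfolding subdet_def Compl_eq_Diff_UNIV
    by (intro sum.cong refl arg_cong2[where f = "(*)"] prod.cong)
       (auto simp: AR dest: permutes_in_image)
  finally show ?thesis .
qed


subsection \<open>Cubics with all roots in the unit interval\<close>

text \<open>Let F be the cubic. The discriminant makes all roots real, and the alternating signs of
  the coefficients exclude negative ones. The other inequalities say that F(1), F'(1)/3 and F''(1)/6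
  are nonnegative: the Taylor coefficients of F(1 + t), which exclude roots above 1 in the same
  way.\<close>

lemma cubic_roots_unit_interval:
  fixes a0 a1 a2 :: real
  shows "(\<forall>y::complex. y ^ 3 - of_real a2 * y\<^sup>2 + of_real a1 * y - of_real a0 = 0 \<longrightarrow>
       (\<exists>r::real. y = of_real r \<and> 0 \<le> r \<and> r \<le> 1)) \<longleftrightarrow>
     0 \<le> cubic_disc a0 a1 a2 \<and> 0 \<le> a2 / 3 \<and> a2 / 3 \<le> 1 \<and> 0 \<le> a1 \<and> 0 \<le> a0 \<and>
     0 \<le> 1 - a2 + a1 - a0 \<and> 0 \<le> 1 - 2 / 3 * a2 + 1 / 3 * a1"
    (is "?L \<longleftrightarrow> ?R")
proof -
  define F where "F y = y ^ 3 - a2 * y\<^sup>2 + a1 * y - a0" for y :: real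
  obtain r where r: "F r = 0"
  proof -
    have Fp: "F y = y * y * (y - a2) + a1 * y - a0" and Fm: "F (- y) = - (y * y * (y + a2)) - a1 * y - a0" for y
      unfolding F_def by (simp_all add: power2_eq_square power3_eq_cube algebra_simps)
    \<comment> \<open>Large enough for the cubic term to dominate at \<open>m\<close> and
      \<open>- m\<close>, so that \<open>F\<close> changes sign in between.\<close>
    define m where "m = 1 + \<bar>a2\<bar> + \<bar>a1\<bar> + \<bar>a0\<bar>"
    have m: "m \<ge> 1" "m - a2 \<ge> 1 + \<bar>a1\<bar> + \<bar>a0\<bar>" "m + a2 \<ge> 1 + \<bar>a1\<bar> + \<bar>a0\<bar>"
      unfolding m_def by auto
    have mm: "m * m * (1 + \<bar>a1\<bar> + \<bar>a0\<bar>) \<ge> m * (1 + \<bar>a1\<bar> + \<bar>a0\<bar>)"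
      using m by (intro mult_right_mono) auto
    have "\<bar>a1\<bar> * m + \<bar>a0\<bar> \<le> m * (1 + \<bar>a1\<bar> + \<bar>a0\<bar>)"
      using m mult_right_mono[of 1 m "\<bar>a0\<bar>"] by (simp add: algebra_simps)
    moreover have "m * m * (m - a2) \<ge> m * m * (1 + \<bar>a1\<bar> + \<bar>a0\<bar>)"
      using m by (intro mult_left_mono) auto
    moreover have "m * m * (m + a2) \<ge> m * m * (1 + \<bar>a1\<bar> + \<bar>a0\<bar>)"
      using m by (intro mult_left_mono) auto
    moreover have "a1 * m \<ge> - (\<bar>a1\<bar> * m)" "a1 * m \<le> \<bar>a1\<bar> * m"
      using m mult_right_mono[of "-\<bar>a1\<bar>" a1 m] mult_right_mono[of a1 "\<bar>a1\<bar>" m] by auto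
    ultimately have "F m \<ge> 0" "F (- m) \<le> 0"
      unfolding Fp[of m] Fm[of m] using mm by linarith+
    moreover have "continuous_on {-m..m} F"
      unfolding F_def by (intro continuous_intros)
    ultimately have "\<exists>y\<ge>-m. y \<le> m \<and> F y = 0"
      using m by (intro IVT') auto
    thus ?thesis using that by blast
  qed
  define b c where "b = r - a2" and "c = r\<^sup>2 - a2 * r + a1"
  have a: "a2 = r - b" "a1 = c - r * b" "a0 = r * c"
    using r unfolding b_def c_def F_def by (auto simp: power2_eq_square power3_eq_cube algebra_simps)
  \<comment> \<open>The squared factor is the quadratic factor at \<open>r\<close>, that is, the
    product of the differences between \<open>r\<close> and the other two roots. If these are not
    real, it is positive and the discriminant negative.\<close>
  have disc: "cubic_disc a0 a1 a2 = (b\<^sup>2 - 4 * c) * (r\<^sup>2 + b * r + c)\<^sup>2"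
    unfolding cubic_disc_def a by (simp add: field_simps power2_eq_square power3_eq_cube)
  have fact: "y ^ 3 - of_real a2 * y\<^sup>2 + of_real a1 * y - of_real a0
     = (y - of_real r) * (y\<^sup>2 + of_real b * y + of_real c)" for y :: complex
    unfolding a by (simp add: algebra_simps power2_eq_square power3_eq_cube)
  have factR: "F y = (y - r) * (y\<^sup>2 + b * y + c)" for y
    unfolding F_def a by (simp add: algebra_simps power2_eq_square power3_eq_cube)
  have sq: "y\<^sup>2 + of_real b * y + of_real c = (y - s) * (y - (- of_real b - s))"
    if "s * s + of_real b * s + of_real c = 0" for y s :: complex
    using that by algebra
  show ?thesis
  proof
    assume L: ?L
    define s :: complex where "s = (- of_real b + csqrt (of_real (b\<^sup>2 - 4 * c))) / 2"
    have s: "s * s + of_real b * s + of_real c = 0"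
    proof -
      have "2 * s + of_real b = csqrt (of_real (b\<^sup>2 - 4 * c))" by (simp add: s_def field_simps)
      hence "(2 * s + of_real b)\<^sup>2 = of_real (b\<^sup>2 - 4 * c)" by (metis power2_csqrt)
      hence "4 * (s * s + of_real b * s + of_real c) = 0"
        by (simp add: algebra_simps power2_eq_square)
      thus ?thesis by (metis mult_eq_0_iff zero_neq_numeral)
    qed
    from L fact[of s] s obtain s1 where s1: "s = of_real s1" "0 \<le> s1" "s1 \<le> 1"
      by (auto simp: power2_eq_square)
    from L fact[of "- of_real b - s"] sq[OF s, of "- of_real b - s"] obtain s2
      where s2: "- of_real b - s = of_real s2" "0 \<le> s2" "s2 \<le> 1" by auto
    from L fact[of "of_real r"] have r1: "0 \<le> r" "r \<le> 1" by auto
    have "complex_of_real b = - (- of_real b - s) - s" by simp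
    also have "\<dots> = of_real (- s1 - s2)" unfolding s2(1) unfolding s1(1) by simp
    finally have "complex_of_real b = of_real (- s1 - s2)" .
    hence b: "b = - s1 - s2" by (simp only: of_real_eq_iff)
    have "complex_of_real c = of_real (s1 * s2)"
      using s unfolding s1 b by (simp add: algebra_simps)
    hence c: "c = s1 * s2" by (simp only: of_real_eq_iff)
    have a': "a2 = r + s1 + s2" "a1 = s1 * s2 + r * s1 + r * s2" "a0 = r * s1 * s2"
      unfolding a b c by (auto simp: algebra_simps)
    have "cubic_disc a0 a1 a2 = ((s1 - s2) * (r\<^sup>2 + b * r + c))\<^sup>2"
      unfolding disc b c by (simp add: algebra_simps power2_eq_square)
    moreover have "1 - a2 + a1 - a0 = (1 - r) * (1 - s1) * (1 - s2)"
      "1 - 2 / 3 * a2 + 1 / 3 * a1 =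
        ((1 - r) * (1 - s1) + (1 - r) * (1 - s2) + (1 - s1) * (1 - s2)) / 3"
      unfolding a' by (auto simp: algebra_simps)
    moreover have "0 \<le> (1 - r) * (1 - s1) * (1 - s2)"
      "0 \<le> (1 - r) * (1 - s1) + (1 - r) * (1 - s2) + (1 - s1) * (1 - s2)"
      "0 \<le> a2" "a2 \<le> 3" "0 \<le> a1" "0 \<le> a0"
      using s1 s2 r1 by (auto simp: a' intro!: add_nonneg_nonneg mult_nonneg_nonneg)
    ultimately show ?R by (simp del: times_divide_eq_left)
  next
    assume R: ?R
    have bound: "0 \<le> y \<and> y \<le> 1" if "F y = 0" for y
    proof
      show "0 \<le> y"
      proof (rule ccontr)
        assume "\<not> 0 \<le> y"
        hence y: "y < 0" by simp
        hence "y ^ 3 < 0" by (simp add: power3_eq_cube mult_neg_neg mult_pos_neg)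
        moreover have "a2 * y\<^sup>2 \<ge> 0" "a1 * y \<le> 0" using R y by (auto intro: mult_nonneg_nonpos)
        ultimately show False using that R unfolding F_def by linarith
      qed
      show "y \<le> 1"
      proof (rule ccontr)
        assume "\<not> y \<le> 1"
        define t where "t = y - 1"
        hence t: "t > 0" using \<open>\<not> y \<le> 1\<close> by simp
        have "F y = t ^ 3 + (3 - a2) * t\<^sup>2 + (3 - 2 * a2 + a1) * t + (1 - a2 + a1 - a0)"
          unfolding F_def t_def by (simp add: algebra_simps power2_eq_square power3_eq_cube)
        moreover have "t ^ 3 > 0" "(3 - a2) * t\<^sup>2 \<ge> 0" "(3 - 2 * a2 + a1) * t \<ge> 0"
          using t R by (auto intro!: mult_nonneg_nonneg)
        ultimately show False using that R by linarith
      qed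
    qed
    have nn: "b\<^sup>2 - 4 * c \<ge> 0"
    proof (rule ccontr)
      assume neg: "\<not> ?thesis"
      have "4 * (r\<^sup>2 + b * r + c) = (2 * r + b)\<^sup>2 - (b\<^sup>2 - 4 * c)"
        by (simp add: algebra_simps power2_eq_square)
      also have "\<dots> > 0" using neg by (smt (verit) zero_le_power2)
      finally have "(r\<^sup>2 + b * r + c)\<^sup>2 > 0" by simp
      hence "cubic_disc a0 a1 a2 < 0" unfolding disc using neg by (intro mult_neg_pos) auto
      thus False using R by simp
    qed
    define s where "s = (- b + sqrt (b\<^sup>2 - 4 * c)) / 2"
    have "2 * s + b = sqrt (b\<^sup>2 - 4 * c)" by (simp add: s_def field_simps)
    hence "(2 * s + b)\<^sup>2 = b\<^sup>2 - 4 * c" using nn by simp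
    hence s: "s * s + b * s + c = 0" by (simp add: algebra_simps power2_eq_square)
    hence sC: "of_real s * of_real s + of_real b * of_real s + complex_of_real c = 0"
      by (metis of_real_0 of_real_add of_real_mult)
    show ?L
    proof (intro allI impI)
      fix y :: complex
      assume "y ^ 3 - of_real a2 * y\<^sup>2 + of_real a1 * y - of_real a0 = 0"
      hence "y - of_real r = 0 \<or> y - of_real s = 0 \<or> y - (- of_real b - of_real s) = 0"
        unfolding fact sq[OF sC] mult_eq_0_iff by blast
      hence "y = of_real r \<or> y = of_real s \<or> y = of_real (- b - s)"
        by (simp only: right_minus_eq of_real_minus of_real_diff)
      moreover have "F r = 0" "F s = 0"
        using s by (auto simp: factR power2_eq_square)
      moreover have "F (- b - s) = 0"
        using s by (auto simp: factR power2_eq_square algebra_simps)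
      ultimately show "\<exists>r::real. y = of_real r \<and> 0 \<le> r \<and> r \<le> 1" using bound by blast
    qed
  qed
qed

text \<open>Apart from a power of \<zeta> = z/v the determinant is a polynomial in \<zeta>^2; this
  passes from the ratio \<zeta> to the roots y = \<zeta>^2 of its factors. A real square root makes
  y real and nonnegative.\<close>

lemma csquare_unit_interval:
  fixes y :: complex
  shows "(\<forall>\<zeta>. \<zeta>\<^sup>2 = y \<longrightarrow> \<zeta> \<in> \<real> \<and> (Re \<zeta>)\<^sup>2 \<le> 1) \<longleftrightarrow> (\<exists>r. y = of_real r \<and> 0 \<le> r \<and> r \<le> 1)"
proof
  assume L: "\<forall>\<zeta>. \<zeta>\<^sup>2 = y \<longrightarrow> \<zeta> \<in> \<real> \<and> (Re \<zeta>)\<^sup>2 \<le> 1"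
  have "csqrt y \<in> \<real>" "(Re (csqrt y))\<^sup>2 \<le> 1"
    using L power2_csqrt by blast+
  moreover from this have "y = of_real ((Re (csqrt y))\<^sup>2)"
    by (metis complex_is_Real_iff of_real_Re of_real_power power2_csqrt)
  ultimately show "\<exists>r. y = of_real r \<and> 0 \<le> r \<and> r \<le> 1" by (metis zero_le_power2)
next
  assume "\<exists>r. y = of_real r \<and> 0 \<le> r \<and> r \<le> 1"
  then obtain r where r: "y = of_real r" "0 \<le> r" "r \<le> 1" by blast
  show "\<forall>\<zeta>. \<zeta>\<^sup>2 = y \<longrightarrow> \<zeta> \<in> \<real> \<and> (Re \<zeta>)\<^sup>2 \<le> 1"
  proof (intro allI impI)
    fix \<zeta> assume "\<zeta>\<^sup>2 = y"
    also have "y = (of_real (sqrt r))\<^sup>2" using r by (simp flip: of_real_power)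
    finally have "\<zeta> = of_real (sqrt r) \<or> \<zeta> = - of_real (sqrt r)" by (simp add: power2_eq_iff)
    thus "\<zeta> \<in> \<real> \<and> (Re \<zeta>)\<^sup>2 \<le> 1" using r by auto
  qed
qed


subsection \<open>Hyperbolic pencils\<close>

text \<open>Meant for the Leibniz terms of det(X + t Y). The coefficient at \<open>card S\<close>
  replaces the leading coefficient, since factors with \<open>b i = 0\<close> lower the
  degree.\<close>

lemma coeff_prod_linear:
  fixes a b :: "'i \<Rightarrow> 'a::comm_ring_1"
  assumes "finite S"
  shows "degree (\<Prod>i\<in>S. [:a i, b i:]) \<le> card S \<and> coeff (\<Prod>i\<in>S. [:a i, b i:]) (card S) = (\<Prod>i\<in>S. b i)"
  using assms
proof (induction S rule: finite_induct)
  case (insert x S)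
  let ?p = "\<Prod>i\<in>S. [:a i, b i:]"
  have "degree ([:a x, b x:] * ?p) \<le> degree [:a x, b x:] + degree ?p"
    by (rule degree_mult_le)
  also have "\<dots> \<le> 1 + card S" using insert.IH by (intro add_mono) auto
  finally have "degree ([:a x, b x:] * ?p) \<le> 1 + card S" .
  moreover have "coeff ?p (Suc (card S)) = 0"
    using insert.IH by (intro coeff_eq_0) auto
  ultimately show ?case using insert by (simp add: mult.commute)
qed simp

text \<open>In t, det(X + t Y) is a polynomial of degree \<open>CARD('n)\<close> with leading
  coefficient det Y, so its modulus is that of det Y times the product of the distances from t to
  the roots. The nearest root is bounded by this product; the result is a quantitative continuity of
  roots.\<close>

lemma root_near_nonroot:
  fixes X Y :: "complex^'n^'n"
  assumes Y: "det Y \<noteq> 0"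
  shows "\<exists>r. det (\<chi> i j. X $ i $ j + r * Y $ i $ j) = 0 \<and>
    norm (t - r) ^ CARD('n) \<le> norm (det (\<chi> i j. X $ i $ j + t * Y $ i $ j)) / norm (det Y)"
proof -
  define Q where "Q = (\<Sum>p | p permutes (UNIV :: 'n set).
    smult (of_int (sign p)) (\<Prod>i\<in>UNIV. [:X $ i $ p i, Y $ i $ p i:]))"
  have Q: "poly Q s = det (\<chi> i j. X $ i $ j + s * Y $ i $ j)" for s
    by (simp add: Q_def det_def poly_sum poly_prod)
  have "coeff Q CARD('n) = det Y"
    unfolding Q_def det_def coeff_sum coeff_smult
    by (intro sum.cong refl arg_cong2[where f = "(*)"] conjunct2[OF coeff_prod_linear]) simp
  moreover have "degree Q \<le> CARD('n)"
    unfolding Q_def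
    by (intro degree_sum_le order_trans[OF degree_smult_le] conjunct1[OF coeff_prod_linear])
       (simp_all add: finite_permutations)
  ultimately have deg: "degree Q = CARD('n)" and lead: "lead_coeff Q = det Y"
    using Y le_degree[of Q "CARD('n)"] by auto
  have "Q \<noteq> 0" using deg by auto
  obtain A where A: "size A = CARD('n)" "Q = smult (det Y) (\<Prod>x\<in>#A. [:-x, 1:])"
    using alg_closed_imp_factorization[OF \<open>Q \<noteq> 0\<close>] deg lead by auto
  have val: "poly Q s = det Y * (\<Prod>x\<in>#A. s - x)" for s
    by (simp add: A(2) poly_prod_mset)
  define m where "m = Min ((\<lambda>x. norm (t - x)) ` set_mset A)"
  have "A \<noteq> {#}" using A(1) by auto
  hence "m \<in> (\<lambda>x. norm (t - x)) ` set_mset A" unfolding m_def by (intro Min_in) auto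
  then obtain r where r: "r \<in># A" "m = norm (t - r)" by auto
  \<comment> \<open>The induction runs over sub-multisets of \<open>A\<close>, so that
    \<open>m\<close> remains the minimum over all of \<open>A\<close>.\<close>
  have "m ^ size B \<le> norm (\<Prod>x\<in>#B. t - x)" if "B \<subseteq># A" for B
    using that
  proof (induction B)
    case (add x B)
    have "B \<subseteq># A" "x \<in># A"
      using add.prems by (auto dest: mset_subset_eq_insertD)
    hence "m \<le> norm (t - x)" unfolding m_def by (intro Min_le) auto
    hence "m * m ^ size B \<le> norm (t - x) * norm (\<Prod>x\<in>#B. t - x)"
      using add.IH[OF \<open>B \<subseteq># A\<close>] r by (intro mult_mono) auto
    thus ?case by (simp add: norm_mult)
  qed simp
  from this[of A] have "norm (t - r) ^ CARD('n) \<le> norm (\<Prod>x\<in>#A. t - x)" using A r by simp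
  also have "\<dots> = norm (poly Q t) / norm (det Y)" using Y by (simp add: val norm_mult)
  finally have "norm (t - r) ^ CARD('n) \<le> norm (poly Q t) / norm (det Y)" .
  moreover have "poly Q r = 0" using r(1) by (auto simp: val prod_mset_zero_iff)
  ultimately show ?thesis unfolding Q by blast
qed

text \<open>\<open>princ\<close> for an arbitrary family of real matrices, so that hyperbolicity can
  be studied apart from the fluid.\<close>

definition pencil :: "('m \<Rightarrow> real^'n^'n) \<Rightarrow> 'a::{real_algebra_1, comm_ring_1}^'m::finite \<Rightarrow> 'a^'n^'n" where
  "pencil A \<phi> = (\<chi> i j. \<Sum>\<alpha>\<in>UNIV. of_real (A \<alpha> $ i $ j) * \<phi> $ \<alpha>)"

definition cvec :: "real^'m \<Rightarrow> complex^'m" where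
  "cvec v = (\<chi> i. of_real (v $ i))"

lemma cvec_nth [simp]: "cvec v $ i = of_real (v $ i)"
  by (simp add: cvec_def)

lemma det_pencil_scale: "det (pencil A (t *s \<phi>) :: complex^'n^'n) = t ^ CARD('n) * det (pencil A \<phi>)"
proof -
  have "pencil A (t *s \<phi>) = (\<chi> i. t *s pencil A \<phi> $ i)"
    by (simp add: pencil_def vec_eq_iff sum_distrib_left mult_ac)
  thus ?thesis using det_rows_mul[of "\<lambda>_. t" "\<lambda>i. pencil A \<phi> $ i"] by simp
qed

lemma continuous_det_pencil:
  fixes h :: "'b::topological_space \<Rightarrow> complex^'m"
  assumes "continuous_on S h"
  shows "continuous_on S (\<lambda>y. det (pencil A (h y) :: complex^'n^'n))"
  unfolding det_def pencil_def vec_lambda_beta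
  by (intro continuous_intros assms)

lemma det_pencil_cnj:
  "det (pencil A (\<chi> i. cnj (\<phi> $ i)) :: complex^'n^'n) = cnj (det (pencil A \<phi>))"
  by (simp add: det_def pencil_def cnj_sum cnj_prod)

lemma det_pencil_root_near:
  assumes "det (pencil A \<xi> :: complex^'n^'n) \<noteq> 0"
  shows "\<exists>r. det (pencil A (\<psi> + r *s \<xi>) :: complex^'n^'n) = 0 \<and>
    norm (t - r) ^ CARD('n) \<le> norm (det (pencil A (\<psi> + t *s \<xi>) :: complex^'n^'n)) / norm (det (pencil A \<xi> :: complex^'n^'n))"
proof -
  have "(\<chi> i j. (pencil A \<psi> :: complex^'n^'n) $ i $ j + r * pencil A \<xi> $ i $ j) = pencil A (\<psi> + r *s \<xi>)" for r
    by (simp add: vec_eq_iff pencil_def sum.distrib[symmetric] sum_distrib_left algebra_simps)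
  thus ?thesis using root_near_nonroot[OF assms, of "pencil A \<psi>" t] by simp
qed

text \<open>Garding's theorem. The roots \<open>t\<close> of
  \<open>det (pencil A (\<i> \<theta> + t \<xi> + s \<psi>))\<close> lie in the lower half plane for \<open>s = 0\<close> and can never cross
  the real axis as \<open>s\<close> varies, since \<open>\<i>\<close> would be a root in the direction \<open>\<theta>\<close>.\<close>

lemma hyperbolic_direction_transfer:
  fixes A :: "'m::finite \<Rightarrow> real^'n^'n"
  defines "p \<equiv> \<lambda>\<phi>. det (pencil A \<phi> :: complex^'n^'n)"
  assumes hyp: "\<And>\<psi> t. p (cvec \<psi> + t *s cvec \<theta>) = 0 \<Longrightarrow> t \<in> \<real>"
    and cone: "\<And>\<sigma>. \<sigma> \<ge> 0 \<Longrightarrow> p (cvec (\<theta> + \<sigma> *\<^sub>R \<xi>)) \<noteq> 0" and xi: "p (cvec \<xi>) \<noteq> 0"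
    and root: "p (cvec \<psi> + t *s cvec \<xi>) = 0"
  shows "t \<in> \<real>"
proof -
  define q where "q \<psi> s t = p (\<i> *s cvec \<theta> + t *s cvec \<xi> + of_real s *s cvec \<psi>)"
    for \<psi> :: "real^'m" and s :: real and t :: complex
  have cont: "continuous_on S (\<lambda>y. p (h y))" if "continuous_on S h" for S and h :: "'b::topological_space \<Rightarrow> _"
    unfolding p_def by (rule continuous_det_pencil[OF that])
  have smult_cont: "continuous_on S (\<lambda>y. c y *s v)" if "continuous_on S c"
    for S and c :: "'b::topological_space \<Rightarrow> complex" and v :: "complex^'m"
    unfolding vector_scalar_mult_def by (intro continuous_intros that)
  have scale: "p (t *s \<phi>) = t ^ CARD('n) * p \<phi>" for t \<phi>
    unfolding p_def by (rule det_pencil_scale)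
  have real_t: "q \<psi> s (of_real t) \<noteq> 0" for \<psi> s t
  proof
    assume "q \<psi> s (of_real t) = 0"
    moreover have "\<i> *s cvec \<theta> + of_real t *s cvec \<xi> + of_real s *s cvec \<psi>
        = cvec (t *\<^sub>R \<xi> + s *\<^sub>R \<psi>) + \<i> *s cvec \<theta>"
      by (simp add: vec_eq_iff)
    ultimately have "\<i> \<in> \<real>" using hyp[of "t *\<^sub>R \<xi> + s *\<^sub>R \<psi>" \<i>] by (simp add: q_def)
    thus False by (simp add: complex_is_Real_iff)
  qed
  \<comment> \<open>By homogeneity \<open>\<i> / t\<close> is a root in the direction \<theta> from
    the base point \<xi>, hence a real number \<rho>. Then t = \<i>/\<rho>, and Im t \<ge> 0 forces
    \<rho> > 0, so that \<theta> + \<xi>/\<rho> would be a zero excluded by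
    \<open>cone\<close>.\<close>
  have start: "q \<psi> 0 t \<noteq> 0" if "Im t \<ge> 0" for \<psi> t
  proof
    assume q0: "q \<psi> 0 t = 0"
    show False
    proof (cases "t = 0")
      case True
      thus False using real_t[of \<psi> 0 0] q0 by simp
    next
      case False
      have "\<i> *s cvec \<theta> + t *s cvec \<xi> = t *s (cvec \<xi> + (\<i> / t) *s cvec \<theta>)"
        using False by (simp add: vec_eq_iff field_simps)
      hence "p (\<i> *s cvec \<theta> + t *s cvec \<xi>) = t ^ CARD('n) * p (cvec \<xi> + (\<i> / t) *s cvec \<theta>)"
        by (simp only: scale)
      hence "p (cvec \<xi> + (\<i> / t) *s cvec \<theta>) = 0"
        using q0 False by (simp add: q_def)
      moreover from this have "\<i> / t \<in> \<real>" by (rule hyp)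
      then obtain \<rho> where \<rho>: "\<i> / t = of_real \<rho>" by (auto elim: Reals_cases)
      have "\<rho> \<noteq> 0" using \<rho> False by auto
      have "t = of_real (1 / \<rho>) * \<i>" using \<rho> False \<open>\<rho> \<noteq> 0\<close> by (simp add: field_simps)
      hence "\<rho> > 0" using that \<open>\<rho> \<noteq> 0\<close> by simp
      moreover have "cvec \<xi> + of_real \<rho> *s cvec \<theta> = of_real \<rho> *s cvec (\<theta> + (1 / \<rho>) *\<^sub>R \<xi>)"
        using \<open>\<rho> \<noteq> 0\<close> by (simp add: vec_eq_iff field_simps)
      ultimately show False
        using cone[of "1 / \<rho>"] \<rho> by (simp add: scale)
    qed
  qed
  \<comment> \<open>The set \<open>B\<close> of parameters s with a root in the closed upper half
    plane is clopen in the unit interval: closed because the roots stay bounded, open because a root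
    off the real axis survives a small change of s. It misses 0, hence is empty.\<close>
  have upper: "q \<psi> s t \<noteq> 0" if "Im t \<ge> 0" "s \<in> {0..1}" for \<psi> s t
  proof -
    obtain \<delta> where \<delta>: "\<delta> > 0" "\<And>\<phi>. norm (\<phi> - cvec \<xi>) < \<delta> \<Longrightarrow> p \<phi> \<noteq> 0"
    proof -
      have "open (p -` (- {0}))"
        using cont[of UNIV "\<lambda>y. y"] by (auto intro!: open_vimage)
      moreover have "cvec \<xi> \<in> p -` (- {0})" using xi by simp
      ultimately obtain d where "d > 0" "ball (cvec \<xi>) d \<subseteq> p -` (- {0})"
        using open_contains_ball by blast
      thus ?thesis using that[of d] by (auto simp: dist_norm norm_minus_commute subset_iff)
    qed
    define C where "C = norm (\<i> *s cvec \<theta>) + norm (cvec \<psi>)"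
    define R where "R = C / \<delta> + 1"
    have "C \<ge> 0" by (simp add: C_def)
    have nsm: "norm (c *s v) = norm c * norm v" for c :: complex and v :: "complex^'m"
      by (simp add: norm_vec_def norm_mult L2_set_left_distrib L2_set_def power_mult_distrib
          sum_distrib_left[symmetric] real_sqrt_mult)
    \<comment> \<open>By homogeneity a root of large modulus would give a zero of \<open>p\<close>
      close to \<xi>, inside the ball of radius \<delta> that contains none.\<close>
    have bounded: "norm t \<le> R" if "q \<psi> s t = 0" "s \<in> {0..1}" for s t
    proof (rule ccontr)
      assume "\<not> norm t \<le> R"
      hence t: "norm t > R" by simp
      hence t0: "norm t > 0" using \<open>C \<ge> 0\<close> \<delta>(1) unfolding R_def
        by (smt (verit) divide_nonneg_pos)
      hence "t \<noteq> 0" by auto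
      have "\<i> *s cvec \<theta> + t *s cvec \<xi> + of_real s *s cvec \<psi>
         = t *s (cvec \<xi> + (1 / t) *s (\<i> *s cvec \<theta> + of_real s *s cvec \<psi>))"
        using \<open>t \<noteq> 0\<close> by (simp add: vec_eq_iff field_simps)
      hence "q \<psi> s t = t ^ CARD('n) * p (cvec \<xi> + (1 / t) *s (\<i> *s cvec \<theta> + of_real s *s cvec \<psi>))"
        unfolding q_def by (simp only: scale)
      hence "p (cvec \<xi> + (1 / t) *s (\<i> *s cvec \<theta> + of_real s *s cvec \<psi>)) = 0"
        using that \<open>t \<noteq> 0\<close> by simp
      hence "\<not> norm ((1 / t) *s (\<i> *s cvec \<theta> + of_real s *s cvec \<psi>)) < \<delta>"
        using \<delta>(2) by force
      moreover have "norm (\<i> *s cvec \<theta> + of_real s *s cvec \<psi>) \<le> C"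
      proof -
        have "norm (of_real s *s cvec \<psi>) \<le> 1 * norm (cvec \<psi>)"
          unfolding nsm using that by (intro mult_right_mono) auto
        thus ?thesis unfolding C_def by (intro norm_triangle_le) auto
      qed
      moreover have "norm ((1 / t) *s v) = norm v / norm t" for v :: "complex^'m"
        by (simp only: nsm) (simp add: norm_divide)
      ultimately have "\<delta> \<le> C / norm t"
        using divide_right_mono[of "norm (\<i> *s cvec \<theta> + complex_of_real s *s cvec \<psi>)" C "norm t"]
        by (metis norm_ge_zero not_le_imp_less order_trans)
      hence "norm t \<le> C / \<delta>" using t0 \<delta>(1) by (simp add: field_simps)
      thus False using t by (simp add: R_def)
    qed
    define Z where "Z = {y \<in> {0..1} \<times> (cball 0 R \<inter> {t. Im t \<ge> 0}). q \<psi> (fst y) (snd y) = 0}"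
    define B where "B = {s \<in> {0..1}. \<exists>t. Im t \<ge> 0 \<and> q \<psi> s t = 0}"
    have qcont: "continuous_on S (\<lambda>y. q \<psi> (fst y) (snd y))" for S
      unfolding q_def by (intro cont continuous_intros smult_cont)
    have K: "compact ({0..1::real} \<times> (cball 0 R \<inter> {t. Im t \<ge> 0}))"
      by (intro compact_Times compact_Int_closed compact_cball closed_halfspace_Im_ge) auto
    have "closed Z"
      unfolding Z_def
      by (rule continuous_closed_preimage_constant[OF qcont compact_imp_closed[OF K]])
    hence "compact (({0..1::real} \<times> (cball 0 R \<inter> {t. Im t \<ge> 0})) \<inter> Z)"
      by (rule compact_Int_closed[OF K])
    also have "({0..1::real} \<times> (cball 0 R \<inter> {t. Im t \<ge> 0})) \<inter> Z = Z"
      by (auto simp: Z_def)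
    finally have "compact Z" .
    hence "compact (fst ` Z)" by (intro compact_continuous_image continuous_intros)
    moreover have "fst ` Z = B"
    proof (intro equalityI subsetI)
      fix s assume "s \<in> B"
      then obtain t where "s \<in> {0..1}" "Im t \<ge> 0" "q \<psi> s t = 0" by (auto simp: B_def)
      hence "(s, t) \<in> Z" using bounded by (simp add: Z_def)
      thus "s \<in> fst ` Z" by force
    qed (auto simp: Z_def B_def)
    ultimately have "closed B" by (simp add: compact_imp_closed)
    moreover have "openin (top_of_set {0..1}) B"
      unfolding openin_euclidean_subtopology_iff
    proof (intro conjI ballI)
      show "B \<subseteq> {0..1}" by (auto simp: B_def)
      fix s0 assume "s0 \<in> B"
      then obtain t0 where t0: "s0 \<in> {0..1}" "Im t0 \<ge> 0" "q \<psi> s0 t0 = 0" by (auto simp: B_def)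
      \<comment> \<open>Real roots being excluded, Im t0 is positive, and any root closer to t0 than
        Im t0 still lies in the upper half plane.\<close>
      have "Im t0 \<noteq> 0"
        using real_t[of \<psi> s0 "Re t0"] t0 by (metis complex_is_Real_iff of_real_Re)
      hence im: "Im t0 > 0" using t0 by simp
      have pos: "norm (p (cvec \<xi>)) * Im t0 ^ CARD('n) > 0" using im xi by simp
      have "continuous_on UNIV (\<lambda>s. q \<psi> s t0)"
        unfolding q_def by (intro cont continuous_intros smult_cont)
      then obtain d where d: "d > 0"
        "\<And>s. dist s s0 < d \<Longrightarrow> dist (q \<psi> s t0) (q \<psi> s0 t0) < norm (p (cvec \<xi>)) * Im t0 ^ CARD('n)"
        using pos unfolding continuous_on_iff by blast
      have "s \<in> B" if "s \<in> {0..1}" "dist s s0 < d" for s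
      proof -
        obtain r where r: "p (\<i> *s cvec \<theta> + of_real s *s cvec \<psi> + r *s cvec \<xi>) = 0"
          "norm (t0 - r) ^ CARD('n) \<le>
             norm (p (\<i> *s cvec \<theta> + of_real s *s cvec \<psi> + t0 *s cvec \<xi>)) / norm (p (cvec \<xi>))"
          using det_pencil_root_near[of A "cvec \<xi>"] xi unfolding p_def by blast
        have "norm (q \<psi> s t0) / norm (p (cvec \<xi>)) < Im t0 ^ CARD('n)"
          using d(2)[OF that(2)] t0(3) xi by (simp add: field_simps)
        with r(2) have "norm (t0 - r) ^ CARD('n) < Im t0 ^ CARD('n)"
          by (simp add: q_def add_ac)
        hence "norm (t0 - r) < Im t0" using im by (meson power_less_imp_less_base less_imp_le)
        hence "Im r \<ge> 0" using abs_Im_le_cmod[of "t0 - r"] by auto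
        moreover have "q \<psi> s r = 0" using r(1) by (simp add: q_def add_ac)
        ultimately show ?thesis using that by (auto simp: B_def)
      qed
      thus "\<exists>e>0. \<forall>x'\<in>{0..1}. dist x' s0 < e \<longrightarrow> x' \<in> B" using d(1) by blast
    qed
    moreover have "B \<subseteq> {0..1}" by (auto simp: B_def)
    ultimately have "B = {} \<or> B = {0..1}"
      using connected_clopen[of "{0..1::real}"] closed_subset[of B "{0..1}"] by simp
    moreover have "0 \<notin> B" using start by (auto simp: B_def)
    ultimately have "B = {}" by auto
    thus ?thesis using that by (auto simp: B_def)
  qed
  \<comment> \<open>The root in question lacks the shift by \<i>\<theta>. Adding
    \<epsilon>\<i>\<theta> for small \<epsilon> moves it by less than Im t, and scaling by
    1/\<epsilon> makes the moved root a root of \<open>q\<close> at s = 1 with base point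
    \<psi>/\<epsilon>.\<close>
  have no_upper: "p (cvec \<psi> + t *s cvec \<xi>) \<noteq> 0" if im: "Im t > 0" for \<psi> t
  proof
    assume root: "p (cvec \<psi> + t *s cvec \<xi>) = 0"
    define f where "f \<epsilon> = p (cvec \<psi> + of_real \<epsilon> *s (\<i> *s cvec \<theta>) + t *s cvec \<xi>)" for \<epsilon> :: real
    have pos: "norm (p (cvec \<xi>)) * Im t ^ CARD('n) > 0" using im xi by simp
    have "continuous_on UNIV f"
      unfolding f_def by (intro cont continuous_intros smult_cont)
    then obtain d where d: "d > 0"
      "\<And>s. dist s 0 < d \<Longrightarrow> dist (f s) (f 0) < norm (p (cvec \<xi>)) * Im t ^ CARD('n)"
      using pos unfolding continuous_on_iff by blast
    have "f 0 = 0" using root by (simp add: f_def)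
    define \<epsilon> where "\<epsilon> = d / 2"
    have \<epsilon>: "\<epsilon> > 0" using d(1) by (simp add: \<epsilon>_def)
    obtain r where r: "p (cvec \<psi> + of_real \<epsilon> *s (\<i> *s cvec \<theta>) + r *s cvec \<xi>) = 0"
      "norm (t - r) ^ CARD('n) \<le> norm (f \<epsilon>) / norm (p (cvec \<xi>))"
      using det_pencil_root_near[of A "cvec \<xi>"] xi unfolding p_def f_def by blast
    have "norm (f \<epsilon>) / norm (p (cvec \<xi>)) < Im t ^ CARD('n)"
      using d(2)[of \<epsilon>] d(1) \<open>f 0 = 0\<close> xi by (simp add: field_simps \<epsilon>_def)
    with r(2) have "norm (t - r) ^ CARD('n) < Im t ^ CARD('n)" by simp
    hence "norm (t - r) < Im t" using im by (meson power_less_imp_less_base less_imp_le)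
    hence im': "Im r \<ge> 0" using abs_Im_le_cmod[of "t - r"] by auto
    have "cvec \<psi> + of_real \<epsilon> *s (\<i> *s cvec \<theta>) + r *s cvec \<xi>
      = of_real \<epsilon> *s (\<i> *s cvec \<theta> + (r / of_real \<epsilon>) *s cvec \<xi> + of_real 1 *s cvec ((1 / \<epsilon>) *\<^sub>R \<psi>))"
      using \<epsilon> by (simp add: vec_eq_iff field_simps)
    hence "p (cvec \<psi> + of_real \<epsilon> *s (\<i> *s cvec \<theta>) + r *s cvec \<xi>)
      = of_real \<epsilon> ^ CARD('n) * q ((1 / \<epsilon>) *\<^sub>R \<psi>) 1 (r / of_real \<epsilon>)"
      unfolding q_def by (simp only: scale)
    hence "q ((1 / \<epsilon>) *\<^sub>R \<psi>) 1 (r / of_real \<epsilon>) = 0"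
      using r(1) \<epsilon> by simp
    moreover have "Im (r / of_real \<epsilon>) \<ge> 0" using im' \<epsilon> by simp
    ultimately show False using upper by auto
  qed
  have "\<not> Im t > 0" using no_upper[of t \<psi>] root by auto
  \<comment> \<open>The matrices are real, so conjugation carries the lower half plane to the upper
    one.\<close>
  moreover have "\<not> Im t < 0"
  proof
    assume "Im t < 0"
    moreover have "p (cvec \<psi> + cnj t *s cvec \<xi>) = cnj (p (cvec \<psi> + t *s cvec \<xi>))"
      unfolding p_def det_pencil_cnj[symmetric]
      by (intro arg_cong[of _ _ det] arg_cong[of _ _ "pencil A"]) (simp add: vec_eq_iff)
    ultimately show False using no_upper[of "cnj t" \<psi>] root by simp
  qed
  ultimately show ?thesis by (simp add: complex_is_Real_iff)
qed


subsection \<open>The principal part in an eigenframe\<close>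

lemma UNIV_4': "(UNIV :: 4 set) = {0, 1, 2, 3}"
  using UNIV_4 by (auto simp: insert_commute)

lemma sum_4': "(\<Sum>A\<in>(UNIV :: 4 set). F A) = F 0 + F 1 + F 2 + F 3"
proof -
  have "(4 :: 4) = 0" by simp
  thus ?thesis unfolding sum_4 by (simp only: add_ac)
qed

lemma exhaust_4': "(A :: 4) = 0 \<or> A = 1 \<or> A = 2 \<or> A = 3"
  using UNIV_4' by blast

lemma sum_nonVel:
  "(\<Sum>k\<in>- range Vel. F k) = F Energy + F Particle + F Bulk + (\<Sum>C\<in>UNIV. \<Sum>D\<in>UNIV. F (Shear C D))"
proof -
  have *: "- range Vel = {Energy, Particle, Bulk} \<union> (\<lambda>(C, D). Shear C D) ` UNIV"
  proof (intro equalityI subsetI)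
    fix k assume "k \<in> - range Vel"
    thus "k \<in> {Energy, Particle, Bulk} \<union> (\<lambda>(C, D). Shear C D) ` UNIV" by (cases k) auto
  qed auto
  have "inj (\<lambda>(C, D). Shear C D)" by (auto simp: inj_on_def)
  hence "(\<Sum>k\<in>(\<lambda>(C, D). Shear C D) ` UNIV. F k) = (\<Sum>C\<in>UNIV. \<Sum>D\<in>UNIV. F (Shear C D))"
    by (simp add: sum.reindex o_def sum.cartesian_product case_prod_unfold)
  moreover have "(\<Sum>k\<in>{Energy, Particle, Bulk}. F k) = F Energy + F Particle + F Bulk"
    by (simp add: add_ac)
  ultimately show ?thesis
    unfolding * by (subst sum.union_disjoint) auto
qed

lemma sum_fld: "(\<Sum>k\<in>UNIV. F k) = (\<Sum>A\<in>UNIV. F (Vel A)) + F Energy + F Particle + F Bulk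
   + (\<Sum>C\<in>UNIV. \<Sum>D\<in>UNIV. F (Shear C D))"
proof -
  have "(\<Sum>k\<in>UNIV. F k) = (\<Sum>k\<in>range Vel. F k) + (\<Sum>k\<in>- range Vel. F k)"
    by (subst sum.union_disjoint[symmetric]) auto
  moreover have "(\<Sum>k\<in>range Vel. F k) = (\<Sum>A\<in>UNIV. F (Vel A))"
    by (simp add: sum.reindex inj_on_def)
  ultimately show ?thesis by (simp add: sum_nonVel add_ac)
qed

lemma prod_nonVel:
  "(\<Prod>k\<in>- range Vel. F k) = F Energy * F Particle * F Bulk * (\<Prod>C\<in>UNIV. \<Prod>D\<in>UNIV. F (Shear C D))"
proof -
  have *: "- range Vel = {Energy, Particle, Bulk} \<union> (\<lambda>(C, D). Shear C D) ` UNIV"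
  proof (intro equalityI subsetI)
    fix k assume "k \<in> - range Vel"
    thus "k \<in> {Energy, Particle, Bulk} \<union> (\<lambda>(C, D). Shear C D) ` UNIV" by (cases k) auto
  qed auto
  have "inj (\<lambda>(C, D). Shear C D)" by (auto simp: inj_on_def)
  hence "(\<Prod>k\<in>(\<lambda>(C, D). Shear C D) ` UNIV. F k) = (\<Prod>C\<in>UNIV. \<Prod>D\<in>UNIV. F (Shear C D))"
    by (simp add: prod.reindex o_def prod.cartesian_product case_prod_unfold)
  moreover have "(\<Prod>k\<in>{Energy, Particle, Bulk}. F k) = F Energy * F Particle * F Bulk"
    by (simp add: mult_ac)
  ultimately show ?thesis
    unfolding * by (subst prod.union_disjoint) auto
qed

text \<open>The determinant of the 3 x 3 matrix with entries d_a \<delta>_ab - v_a v_b K_ab, where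
  s_a = v_a^2. It is expanded over the subsets T of the index set: the principal minor of K on T
  comes with s on T, d off T and the sign (-1)^|T|. Each v_a occurs once through its row and once
  through its column, hence squared.\<close>

definition det3_update :: "(4 \<Rightarrow> 'a::comm_ring_1) \<Rightarrow> (4 \<Rightarrow> 'a) \<Rightarrow> (4 \<Rightarrow> 4 \<Rightarrow> 'a) \<Rightarrow> 'a" where
  "det3_update d s K = d 1 * d 2 * d 3
     - s 1 * K 1 1 * d 2 * d 3 - s 2 * K 2 2 * d 1 * d 3 - s 3 * K 3 3 * d 1 * d 2
     + s 1 * s 2 * (K 1 1 * K 2 2 - K 1 2 * K 2 1) * d 3
     + s 1 * s 3 * (K 1 1 * K 3 3 - K 1 3 * K 3 1) * d 2
     + s 2 * s 3 * (K 2 2 * K 3 3 - K 2 3 * K 3 2) * d 1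
     - s 1 * s 2 * s 3 * (K 1 1 * K 2 2 * K 3 3 + K 1 2 * K 2 3 * K 3 1 + K 1 3 * K 2 1 * K 3 2
         - K 1 1 * K 2 3 * K 3 2 - K 1 2 * K 2 1 * K 3 3 - K 1 3 * K 2 2 * K 3 1)"

lemma det3_update_scale:
  "det3_update (\<lambda>A. t * d A) (\<lambda>A. t * s A) K = t ^ 3 * det3_update d s K"
  by (simp add: det3_update_def power3_eq_cube algebra_simps)

lemma det3_update_cong:
  assumes "\<And>a. a \<noteq> 0 \<Longrightarrow> d a = d' a" "\<And>a. a \<noteq> 0 \<Longrightarrow> s a = s' a"
  shows "det3_update d s K = det3_update d' s' K"
  by (simp add: det3_update_def assms)

text \<open>The triple is real yet valid at all complex \<open>y\<close>: the same numbers must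
  serve the real factorization and the complex roots.\<close>

lemma det3_update_cubic:
  fixes p m s :: "4 \<Rightarrow> real" and K :: "4 \<Rightarrow> 4 \<Rightarrow> real"
  assumes nz: "p 1 \<noteq> 0" "p 2 \<noteq> 0" "p 3 \<noteq> 0"
  obtains a0 a1 a2 :: real where
    "\<And>y :: complex. det3_update (\<lambda>A. y * of_real (p A) - of_real (m A)) (\<lambda>A. of_real (s A)) (\<lambda>A N. of_real (K A N))
      = of_real (p 1 * p 2 * p 3) * (y ^ 3 - of_real a2 * y\<^sup>2 + of_real a1 * y - of_real a0)"
proof -
  define J12 J13 J23 where "J12 = s 1 * s 2 * (K 1 1 * K 2 2 - K 1 2 * K 2 1)"
    and "J13 = s 1 * s 3 * (K 1 1 * K 3 3 - K 1 3 * K 3 1)"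
    and "J23 = s 2 * s 3 * (K 2 2 * K 3 3 - K 2 3 * K 3 2)"
  define J where "J = s 1 * s 2 * s 3 * (K 1 1 * K 2 2 * K 3 3 + K 1 2 * K 2 3 * K 3 1 + K 1 3 * K 2 1 * K 3 2
         - K 1 1 * K 2 3 * K 3 2 - K 1 2 * K 2 1 * K 3 3 - K 1 3 * K 2 2 * K 3 1)"
  define S1 S2 S3 where "S1 = s 1 * K 1 1" and "S2 = s 2 * K 2 2" and "S3 = s 3 * K 3 3"
  define c2 where "c2 = - (m 1 * p 2 * p 3 + p 1 * m 2 * p 3 + p 1 * p 2 * m 3)
     - (S1 * p 2 * p 3 + S2 * p 1 * p 3 + S3 * p 1 * p 2)"
  define c1 where "c1 = m 1 * m 2 * p 3 + m 1 * p 2 * m 3 + p 1 * m 2 * m 3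
     + S1 * (p 2 * m 3 + m 2 * p 3) + S2 * (p 1 * m 3 + m 1 * p 3) + S3 * (p 1 * m 2 + m 1 * p 2)
     + J12 * p 3 + J13 * p 2 + J23 * p 1"
  define c0 where "c0 = - m 1 * m 2 * m 3 - S1 * m 2 * m 3 - S2 * m 1 * m 3 - S3 * m 1 * m 2
     - J12 * m 3 - J13 * m 2 - J23 * m 1 - J"
  have "det3_update (\<lambda>A. y * of_real (p A) - of_real (m A)) (\<lambda>A. of_real (s A)) (\<lambda>A N. of_real (K A N))
      = of_real (p 1 * p 2 * p 3) * (y ^ 3 - of_real (- c2 / (p 1 * p 2 * p 3)) * y\<^sup>2
          + of_real (c1 / (p 1 * p 2 * p 3)) * y - of_real (- c0 / (p 1 * p 2 * p 3)))" (is "?L = ?R") for y :: complex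
  proof -
    have "?L = of_real (p 1 * p 2 * p 3) * y ^ 3 + of_real c2 * y\<^sup>2 + of_real c1 * y + of_real c0"
      unfolding det3_update_def c2_def c1_def c0_def J12_def J13_def J23_def J_def S1_def S2_def S3_def
      by (simp add: power2_eq_square power3_eq_cube algebra_simps)
    also have "\<dots> = ?R" using nz by (simp add: distrib_left right_diff_distrib)
    finally show ?thesis .
  qed
  thus ?thesis by (rule that)
qed

text \<open>The matrix of the principal part in an eigenframe: \<open>f A\<close> are the components of the covector,
  so that \<open>f 0\<close> is \<open>z\<close>, and \<open>L A\<close> are the eigenvalues of the shear tensor. The
  coefficients stand for \<open>E\<close>, \<open>P\<^sub>\<epsilon>\<close>, \<open>P\<^sub>n\<close>, \<open>n\<close>, \<open>\<tau>\<^sub>\<Pi>\<close>, \<open>\<zeta> + \<delta>\<^sub>\<Pi>\<^sub>\<Pi> \<Pi>\<close>, \<open>\<lambda>\<^sub>\<Pi>\<^sub>\<pi>\<close>,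
  \<open>\<tau>\<^sub>\<pi>\<close>, \<open>\<eta> + \<lambda>\<^sub>\<pi>\<^sub>\<Pi> \<Pi> / 2\<close>, \<open>\<delta>\<^sub>\<pi>\<^sub>\<pi> - \<tau>\<^sub>\<pi>\<^sub>\<pi> / 3\<close> and \<open>\<tau>\<^sub>\<pi>\<^sub>\<pi>\<close>.\<close>

locale frame_symbol =
  fixes E Pe Pn n tb zb lb ts H ds tt :: "'a::field_char_0" and L f :: "4 \<Rightarrow> 'a"
begin

definition sp :: "4 \<Rightarrow> 'a" where "sp A = (if A = 0 then 0 else f A)"

text \<open>Frame components of \<open>Cpi\<close> contracted with the covector, term by term. No
  metric signs appear: the only frame vector of negative norm is u, where the projector and, for
  \<open>L 0 = 0\<close>, the shear tensor vanish.\<close>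

definition shear_coeff :: "4 \<Rightarrow> 4 \<Rightarrow> 4 \<Rightarrow> 'a" where
  "shear_coeff A B N =
     H * (sp A * of_bool (B = N) + sp B * of_bool (A = N) - 2/3 * (of_bool (A = B \<and> A \<noteq> 0) * sp N))
     - ts * f 0 * L N * (of_bool (A = N \<and> B = 0) + of_bool (B = N \<and> A = 0))
     + ds * (of_bool (A = B) * L A) * f N
     + tt/2 * (1/2 * (sp B * (L N * of_bool (A = N)) + sp A * (L N * of_bool (B = N)))
             + 1/2 * (L A * f A * of_bool (B = N) + L B * f B * of_bool (A = N)))
     - tt/3 * (of_bool (A = B \<and> A \<noteq> 0) * (L N * f N))"

fun entry :: "fld \<Rightarrow> fld \<Rightarrow> 'a" where
  "entry (Vel A) (Vel N) = E * f 0 * of_bool (A = N) - of_bool (A = 0) * (L N * f N)"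
| "entry (Vel A) Energy = sp A * Pe"
| "entry (Vel A) Particle = sp A * Pn"
| "entry (Vel A) Bulk = sp A"
| "entry (Vel A) (Shear C D) = of_bool (A = C) * f D"
| "entry Energy (Vel N) = E * f N + L N * f N"
| "entry Energy Energy = f 0"
| "entry Energy _ = 0"
| "entry Particle (Vel N) = n * f N"
| "entry Particle Particle = f 0"
| "entry Particle _ = 0"
| "entry Bulk (Vel N) = zb * f N + lb * (L N * f N)"
| "entry Bulk Bulk = tb * f 0"
| "entry Bulk _ = 0"
| "entry (Shear A B) (Vel N) = shear_coeff A B N"
| "entry (Shear A B) (Shear C D) = of_bool (A = C \<and> B = D) * (ts * f 0)"
| "entry (Shear A B) _ = 0"

definition symbol :: "'a^fld^fld" where
  "symbol = (\<chi> i j. entry i j)"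

definition V :: 'a where "V = (f 1)\<^sup>2 + (f 2)\<^sup>2 + (f 3)\<^sup>2"
definition W :: 'a where "W = L 1 * (f 1)\<^sup>2 + L 2 * (f 2)\<^sup>2 + L 3 * (f 3)\<^sup>2"

definition quad :: 'a where "quad = E * (f 0)\<^sup>2 - (H * V + tt / 4 * W) / ts"

text \<open>The diagonal part of the spatial block of the Schur complement, multiplied by
  \<open>f 0\<close>. The summand \<open>L A\<close> next to \<open>E\<close> stems from the term of
  \<open>Cpi\<close> with \<tau>_\<pi>.\<close>

definition diag_entry :: "4 \<Rightarrow> 'a" where
  "diag_entry A = (f 0)\<^sup>2 * (E + L A) - (H * V + tt / 4 * (V * L A + W)) / ts"

text \<open>The factor of - f_A f_N in the same block. Its four groups come from eliminating the
  energy, particle, bulk and shear equations; \<open>H / 3\<close> is what the traceless combination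
  leaves of H.\<close>

definition update_entry :: "4 \<Rightarrow> 4 \<Rightarrow> 'a" where
  "update_entry A N = Pe * (E + L N) + Pn * n + (zb + lb * L N) / tb
     + (H / 3 + ds * L A + tt / 4 * (L A + L N) - tt / 3 * L N) / ts"

text \<open>The last term, divided by the pivot \<open>ts * f 0\<close>, cancels the term
  \<open>- u w\<close> of the momentum equation. This is why the time row of the Schur complement is
  diagonal.\<close>

lemma shear_contract_0:
  assumes "L 0 = 0"
  shows "(\<Sum>D\<in>UNIV. f D * shear_coeff 0 D N) =
    (H * V + tt / 4 * W) * of_bool (N = 0) - ts * f 0 * L N * f N"
  using exhaust_4'[of N] assms
  by (elim disjE) (simp_all add: sum_4' shear_coeff_def sp_def V_def W_def power2_eq_square field_simps)

lemma shear_contract: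
  assumes "L 0 = 0" "A \<noteq> 0" "N \<noteq> 0"
  shows "(\<Sum>D\<in>UNIV. f D * shear_coeff A D N) =
        H * (f A * f N / 3 + V * of_bool (A = N)) - ts * (f 0)\<^sup>2 * L N * of_bool (A = N)
        + ds * L A * f A * f N
        + tt / 4 * (V * L N * of_bool (A = N) + f A * L N * f N + L A * f A * f N
           + W * of_bool (A = N)) - tt / 3 * L N * f N * f A"
  using exhaust_4'[of A] exhaust_4'[of N] assms
  by (elim disjE) (simp_all add: sum_4' shear_coeff_def sp_def V_def W_def field_simps power2_eq_square)

text \<open>The elimination has pivots proportional to \<open>f 0\<close>, so \<open>f 0 = 0\<close>
  is treated apart: the right-hand side vanishes there and a kernel vector shows that the matrix is
  singular.\<close>

lemma det_symbol:
  assumes "L 0 = 0" "tb \<noteq> 0" "ts \<noteq> 0"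
  shows "det symbol = tb * ts ^ 16 * f 0 ^ 15 * quad * det3_update diag_entry (\<lambda>a. (f a)\<^sup>2) update_entry"
proof (cases "f 0 = 0")
  case True
  \<comment> \<open>For \<open>f 0 = 0\<close> the shear equations no longer contain the shear
    unknowns, so every variation of \<pi>^{0b} with f_b \<delta>\<pi>^{0b} = 0 lies in the kernel.
    Two spatial components suffice for a nonzero one.\<close>
  obtain y1 y2 y3 :: 'a where y: "f 1 * y1 + f 2 * y2 + f 3 * y3 = 0" "y1 \<noteq> 0 \<or> y2 \<noteq> 0"
  proof (cases "f 1 = 0")
    case True thus ?thesis using that[of 1 0 0] by simp
  next
    case False thus ?thesis using that[of "- f 2" "f 1" 0] by simp
  qed
  define \<delta> :: "'a^fld" where "\<delta> = (\<chi> i. case i of Shear C D \<Rightarrow>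
    if C = 0 then (if D = 1 then y1 else if D = 2 then y2 else if D = 3 then y3 else 0) else 0 | _ \<Rightarrow> 0)"
  have "(symbol *v \<delta>) $ i = 0" for i
    using True y(1)
    by (cases i) (auto simp: matrix_vector_mult_def sum_fld symbol_def \<delta>_def sum_4')
  hence "symbol *v \<delta> = 0" by (simp add: vec_eq_iff)
  moreover have "\<delta> $ Shear 0 1 \<noteq> 0 \<or> \<delta> $ Shear 0 2 \<noteq> 0" using y(2) by (simp add: \<delta>_def)
  hence "\<delta> \<noteq> 0" by auto
  ultimately have "\<not> invertible symbol"
    using matrix_left_invertible_ker[of symbol] by (auto simp: invertible_def)
  hence "det symbol = 0" by (simp add: invertible_det_nz)
  thus ?thesis using True by simp
next
  case z: False
  define S where "S i j = symbol $ i $ j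
    - (\<Sum>k\<in>- range Vel. symbol $ i $ k * symbol $ k $ j / symbol $ k $ k)" for i j
  have S: "S (Vel A) (Vel N) = E * f 0 * of_bool (A = N) - of_bool (A = 0) * (L N * f N)
        - (sp A * Pe * (E * f N + L N * f N) / f 0 + sp A * Pn * (n * f N) / f 0
           + sp A * (zb * f N + lb * (L N * f N)) / (tb * f 0)
           + (\<Sum>D\<in>UNIV. f D * shear_coeff A D N) / (ts * f 0))" for A N
  proof -
    have "(\<Sum>C\<in>UNIV. \<Sum>D\<in>UNIV. of_bool (A = C) * f D * shear_coeff C D N / (ts * f 0))
      = (\<Sum>D\<in>UNIV. f D * shear_coeff A D N) / (ts * f 0)"
      using exhaust_4'[of A] by (elim disjE) (simp_all add: sum_4' sum_divide_distrib add_divide_distrib)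
    thus ?thesis by (simp add: S_def symbol_def sum_nonVel)
  qed
  have "det symbol = (\<Prod>k\<in>- range Vel. symbol $ k $ k) * subdet S (- (- range Vel))"
    unfolding S_def
  proof (rule det_Schur_diag)
    fix i j assume "i \<in> - range Vel" "j \<in> - range Vel" "i \<noteq> j"
    thus "symbol $ i $ j = 0" by (cases i; cases j) (auto simp: symbol_def)
  next
    fix i assume "i \<in> - range Vel"
    thus "symbol $ i $ i \<noteq> 0" using z assms by (cases i) (auto simp: symbol_def)
  qed
  \<comment> \<open>The 19 pivots belong to three scalar and sixteen shear equations. The reduced 4
    x 4 determinant has denominator \<open>f 0 ^ 4\<close>, which leaves the power 15.\<close>
  also have "(\<Prod>k\<in>- range Vel. symbol $ k $ k) = tb * ts ^ 16 * f 0 ^ 19"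
    by (simp add: prod_nonVel symbol_def power_mult_distrib power_add[symmetric] mult_ac)
       (simp add: numeral_eq_Suc)
  also have "subdet S (- (- range Vel)) = S (Vel 0) (Vel 0) * subdet S {Vel 1, Vel 2, Vel 3}"
  proof -
    have r: "S (Vel 0) (Vel N) = 0" if "0 \<noteq> N" for N
      using that z assms by (simp add: S shear_contract_0 sp_def)
    have "subdet S (range Vel) = (\<Prod>i\<in>{Vel 0}. S i i) * subdet S (range Vel - {Vel 0})"
    proof (rule subdet_diag_rows)
      fix i j :: fld assume "i \<in> {Vel 0}" "j \<in> range Vel" "i \<noteq> j"
      then obtain N where "i = Vel 0" "j = Vel N" "0 \<noteq> N" by blast
      thus "S i j = 0" using r[of N] by blast
    qed auto
    moreover have "range Vel - {Vel 0} = {Vel 1, Vel 2, Vel 3}"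
      unfolding UNIV_4' by simp
    ultimately show ?thesis by simp
  qed
  also have "S (Vel 0) (Vel 0) = quad / f 0"
  proof -
    have "S (Vel 0) (Vel 0) = E * f 0 - (H * V + tt / 4 * W) / (ts * f 0)"
      using assms by (simp add: S shear_contract_0 sp_def)
    thus ?thesis
      using z unfolding quad_def by (simp add: diff_divide_distrib power2_eq_square)
  qed
  also have "subdet S {Vel 1, Vel 2, Vel 3} = det3_update diag_entry (\<lambda>a. (f a)\<^sup>2) update_entry / f 0 ^ 3"
  proof -
    define T where "T A N = of_bool (A = N) * diag_entry A - f A * f N * update_entry A N" for A N
    have ST: "S (Vel A) (Vel N) = T A N / f 0" if "A \<noteq> 0" "N \<noteq> 0" for A N
    proof -
      have cancel: "(p0 * f 0 - (a / f 0 + b / f 0 + c / (tb * f 0) + d / (ts * f 0))) * f 0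
        = p0 * (f 0)\<^sup>2 - (a + b + c / tb + d / ts)" for p0 a b c d
        using z assms by (simp add: left_diff_distrib distrib_right power2_eq_square)
      define X where "X = H * (f A * f N / 3 + V * of_bool (A = N)) - ts * (f 0)\<^sup>2 * L N * of_bool (A = N)
        + ds * L A * f A * f N
        + tt / 4 * (V * L N * of_bool (A = N) + f A * L N * f N + L A * f A * f N
           + W * of_bool (A = N)) - tt / 3 * L N * f N * f A"
      have "S (Vel A) (Vel N) = (E * of_bool (A = N)) * f 0
        - (f A * Pe * (E * f N + L N * f N) / f 0 + f A * Pn * (n * f N) / f 0
           + f A * (zb * f N + lb * (L N * f N)) / (tb * f 0) + X / (ts * f 0))"
        unfolding S shear_contract[OF assms(1) that] X_def[symmetric] using that by (simp add: sp_def)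
      hence "S (Vel A) (Vel N) * f 0 = (E * of_bool (A = N)) * (f 0)\<^sup>2
        - (f A * Pe * (E * f N + L N * f N) + f A * Pn * (n * f N)
           + f A * (zb * f N + lb * (L N * f N)) / tb + X / ts)"
        by (simp only: cancel)
      also have "X / ts = (H * V + tt / 4 * (V * L N + W)) / ts * of_bool (A = N)
         - (f 0)\<^sup>2 * L N * of_bool (A = N)
         + f A * f N * ((H / 3 + ds * L A + tt / 4 * (L A + L N) - tt / 3 * L N) / ts)"
        unfolding X_def using assms by (simp add: field_simps)
      also have "E * of_bool (A = N) * (f 0)\<^sup>2
        - (f A * Pe * (E * f N + L N * f N) + f A * Pn * (n * f N)
           + f A * (zb * f N + lb * (L N * f N)) / tb
           + ((H * V + tt / 4 * (V * L N + W)) / ts * of_bool (A = N)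
              - (f 0)\<^sup>2 * L N * of_bool (A = N)
              + f A * f N * ((H / 3 + ds * L A + tt / 4 * (L A + L N) - tt / 3 * L N) / ts))) = T A N"
      proof (cases "A = N")
        case True
        show ?thesis unfolding True T_def diag_entry_def update_entry_def
          by (simp add: ring_distribs add_divide_distrib mult_ac)
      next
        case False
        thus ?thesis unfolding T_def update_entry_def
          by (simp add: ring_distribs add_divide_distrib mult_ac)
      qed
      finally have "S (Vel A) (Vel N) * f 0 = T A N" .
      thus ?thesis using z by (simp add: field_simps)
    qed
    have "subdet S {Vel 1, Vel 2, Vel 3} =
       (T 1 1 * T 2 2 * T 3 3 + T 1 2 * T 2 3 * T 3 1 + T 1 3 * T 2 1 * T 3 2
       - T 1 1 * T 2 3 * T 3 2 - T 1 2 * T 2 1 * T 3 3 - T 1 3 * T 2 2 * T 3 1) / f 0 ^ 3"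
      unfolding subdet_three[of "Vel 1" "Vel 2" "Vel 3", simplified]
      by (simp add: ST add_divide_distrib diff_divide_distrib power3_eq_cube)
    also have "T 1 1 * T 2 2 * T 3 3 + T 1 2 * T 2 3 * T 3 1 + T 1 3 * T 2 1 * T 3 2
       - T 1 1 * T 2 3 * T 3 2 - T 1 2 * T 2 1 * T 3 3 - T 1 3 * T 2 2 * T 3 1
       = det3_update diag_entry (\<lambda>a. (f a)\<^sup>2) update_entry"
      by (simp add: T_def det3_update_def) (simp add: power2_eq_square algebra_simps)
    finally show ?thesis .
  qed
  also have "f 0 ^ 19 = f 0 ^ 15 * (f 0 * f 0 ^ 3)"
    by (simp flip: power_Suc power_add)
  also have "tb * ts ^ 16 * (f 0 ^ 15 * (f 0 * f 0 ^ 3)) * (quad / f 0 * (D / f 0 ^ 3))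
      = tb * ts ^ 16 * f 0 ^ 15 * quad * D" for D
  proof -
    have c: "a * (b * (y * w)) * (q / y * (D / w)) = a * b * q * D" if "y \<noteq> 0" "w \<noteq> 0" for a b y w q :: 'a
      using that by simp
    show ?thesis by (rule c[OF z]) (use z in simp)
  qed
  finally show ?thesis .
qed

end

section \<open>Frame components of the metric, the shear tensor and the principal part\<close>

locale fluid_frame =
  fixes g :: "real^4 \<Rightarrow> real^4^4" and x :: "real^4" and M :: fluid and U :: state
    and e :: "4 \<Rightarrow> real^4" and \<Lambda> :: "4 \<Rightarrow> real"
  assumes lor: "lorentzian (g x)" and con: "constrained (g x) U" and frame: "eigenframe (g x) U e \<Lambda>"
begin

definition low :: "4 \<Rightarrow> 4 \<Rightarrow> real" where "low A \<mu> = (\<Sum>\<nu>\<in>UNIV. g x $ \<mu> $ \<nu> * e A $ \<nu>)"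

definition sg :: "4 \<Rightarrow> real" where "sg A = (if A = 0 then -1 else 1)"

lemma sg_sq [simp]: "sg A * sg A = 1" "sg A * (sg A * y) = y"
  by (auto simp: sg_def)

lemma g_sym: "g x $ \<mu> $ \<nu> = g x $ \<nu> $ \<mu>"
  using lor unfolding lorentzian_def transpose_def by (simp add: vec_eq_iff)

lemma e0: "e 0 $ \<mu> = vel U \<mu>"
  using frame by (simp add: eigenframe_def)

lemma low0: "vel_low (g x) U = low 0"
  by (simp add: fun_eq_iff vel_low_def low_def e0)

lemma orth: "(\<Sum>\<mu>\<in>UNIV. e A $ \<mu> * low B \<mu>) = sg A * of_bool (A = B)"
proof -
  have "(\<Sum>\<mu>\<in>UNIV. e A $ \<mu> * low B \<mu>) = e A \<bullet> (g x *v e B)"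
    by (simp add: inner_vec_def matrix_vector_mult_def low_def)
  thus ?thesis using frame by (simp add: eigenframe_def minkowski_def sg_def)
qed

text \<open>Orthonormality says that the covectors \<open>sg A * low A\<close> form a left inverse
  of the matrix of frame vectors; for square matrices it is also a right inverse.\<close>

lemma complete: "(\<Sum>A\<in>UNIV. sg A * e A $ \<mu> * low A \<nu>) = of_bool (\<mu> = \<nu>)"
proof -
  define P :: "real^4^4" where "P = (\<chi> A \<mu>. sg A * low A \<mu>)"
  define Q :: "real^4^4" where "Q = (\<chi> \<mu> A. e A $ \<mu>)"
  have "(\<Sum>\<mu>\<in>UNIV. sg A * low A \<mu> * e B $ \<mu>) = of_bool (A = B)" for A B
  proof -
    have "(\<Sum>\<mu>\<in>UNIV. sg A * low A \<mu> * e B $ \<mu>) = sg A * (\<Sum>\<mu>\<in>UNIV. e B $ \<mu> * low A \<mu>)"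
      by (simp add: sum_distrib_left mult_ac)
    thus ?thesis by (auto simp: orth)
  qed
  hence "P ** Q = mat 1"
    by (simp add: P_def Q_def matrix_matrix_mult_def mat_def vec_eq_iff)
  hence "Q ** P = mat 1" by (simp add: matrix_left_right_inverse)
  hence "(Q ** P) $ \<mu> $ \<nu> = mat 1 $ \<mu> $ \<nu>" by simp
  thus ?thesis by (simp add: P_def Q_def matrix_matrix_mult_def mat_def mult_ac)
qed

lemma ginv: "matrix_inv (g x) $ \<mu> $ \<nu> = (\<Sum>A\<in>UNIV. sg A * e A $ \<mu> * e A $ \<nu>)"
proof -
  define X :: "real^4^4" where "X = (\<chi> \<mu> \<nu>. \<Sum>A\<in>UNIV. sg A * e A $ \<mu> * e A $ \<nu>)"
  have "(X ** g x) $ \<mu> $ \<nu> = mat 1 $ \<mu> $ \<nu>" for \<mu> \<nu>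
  proof -
    have "(X ** g x) $ \<mu> $ \<nu> = (\<Sum>\<kappa>\<in>UNIV. \<Sum>A\<in>UNIV. sg A * e A $ \<mu> * (g x $ \<nu> $ \<kappa> * e A $ \<kappa>))"
      by (simp add: X_def matrix_matrix_mult_def sum_distrib_left sum_distrib_right g_sym[of _ \<nu>] mult_ac)
    also have "\<dots> = (\<Sum>A\<in>UNIV. sg A * e A $ \<mu> * low A \<nu>)"
      by (subst sum.swap) (simp add: low_def sum_distrib_left)
    finally show ?thesis by (simp add: complete mat_def)
  qed
  hence XG: "X ** g x = mat 1" by (simp add: vec_eq_iff)
  hence GX: "g x ** X = mat 1" by (simp add: matrix_left_right_inverse)
  have "\<exists>A'. g x ** A' = mat 1 \<and> A' ** g x = mat 1" using XG GX by blast
  hence "g x ** matrix_inv (g x) = mat 1" unfolding matrix_inv_def by (rule someI2_ex) simp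
  hence "X ** (g x ** matrix_inv (g x)) = X" by simp
  hence "matrix_inv (g x) = X" by (simp add: matrix_mul_assoc XG)
  thus ?thesis by (simp add: X_def)
qed

lemma shear_sym: "shear U \<mu> \<nu> = shear U \<nu> \<mu>"
  using con by (simp add: constrained_def)

lemma eigen: "(\<Sum>\<alpha>\<in>UNIV. shear_mix (g x) U \<mu> \<alpha> * e A $ \<alpha>) = \<Lambda> A * e A $ \<mu>"
  using frame by (simp add: eigenframe_def)

lemma Lam0: "\<Lambda> 0 = 0"
proof -
  have "\<Lambda> 0 * e 0 $ \<mu> = 0" for \<mu>
  proof -
    have "\<Lambda> 0 * e 0 $ \<mu> = (\<Sum>\<alpha>\<in>UNIV. \<Sum>\<kappa>\<in>UNIV. shear U \<mu> \<kappa> * (g x $ \<kappa> $ \<alpha> * e 0 $ \<alpha>))"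
      unfolding eigen[symmetric] by (simp add: shear_mix_def sum_distrib_left sum_distrib_right mult_ac)
    also have "\<dots> = (\<Sum>\<kappa>\<in>UNIV. vel_low (g x) U \<kappa> * shear U \<kappa> \<mu>)"
      by (subst sum.swap) (simp add: low0 low_def sum_distrib_left sum_distrib_right shear_sym[of _ \<mu>] mult_ac)
    also have "\<dots> = 0" using con by (simp add: constrained_def)
    finally show ?thesis .
  qed
  moreover have "\<exists>\<mu>. e 0 $ \<mu> \<noteq> 0" by (rule ccontr) (use orth[of 0 0] in \<open>simp add: sg_def\<close>)
  ultimately show ?thesis by auto
qed

text \<open>Raising the index in the spectral decomposition produces a factor \<open>sg A\<close>.
  It differs from 1 only at A = 0, where the eigenvalue vanishes.\<close>

lemma shear_frame: "shear U \<mu> \<beta> = (\<Sum>A\<in>UNIV. \<Lambda> A * e A $ \<mu> * e A $ \<beta>)"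
proof -
  have "shear U \<mu> \<beta> = (\<Sum>\<kappa>\<in>UNIV. shear U \<mu> \<kappa> * of_bool (\<beta> = \<kappa>))"
    by simp
  also have "\<dots> = (\<Sum>\<kappa>\<in>UNIV. \<Sum>A\<in>UNIV. \<Sum>\<alpha>\<in>UNIV. sg A * e A $ \<beta> * (shear U \<mu> \<kappa> * g x $ \<kappa> $ \<alpha> * e A $ \<alpha>))"
    by (simp add: complete[symmetric] low_def sum_distrib_left mult_ac)
  also have "\<dots> = (\<Sum>A\<in>UNIV. \<Sum>\<alpha>\<in>UNIV. \<Sum>\<kappa>\<in>UNIV. sg A * e A $ \<beta> * (shear U \<mu> \<kappa> * g x $ \<kappa> $ \<alpha> * e A $ \<alpha>))"
    by (rule trans[OF sum.swap], rule sum.cong[OF refl], rule sum.swap)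
  also have "\<dots> = (\<Sum>A\<in>UNIV. sg A * e A $ \<beta> * (\<Lambda> A * e A $ \<mu>))"
    by (simp add: eigen[symmetric] shear_mix_def sum_distrib_left sum_distrib_right)
  also have "\<dots> = (\<Sum>A\<in>UNIV. \<Lambda> A * e A $ \<mu> * e A $ \<beta>)"
    by (intro sum.cong refl) (auto simp: sg_def Lam0)
  finally show ?thesis .
qed

definition fr_comp :: "real^4 \<Rightarrow> 4 \<Rightarrow> real" where "fr_comp \<phi> A = (\<Sum>\<mu>\<in>UNIV. e A $ \<mu> * \<phi> $ \<mu>)"

lemma zc_frame: "zc U \<phi> = fr_comp \<phi> 0"
  by (simp add: zc_def fr_comp_def e0)

lemma Proj_frame: "Proj (g x) U \<mu> \<nu> = (\<Sum>A\<in>UNIV. of_bool (A \<noteq> 0) * e A $ \<mu> * e A $ \<nu>)"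
  by (simp add: Proj_def ginv sum_4' sg_def e0)

lemma vvec_frame: "vvec (g x) U \<phi> $ \<mu> = (\<Sum>A\<in>UNIV. of_bool (A \<noteq> 0) * fr_comp \<phi> A * e A $ \<mu>)"
proof -
  have "vvec (g x) U \<phi> $ \<mu> = (\<Sum>\<alpha>\<in>UNIV. \<Sum>A\<in>UNIV. of_bool (A \<noteq> 0) * e A $ \<mu> * (e A $ \<alpha> * \<phi> $ \<alpha>))"
    by (simp add: vvec_def Proj_frame sum_distrib_left sum_distrib_right mult_ac)
  also have "\<dots> = (\<Sum>A\<in>UNIV. of_bool (A \<noteq> 0) * e A $ \<mu> * fr_comp \<phi> A)"
    by (subst sum.swap) (simp add: fr_comp_def sum_distrib_left)
  finally show ?thesis by (simp add: mult_ac)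
qed

lemma wlow_frame: "(\<Sum>\<nu>\<in>UNIV. wlow (g x) U \<phi> \<nu> * e A $ \<nu>) = \<Lambda> A * fr_comp \<phi> A"
proof -
  have "(\<Sum>\<nu>\<in>UNIV. wlow (g x) U \<phi> \<nu> * e A $ \<nu>)
    = (\<Sum>\<nu>\<in>UNIV. \<Sum>\<alpha>\<in>UNIV. \<phi> $ \<alpha> * (shear_mix (g x) U \<alpha> \<nu> * e A $ \<nu>))"
    by (simp add: wlow_def sum_distrib_left sum_distrib_right mult_ac)
  also have "\<dots> = (\<Sum>\<alpha>\<in>UNIV. \<phi> $ \<alpha> * (\<Lambda> A * e A $ \<alpha>))"
    by (subst sum.swap) (simp add: eigen[symmetric] sum_distrib_left)
  finally show ?thesis by (simp add: fr_comp_def sum_distrib_left mult_ac)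
qed

lemma wup_frame: "(\<Sum>\<alpha>\<in>UNIV. \<phi> $ \<alpha> * shear U \<alpha> \<mu>) = (\<Sum>A\<in>UNIV. \<Lambda> A * fr_comp \<phi> A * e A $ \<mu>)"
proof -
  have "(\<Sum>\<alpha>\<in>UNIV. \<phi> $ \<alpha> * shear U \<alpha> \<mu>) = (\<Sum>\<alpha>\<in>UNIV. \<Sum>A\<in>UNIV. \<Lambda> A * e A $ \<mu> * (e A $ \<alpha> * \<phi> $ \<alpha>))"
    by (simp add: shear_frame sum_distrib_left mult_ac)
  also have "\<dots> = (\<Sum>A\<in>UNIV. \<Lambda> A * e A $ \<mu> * fr_comp \<phi> A)"
    by (subst sum.swap) (simp add: fr_comp_def sum_distrib_left)
  finally show ?thesis by (simp add: mult_ac)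
qed

text \<open>Fills the covector slot and the velocity slot of a tensor at once. It is linear and
  splits on products, so that the frame form of \<open>Cpi\<close> can be found term by
  term.\<close>

definition contract :: "real^4 \<Rightarrow> 4 \<Rightarrow> (4 \<Rightarrow> 4 \<Rightarrow> real) \<Rightarrow> real" where
  "contract \<phi> N t = (\<Sum>\<nu>\<in>UNIV. (\<Sum>\<alpha>\<in>UNIV. \<phi> $ \<alpha> * t \<alpha> \<nu>) * e N $ \<nu>)"

lemma contract_add: "contract \<phi> N (\<lambda>\<alpha> \<nu>. s \<alpha> \<nu> + t \<alpha> \<nu>) = contract \<phi> N s + contract \<phi> N t"
  by (simp add: contract_def distrib_left distrib_right sum.distrib)

lemma contract_diff: "contract \<phi> N (\<lambda>\<alpha> \<nu>. s \<alpha> \<nu> - t \<alpha> \<nu>) = contract \<phi> N s - contract \<phi> N t"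
  by (simp add: contract_def algebra_simps sum_subtractf)

lemma contract_scale: "contract \<phi> N (\<lambda>\<alpha> \<nu>. r * t \<alpha> \<nu>) = r * contract \<phi> N t"
  by (simp add: contract_def sum_distrib_left sum_distrib_right mult_ac)

lemma contract_prod: "contract \<phi> N (\<lambda>\<alpha> \<nu>. a \<alpha> * b \<nu>) = (\<Sum>\<alpha>\<in>UNIV. \<phi> $ \<alpha> * a \<alpha>) * (\<Sum>\<nu>\<in>UNIV. b \<nu> * e N $ \<nu>)"
  unfolding contract_def sum_product by (simp add: sum_distrib_right sum_distrib_left mult_ac) (rule sum.swap)

lemma contract_kron: "contract \<phi> N (\<lambda>\<alpha> \<nu>. kron \<alpha> \<nu>) = fr_comp \<phi> N"
  by (simp add: contract_def kron_def fr_comp_def mult_ac if_distrib cong: if_cong)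

lemma contract_shear_mix: "contract \<phi> N (\<lambda>\<alpha> \<nu>. shear_mix (g x) U \<alpha> \<nu>) = \<Lambda> N * fr_comp \<phi> N"
  using wlow_frame[of \<phi> N] by (simp add: contract_def wlow_def mult_ac)

lemma kron_frame: "(\<Sum>\<nu>\<in>UNIV. kron \<beta> \<nu> * e N $ \<nu>) = e N $ \<beta>"
  by (simp add: kron_def if_distrib[of "\<lambda>y. y * _"] cong: if_cong)

lemma contract_Proj_mix: "contract \<phi> N (\<lambda>\<alpha> \<nu>. Proj_mix (g x) U \<alpha> \<nu>) = of_bool (N \<noteq> 0) * fr_comp \<phi> N"
proof -
  have "contract \<phi> N (\<lambda>\<alpha> \<nu>. Proj_mix (g x) U \<alpha> \<nu>) = fr_comp \<phi> N + fr_comp \<phi> 0 * (\<Sum>\<nu>\<in>UNIV. e N $ \<nu> * low 0 \<nu>)"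
    unfolding Proj_mix_def low0 contract_add contract_kron contract_prod by (simp add: fr_comp_def e0 mult_ac)
  thus ?thesis by (auto simp: orth sg_def)
qed

definition bulk_visc :: real where
  "bulk_visc = val (zeta M) (g x) U + val (delta_bulk M) (g x) U * bulk U"

definition shear_visc :: real where
  "shear_visc = val (eta M) (g x) U + (1/2) * val (lam_shear_bulk M) (g x) U * bulk U"

definition shear_grad :: real where
  "shear_grad = val (delta_shear M) (g x) U - val (tau_shear_shear M) (g x) U / 3"

sublocale R: frame_symbol "enth M U" "P_energy M U" "P_particle M U" "particle U"
  "val (tau_bulk M) (g x) U" bulk_visc
  "val (lam_bulk_shear M) (g x) U" "val (tau_shear M) (g x) U"
  shear_visc shear_grad "val (tau_shear_shear M) (g x) U" \<Lambda> "fr_comp \<phi>" for \<phi> .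

lemma Cpi_frame:
  "(\<Sum>\<nu>\<in>UNIV. (\<Sum>\<alpha>\<in>UNIV. \<phi> $ \<alpha> * Cpi (g x) M U \<mu> \<beta> \<alpha> \<nu>) * e N $ \<nu>) =
   (\<Sum>A\<in>UNIV. \<Sum>B\<in>UNIV. e A $ \<mu> * e B $ \<beta> * R.shear_coeff \<phi> A B N)"
proof -
  define H ts ds tt where "H = shear_visc" and "ts = val (tau_shear M) (g x) U"
    and "ds = shear_grad" and "tt = val (tau_shear_shear M) (g x) U"
  have v: "(\<Sum>\<alpha>\<in>UNIV. \<phi> $ \<alpha> * Proj (g x) U \<mu> \<alpha>) = (\<Sum>A\<in>UNIV. of_bool (A \<noteq> 0) * fr_comp \<phi> A * e A $ \<mu>)" for \<mu>
    using vvec_frame[of \<phi> \<mu>] by (simp add: vvec_def mult_ac)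
  have v': "(\<Sum>\<alpha>\<in>UNIV. \<phi> $ \<alpha> * Proj (g x) U \<alpha> \<mu>) = (\<Sum>A\<in>UNIV. of_bool (A \<noteq> 0) * fr_comp \<phi> A * e A $ \<mu>)" for \<mu>
    unfolding v[symmetric] by (simp add: Proj_frame mult_ac)
  \<comment> \<open>Each term is arranged as a scalar times a function of \<alpha> times a function
    of \<nu>, or as a scalar times a mixed tensor, the shapes to which the rules for
    \<open>contract\<close> apply.\<close>
  have C: "Cpi (g x) M U \<mu> \<beta> = (\<lambda>\<alpha> \<nu>.
     H * (Proj (g x) U \<mu> \<alpha> * kron \<beta> \<nu> + Proj (g x) U \<beta> \<alpha> * kron \<mu> \<nu>
          - (2/3 * Proj (g x) U \<mu> \<beta>) * Proj_mix (g x) U \<alpha> \<nu>)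
     - ts * (vel U \<beta> * (vel U \<alpha> * shear_mix (g x) U \<mu> \<nu>) + vel U \<mu> * (vel U \<alpha> * shear_mix (g x) U \<beta> \<nu>))
     + (ds * shear U \<mu> \<beta>) * kron \<alpha> \<nu>
     + tt / 4 * ((Proj (g x) U \<alpha> \<beta> * shear_mix (g x) U \<mu> \<nu> + Proj (g x) U \<alpha> \<mu> * shear_mix (g x) U \<beta> \<nu>)
        + (shear U \<alpha> \<mu> * kron \<beta> \<nu> + shear U \<alpha> \<beta> * kron \<mu> \<nu>))
     - (tt / 3 * Proj (g x) U \<mu> \<beta>) * shear_mix (g x) U \<alpha> \<nu>)"
    by (simp add: fun_eq_iff Cpi_def shear_visc_def shear_grad_def H_def ts_def ds_def tt_def algebra_simps)
  have "(\<Sum>\<nu>\<in>UNIV. (\<Sum>\<alpha>\<in>UNIV. \<phi> $ \<alpha> * Cpi (g x) M U \<mu> \<beta> \<alpha> \<nu>) * e N $ \<nu>) = contract \<phi> N (Cpi (g x) M U \<mu> \<beta>)"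
    by (simp add: contract_def)
  also have "\<dots> =
     H * ((\<Sum>A\<in>UNIV. of_bool (A \<noteq> 0) * fr_comp \<phi> A * e A $ \<mu>) * e N $ \<beta>
          + (\<Sum>A\<in>UNIV. of_bool (A \<noteq> 0) * fr_comp \<phi> A * e A $ \<beta>) * e N $ \<mu>
          - (2/3 * Proj (g x) U \<mu> \<beta>) * (of_bool (N \<noteq> 0) * fr_comp \<phi> N))
     - ts * (e 0 $ \<beta> * (fr_comp \<phi> 0 * (\<Lambda> N * e N $ \<mu>)) + e 0 $ \<mu> * (fr_comp \<phi> 0 * (\<Lambda> N * e N $ \<beta>)))
     + (ds * shear U \<mu> \<beta>) * fr_comp \<phi> N
     + tt / 4 * (((\<Sum>A\<in>UNIV. of_bool (A \<noteq> 0) * fr_comp \<phi> A * e A $ \<beta>) * (\<Lambda> N * e N $ \<mu>)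
           + (\<Sum>A\<in>UNIV. of_bool (A \<noteq> 0) * fr_comp \<phi> A * e A $ \<mu>) * (\<Lambda> N * e N $ \<beta>))
        + ((\<Sum>A\<in>UNIV. \<Lambda> A * fr_comp \<phi> A * e A $ \<mu>) * e N $ \<beta> + (\<Sum>A\<in>UNIV. \<Lambda> A * fr_comp \<phi> A * e A $ \<beta>) * e N $ \<mu>))
     - (tt / 3 * Proj (g x) U \<mu> \<beta>) * (\<Lambda> N * fr_comp \<phi> N)"
    unfolding C contract_add contract_diff contract_scale contract_prod contract_kron contract_shear_mix contract_Proj_mix kron_frame eigen v v' wup_frame e0[symmetric]
    by (simp add: fr_comp_def mult_ac)
  also have "\<dots> = (\<Sum>A\<in>UNIV. \<Sum>B\<in>UNIV. e A $ \<mu> * e B $ \<beta> * R.shear_coeff \<phi> A B N)"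
    unfolding R.shear_coeff_def unfolding H_def[symmetric] ts_def[symmetric] ds_def[symmetric]
    unfolding tt_def[symmetric]
      Proj_frame shear_frame
    using exhaust_4'[of N]
    by (elim disjE) (simp_all add: sum_4' R.sp_def Lam0 field_simps)
  finally show ?thesis .
qed

text \<open>Change of basis of the 23-dimensional space from frame to coordinate components.
  Unknowns and equations carry the same tensor indices, so it converts both, and
  \<open>princ\<close> is conjugate to the frame symbol.\<close>

definition frame_mat :: "real^fld^fld" where
  "frame_mat = (\<chi> i j. case i of
      Vel \<mu> \<Rightarrow> (case j of Vel A \<Rightarrow> e A $ \<mu> | _ \<Rightarrow> 0)
    | Shear \<mu> \<beta> \<Rightarrow> (case j of Shear A B \<Rightarrow> e A $ \<mu> * e B $ \<beta> | _ \<Rightarrow> 0)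
    | _ \<Rightarrow> of_bool (i = j))"

lemma det_frame_mat: "det frame_mat \<noteq> 0"
proof -
  define frame_mat' :: "real^fld^fld" where "frame_mat' = (\<chi> i j. case i of
      Vel A \<Rightarrow> (case j of Vel \<mu> \<Rightarrow> sg A * low A \<mu> | _ \<Rightarrow> 0)
    | Shear A B \<Rightarrow> (case j of Shear \<mu> \<beta> \<Rightarrow> (sg A * low A \<mu>) * (sg B * low B \<beta>) | _ \<Rightarrow> 0)
    | _ \<Rightarrow> of_bool (i = j))"
  have o: "(\<Sum>\<mu>\<in>UNIV. sg A * low A \<mu> * e B $ \<mu>) = of_bool (A = B)" for A B
  proof -
    have "(\<Sum>\<mu>\<in>UNIV. sg A * low A \<mu> * e B $ \<mu>) = sg A * (\<Sum>\<mu>\<in>UNIV. e B $ \<mu> * low A \<mu>)"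
      by (simp add: sum_distrib_left mult_ac)
    thus ?thesis by (auto simp: orth)
  qed
  have oo: "(\<Sum>\<mu>\<in>UNIV. \<Sum>\<beta>\<in>UNIV. (sg A * low A \<mu>) * (sg B * low B \<beta>) * (e C $ \<mu> * e D $ \<beta>))
    = of_bool (A = C) * of_bool (B = D)" for A B C D
    unfolding o[symmetric] sum_product by (simp add: mult_ac)
  have "(frame_mat' ** frame_mat) $ i $ j = mat 1 $ i $ j" for i j
    by (cases i; cases j)
      (simp_all add: matrix_matrix_mult_def sum_fld frame_mat_def frame_mat'_def mat_def o oo)
  hence "frame_mat' ** frame_mat = mat 1" by (simp add: vec_eq_iff)
  hence "det frame_mat' * det frame_mat = 1" by (metis det_mul det_I)
  thus ?thesis by auto
qed

lemma princ_frame_mat: "princ g x M U \<phi> ** frame_mat = frame_mat ** R.symbol \<phi>"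
proof -
  have "(princ g x M U \<phi> ** frame_mat) $ i $ j = (frame_mat ** R.symbol \<phi>) $ i $ j" for i j
  proof -
    have col: "(princ g x M U \<phi> ** frame_mat) $ i $ j = (princ g x M U \<phi> *v (\<chi> k. frame_mat $ k $ j)) $ i"
      by (simp add: matrix_matrix_mult_def matrix_vector_mult_def)
    have vel_sum: "(\<Sum>\<nu>\<in>UNIV. (a * \<phi> $ \<nu> + b * wlow (g x) U \<phi> \<nu>) * e N $ \<nu>) = a * fr_comp \<phi> N + b * (\<Lambda> N * fr_comp \<phi> N)"
      for a b N
    proof -
      have "(\<Sum>\<nu>\<in>UNIV. (a * \<phi> $ \<nu> + b * wlow (g x) U \<phi> \<nu>) * e N $ \<nu>)
        = a * fr_comp \<phi> N + b * (\<Sum>\<nu>\<in>UNIV. wlow (g x) U \<phi> \<nu> * e N $ \<nu>)"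
        by (simp add: fr_comp_def sum_distrib_left sum.distrib algebra_simps)
      thus ?thesis by (simp only: wlow_frame)
    qed
    \<comment> \<open>The particle row has no shear term and the energy row has it with coefficient
      1; these are the corresponding simplified instances.\<close>
    note vel_sum1 = vel_sum[of _ 0, simplified] and vel_sum2 = vel_sum[of _ 1, simplified]
    have fD: "(\<Sum>\<beta>\<in>UNIV. \<phi> $ \<beta> * (a * e N $ \<beta>)) = a * fr_comp \<phi> N" for a N
      by (simp add: fr_comp_def sum_distrib_left mult_ac)
    have ee: "(\<Sum>A\<in>UNIV. \<Sum>B\<in>UNIV. e A $ \<mu> * e B $ \<beta> * (of_bool (A = C \<and> B = D) * c)) = e C $ \<mu> * e D $ \<beta> * c" for \<mu> \<beta> C D c
      using exhaust_4'[of C] exhaust_4'[of D] by (elim disjE) (simp_all add: sum_4')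
    have eV: "(\<Sum>A\<in>UNIV. e A $ \<mu> * (c * of_bool (A = N) - of_bool (A = 0) * d)) = c * e N $ \<mu> - vel U \<mu> * d" for \<mu> N c d
      using exhaust_4'[of N] by (elim disjE) (simp_all add: sum_4' e0 algebra_simps)
    have eS: "(\<Sum>A\<in>UNIV. e A $ \<mu> * (of_bool (A = C) * d)) = e C $ \<mu> * d" for \<mu> C d
      using exhaust_4'[of C] by (elim disjE) (simp_all add: sum_4')
    have eP: "(\<Sum>A\<in>UNIV. e A $ \<mu> * (R.sp \<phi> A * c)) = vvec (g x) U \<phi> $ \<mu> * c"
      "(\<Sum>A\<in>UNIV. e A $ \<mu> * R.sp \<phi> A) = vvec (g x) U \<phi> $ \<mu>" for \<mu> c
      by (simp_all add: vvec_frame R.sp_def sum_4' algebra_simps)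
    note expl = princ_explicit[where g = g and x = x, OF con] and rhs = matrix_matrix_mult_def sum_fld frame_mat_def R.symbol_def
    show ?thesis
      unfolding col
    proof (cases i)
      case i: (Vel \<mu>)
      show "(princ g x M U \<phi> *v (\<chi> k. frame_mat $ k $ j)) $ i = (frame_mat ** R.symbol \<phi>) $ i $ j"
        by (cases j) (simp_all add: i expl rhs zc_frame wlow_frame eV eS eP fD)
    next
      case i: Energy
      show "(princ g x M U \<phi> *v (\<chi> k. frame_mat $ k $ j)) $ i = (frame_mat ** R.symbol \<phi>) $ i $ j"
        by (cases j) (simp_all add: i expl rhs zc_frame vel_sum2)
    next
      case i: Particle
      show "(princ g x M U \<phi> *v (\<chi> k. frame_mat $ k $ j)) $ i = (frame_mat ** R.symbol \<phi>) $ i $ j"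
        by (cases j) (simp_all add: i expl rhs zc_frame vel_sum1)
    next
      case i: Bulk
      show "(princ g x M U \<phi> *v (\<chi> k. frame_mat $ k $ j)) $ i = (frame_mat ** R.symbol \<phi>) $ i $ j"
        by (cases j) (simp_all add: i expl rhs zc_frame vel_sum bulk_visc_def[symmetric])
    next
      case i: (Shear \<mu> \<beta>)
      show "(princ g x M U \<phi> *v (\<chi> k. frame_mat $ k $ j)) $ i = (frame_mat ** R.symbol \<phi>) $ i $ j"
        by (cases j) (simp_all add: i expl rhs zc_frame Cpi_frame ee)
    qed
  qed
  thus ?thesis by (simp add: vec_eq_iff)
qed

section \<open>Passage to complex covectors\<close>

definition cfr_comp :: "complex^4 \<Rightarrow> 4 \<Rightarrow> complex" where
  "cfr_comp \<phi> A = (\<Sum>\<mu>\<in>UNIV. of_real (e A $ \<mu>) * \<phi> $ \<mu>)"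

sublocale C: frame_symbol "of_real (enth M U)" "of_real (P_energy M U)" "of_real (P_particle M U)"
  "of_real (particle U)" "of_real (val (tau_bulk M) (g x) U)" "of_real bulk_visc"
  "of_real (val (lam_bulk_shear M) (g x) U)" "of_real (val (tau_shear M) (g x) U)"
  "of_real shear_visc" "of_real shear_grad" "of_real (val (tau_shear_shear M) (g x) U)"
  "\<lambda>A. of_real (\<Lambda> A)" "cfr_comp \<phi>" for \<phi> .

text \<open>All entries are linear in the covector with real coefficients, so real and imaginary
  parts separate. The complex change of basis then follows from two instances of the real
  one.\<close>

lemma complex_entry:
  "Re (C.entry \<phi> i j) = R.entry (\<chi> k. Re (\<phi> $ k)) i j"
  "Im (C.entry \<phi> i j) = R.entry (\<chi> k. Im (\<phi> $ k)) i j"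
proof -
  have b: "Re (of_bool P) = of_bool P" "Im (of_bool P) = 0" for P by (cases P; simp)+
  have F: "Re (cfr_comp \<phi> A) = fr_comp (\<chi> k. Re (\<phi> $ k)) A" "Im (cfr_comp \<phi> A) = fr_comp (\<chi> k. Im (\<phi> $ k)) A" for A
    by (simp_all add: cfr_comp_def fr_comp_def)
  have s: "Re (C.sp \<phi> A) = R.sp (\<chi> k. Re (\<phi> $ k)) A" "Im (C.sp \<phi> A) = R.sp (\<chi> k. Im (\<phi> $ k)) A" for A
    by (simp_all add: C.sp_def R.sp_def F)
  have c: "Re (C.shear_coeff \<phi> A B N) = R.shear_coeff (\<chi> k. Re (\<phi> $ k)) A B N"
    "Im (C.shear_coeff \<phi> A B N) = R.shear_coeff (\<chi> k. Im (\<phi> $ k)) A B N" for A B N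
    by (simp_all only: C.shear_coeff_def R.shear_coeff_def) (simp_all add: b F s)
  show "Re (C.entry \<phi> i j) = R.entry (\<chi> k. Re (\<phi> $ k)) i j"
    by (cases i; cases j) (simp_all add: b F s c)
  show "Im (C.entry \<phi> i j) = R.entry (\<chi> k. Im (\<phi> $ k)) i j"
    by (cases i; cases j) (simp_all add: b F s c)
qed

lemma det_princ:
  fixes \<phi> :: "complex^4"
  assumes "val (tau_bulk M) (g x) U \<noteq> 0" "val (tau_shear M) (g x) U \<noteq> 0"
  shows "det (princ g x M U \<phi>) = of_real (val (tau_bulk M) (g x) U) * of_real (val (tau_shear M) (g x) U) ^ 16
    * cfr_comp \<phi> 0 ^ 15 * C.quad \<phi> * det3_update (C.diag_entry \<phi>) (\<lambda>a. (cfr_comp \<phi> a)\<^sup>2) C.update_entry"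
proof -
  define cframe_mat :: "complex^fld^fld" where "cframe_mat = (\<chi> i j. of_real (frame_mat $ i $ j))"
  have "det cframe_mat = of_real (det frame_mat)" by (simp add: cframe_mat_def det_def)
  hence cframe_mat: "det cframe_mat \<noteq> 0" using det_frame_mat by simp
  have "Re ((princ g x M U \<phi> ** cframe_mat) $ i $ j) = (princ g x M U (\<chi> k. Re (\<phi> $ k)) ** frame_mat) $ i $ j"
    "Im ((princ g x M U \<phi> ** cframe_mat) $ i $ j) = (princ g x M U (\<chi> k. Im (\<phi> $ k)) ** frame_mat) $ i $ j" for i j
    by (simp_all add: matrix_matrix_mult_def cframe_mat_def princ_def)
  moreover have "Re ((cframe_mat ** C.symbol \<phi>) $ i $ j) = (frame_mat ** R.symbol (\<chi> k. Re (\<phi> $ k))) $ i $ j"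
    "Im ((cframe_mat ** C.symbol \<phi>) $ i $ j) = (frame_mat ** R.symbol (\<chi> k. Im (\<phi> $ k))) $ i $ j" for i j
    by (simp_all add: matrix_matrix_mult_def cframe_mat_def C.symbol_def R.symbol_def complex_entry)
  ultimately have "princ g x M U \<phi> ** cframe_mat = cframe_mat ** C.symbol \<phi>"
    by (simp add: vec_eq_iff complex_eq_iff princ_frame_mat)
  hence "det (princ g x M U \<phi>) * det cframe_mat = det cframe_mat * det (C.symbol \<phi>)"
    by (metis det_mul)
  hence "det (princ g x M U \<phi>) = det (C.symbol \<phi>)" using cframe_mat by simp
  also have "\<dots> = of_real (val (tau_bulk M) (g x) U) * of_real (val (tau_shear M) (g x) U) ^ 16
    * cfr_comp \<phi> 0 ^ 15 * C.quad \<phi> * det3_update (C.diag_entry \<phi>) (\<lambda>a. (cfr_comp \<phi> a)\<^sup>2) C.update_entry"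
    using assms Lam0 by (intro C.det_symbol) simp_all
  finally show ?thesis .
qed

end


subsection \<open>The characteristic determinant in a given direction\<close>

lemma sum_dirsq: "dirsq c k 1 + dirsq c k 2 + dirsq c k 3 = 1"
  by (simp add: dirsq_def algebra_simps)

lemma dirsq_nonneg: "c \<in> {0..1} \<Longrightarrow> k \<in> {0..1} \<Longrightarrow> 0 \<le> dirsq c k a"
  by (simp add: dirsq_def)

lemma Lam_dir_eq: "Lam_dir L c k = L 1 * dirsq c k 1 + L 2 * dirsq c k 2 + L 3 * dirsq c k 3"
  by (simp add: Lam_dir_def)

text \<open>The parameters cover the whole simplex of squared cosines. At the pole
  \<open>k = 1\<close> the value of \<open>c\<close> is immaterial and 0 is taken; elsewhere
  \<open>c\<close> is recovered by dividing by 1 - y3.\<close>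

lemma dirsq_surj:
  assumes "0 \<le> y1" "0 \<le> y2" "0 \<le> y3" "y1 + y2 + y3 = 1"
  obtains c k where "c \<in> {0..1}" "k \<in> {0..1}" "dirsq c k 1 = y1" "dirsq c k 2 = y2" "dirsq c k 3 = y3"
proof (cases "y3 = 1")
  case True
  thus ?thesis using that[of 0 1] assms by (simp add: dirsq_def)
next
  case False
  hence "1 - y3 > 0" using assms by linarith
  moreover have "1 - y1 / (1 - y3) = y2 / (1 - y3)" using \<open>1 - y3 > 0\<close> assms by (simp add: field_simps)
  ultimately show ?thesis using that[of "y1 / (1 - y3)" y3] assms by (simp add: dirsq_def)
qed

locale causal_frame = fluid_frame +
  assumes tau: "val (tau_bulk M) (g x) U \<noteq> 0" "val (tau_shear M) (g x) U \<noteq> 0"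
    and nz: "\<And>A. enth M U + \<Lambda> A \<noteq> 0"
    and slices: "spacelike_time_slices (g x)"
begin

text \<open>Only the squares of the spatial components are prescribed, their signs being irrelevant
  to the determinant. The ratio \<zeta> = z/v is complex for the sake of (CI).\<close>

definition aligned :: "real \<Rightarrow> real \<Rightarrow> real \<Rightarrow> complex \<Rightarrow> complex^4 \<Rightarrow> bool" where
  "aligned c k v \<zeta> \<phi> \<longleftrightarrow> cfr_comp \<phi> 0 = of_real v * \<zeta> \<and>
     (\<forall>a. a \<noteq> 0 \<longrightarrow> (cfr_comp \<phi> a)\<^sup>2 = of_real (v\<^sup>2 * dirsq c k a))"

text \<open>Once v is factored out, the cubic depends only on \<open>c\<close>, \<open>k\<close> and
  \<zeta>^2, so one triple serves all aligned covectors. The power 23 is 15 from z^15, 2 from the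
  quadratic factor and 6 from the 3 x 3 block.\<close>

lemma det_princ_direction:
  "\<exists>a0 a1 a2 :: real. \<forall>\<phi> \<zeta> v. aligned c k v \<zeta> \<phi> \<longrightarrow>
     det (princ g x M U \<phi>) =
       of_real ((\<Prod>A\<in>UNIV. enth M U + \<Lambda> A) * v ^ 23 * val (tau_bulk M) (g x) U * val (tau_shear M) (g x) U ^ 16)
       * \<zeta> ^ 15 * (\<zeta>\<^sup>2 - of_real (quad_root (g x) M U \<Lambda> c k))
       * ((\<zeta>\<^sup>2) ^ 3 - of_real a2 * (\<zeta>\<^sup>2)\<^sup>2 + of_real a1 * \<zeta>\<^sup>2 - of_real a0)"
proof -
  define E tt ts H where "E = enth M U" and "tt = val (tau_shear_shear M) (g x) U"
    and "ts = val (tau_shear M) (g x) U" and "H = shear_visc"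
  define m where "m A = (H + tt / 4 * (\<Lambda> A + Lam_dir \<Lambda> c k)) / ts" for A
  define update_entry where "update_entry = (R.update_entry :: 4 \<Rightarrow> 4 \<Rightarrow> real)"
  have E: "E \<noteq> 0" using nz[of 0] Lam0 by (simp add: E_def)
  have n: "E + \<Lambda> A \<noteq> 0" for A using nz by (simp add: E_def)
  obtain a0 a1 a2 where a: "\<And>y :: complex. det3_update (\<lambda>A. y * of_real (E + \<Lambda> A) - of_real (m A))
      (\<lambda>A. of_real (dirsq c k A)) (\<lambda>A N. of_real (update_entry A N))
      = of_real ((E + \<Lambda> 1) * (E + \<Lambda> 2) * (E + \<Lambda> 3)) * (y ^ 3 - of_real a2 * y\<^sup>2 + of_real a1 * y - of_real a0)"
    by (rule det3_update_cubic[of "\<lambda>A. E + \<Lambda> A" m "dirsq c k" update_entry]) ((rule n) | (rule that, assumption))+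
  have "det (princ g x M U \<phi>) =
       of_real ((\<Prod>A\<in>UNIV. enth M U + \<Lambda> A) * v ^ 23 * val (tau_bulk M) (g x) U * val (tau_shear M) (g x) U ^ 16)
       * \<zeta> ^ 15 * (\<zeta>\<^sup>2 - of_real (quad_root (g x) M U \<Lambda> c k))
       * ((\<zeta>\<^sup>2) ^ 3 - of_real a2 * (\<zeta>\<^sup>2)\<^sup>2 + of_real a1 * \<zeta>\<^sup>2 - of_real a0)"
    if al: "aligned c k v \<zeta> \<phi>" for \<phi> \<zeta> v
  proof -
    have 0: "cfr_comp \<phi> 0 = of_real v * \<zeta>"
      and f2: "\<And>a. a \<noteq> 0 \<Longrightarrow> (cfr_comp \<phi> a)\<^sup>2 = of_real (v\<^sup>2) * of_real (dirsq c k a)"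
      using al by (simp_all add: aligned_def)
    have V: "C.V \<phi> = of_real (v\<^sup>2)"
    proof -
      have "C.V \<phi> = of_real (v\<^sup>2 * (dirsq c k 1 + dirsq c k 2 + dirsq c k 3))"
        unfolding C.V_def by (simp add: f2 distrib_left)
      thus ?thesis by (simp only: sum_dirsq mult_1_right)
    qed
    have W: "C.W \<phi> = of_real (v\<^sup>2 * Lam_dir \<Lambda> c k)"
      unfolding C.W_def Lam_dir_eq by (simp add: f2 algebra_simps)
    have q: "quad_root (g x) M U \<Lambda> c k = (H + tt / 4 * Lam_dir \<Lambda> c k) / (ts * E)"
      by (simp add: quad_root_def H_def tt_def ts_def E_def shear_visc_def field_simps)
    have quad: "C.quad \<phi> = of_real (v\<^sup>2 * E) * (\<zeta>\<^sup>2 - of_real (quad_root (g x) M U \<Lambda> c k))"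
    proof -
      have "of_real (v\<^sup>2 * E) * (complex_of_real (quad_root (g x) M U \<Lambda> c k))
        = of_real (v\<^sup>2 * E * quad_root (g x) M U \<Lambda> c k)" by simp
      also have "v\<^sup>2 * E * quad_root (g x) M U \<Lambda> c k = (H * v\<^sup>2 + tt / 4 * (v\<^sup>2 * Lam_dir \<Lambda> c k)) / ts"
        using E tau(2) unfolding q ts_def by (simp add: field_simps)
      finally show ?thesis
        unfolding C.quad_def V W 0
        by (simp add: H_def tt_def ts_def E_def power_mult_distrib right_diff_distrib)
    qed
    have diag_entry: "C.diag_entry \<phi> A = of_real (v\<^sup>2) * (\<zeta>\<^sup>2 * of_real (E + \<Lambda> A) - of_real (m A))" for A
    proof -
      have "of_real (v\<^sup>2) * complex_of_real (m A) = of_real (v\<^sup>2 * m A)" by simp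
      also have "v\<^sup>2 * m A = (H * v\<^sup>2 + tt / 4 * (v\<^sup>2 * \<Lambda> A + v\<^sup>2 * Lam_dir \<Lambda> c k)) / ts"
        unfolding m_def by (simp add: field_simps)
      finally show ?thesis
        unfolding C.diag_entry_def V W 0
        by (simp add: H_def tt_def ts_def E_def power_mult_distrib right_diff_distrib)
    qed
    have kkC: "C.update_entry = (\<lambda>A N. of_real (update_entry A N))"
      by (simp add: fun_eq_iff update_entry_def C.update_entry_def R.update_entry_def)
    have "det3_update (C.diag_entry \<phi>) (\<lambda>a. (cfr_comp \<phi> a)\<^sup>2) C.update_entry
      = det3_update (\<lambda>A. of_real (v\<^sup>2) * (\<zeta>\<^sup>2 * of_real (E + \<Lambda> A) - of_real (m A)))
         (\<lambda>A. of_real (v\<^sup>2) * of_real (dirsq c k A)) (\<lambda>A N. of_real (update_entry A N))"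
      unfolding kkC by (rule det3_update_cong; (rule diag_entry | erule f2))
    also have "\<dots> = of_real (v\<^sup>2) ^ 3 * (of_real ((E + \<Lambda> 1) * (E + \<Lambda> 2) * (E + \<Lambda> 3))
       * ((\<zeta>\<^sup>2) ^ 3 - of_real a2 * (\<zeta>\<^sup>2)\<^sup>2 + of_real a1 * \<zeta>\<^sup>2 - of_real a0))"
      unfolding det3_update_scale a ..
    finally have d3: "det3_update (C.diag_entry \<phi>) (\<lambda>a. (cfr_comp \<phi> a)\<^sup>2) C.update_entry = \<dots>" .
    have prod: "(\<Prod>A\<in>UNIV. enth M U + \<Lambda> A) = E * ((E + \<Lambda> 1) * (E + \<Lambda> 2) * (E + \<Lambda> 3))"
      unfolding UNIV_4' by (simp add: E_def Lam0)
    have pw: "v ^ 23 = v ^ 15 * v\<^sup>2 * (v\<^sup>2) ^ 3" by (simp flip: power_mult power_add)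
    show ?thesis
      unfolding det_princ[OF tau] quad d3 0 prod pw power_mult_distrib[of "of_real v"]
      by (simp only: of_real_mult of_real_power mult_ac)
  qed
  thus ?thesis by blast
qed

section \<open>Covectors with prescribed frame components, and the coefficients of the cubic\<close>

lemma fr_comp_add: "fr_comp (\<phi> + \<psi>) A = fr_comp \<phi> A + fr_comp \<psi> A"
  by (simp add: fr_comp_def distrib_left sum.distrib)

lemma fr_comp_scale: "fr_comp (r *\<^sub>R \<phi>) A = r * fr_comp \<phi> A"
  by (simp add: fr_comp_def sum_distrib_left mult_ac)

lemma cfr_comp_add: "cfr_comp (\<phi> + \<psi>) A = cfr_comp \<phi> A + cfr_comp \<psi> A"
  by (simp add: cfr_comp_def distrib_left sum.distrib)

lemma cfr_comp_scale: "cfr_comp (r *s \<phi>) A = r * cfr_comp \<phi> A"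
  by (simp add: cfr_comp_def sum_distrib_left mult_ac)

lemma cfr_comp_cvec: "cfr_comp (cvec \<phi>) A = of_real (fr_comp \<phi> A)"
  by (simp add: cfr_comp_def fr_comp_def)

definition cov :: "(4 \<Rightarrow> real) \<Rightarrow> real^4" where
  "cov r = (\<chi> \<mu>. \<Sum>A\<in>UNIV. sg A * r A * low A \<mu>)"

lemma fr_comp_cov: "fr_comp (cov r) A = r A"
proof -
  have "fr_comp (cov r) A = (\<Sum>\<mu>\<in>UNIV. \<Sum>B\<in>UNIV. sg B * r B * (e A $ \<mu> * low B \<mu>))"
    by (simp add: fr_comp_def cov_def sum_distrib_left mult_ac)
  also have "\<dots> = (\<Sum>B\<in>UNIV. sg B * r B * (\<Sum>\<mu>\<in>UNIV. e A $ \<mu> * low B \<mu>))"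
    by (subst sum.swap) (simp add: sum_distrib_left)
  also have "\<dots> = r A"
    using exhaust_4'[of A] by (elim disjE) (simp_all add: orth sum_4' sg_def)
  finally show ?thesis .
qed

lemma norm_frame: "\<phi> \<bullet> (matrix_inv (g x) *v \<phi>) = - (fr_comp \<phi> 0)\<^sup>2 + (fr_comp \<phi> 1)\<^sup>2 + (fr_comp \<phi> 2)\<^sup>2 + (fr_comp \<phi> 3)\<^sup>2"
proof -
  have "\<phi> \<bullet> (matrix_inv (g x) *v \<phi>)
    = (\<Sum>\<mu>\<in>UNIV. \<Sum>\<nu>\<in>UNIV. \<Sum>A\<in>UNIV. sg A * (e A $ \<mu> * \<phi> $ \<mu>) * (e A $ \<nu> * \<phi> $ \<nu>))"
    by (simp add: inner_vec_def matrix_vector_mult_def ginv sum_distrib_left sum_distrib_right mult_ac)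
  also have "\<dots> = (\<Sum>A\<in>UNIV. \<Sum>\<mu>\<in>UNIV. \<Sum>\<nu>\<in>UNIV. sg A * (e A $ \<mu> * \<phi> $ \<mu>) * (e A $ \<nu> * \<phi> $ \<nu>))"
    by (rule trans[OF sum.cong[OF refl sum.swap] sum.swap])
  also have "\<dots> = (\<Sum>A\<in>UNIV. sg A * (fr_comp \<phi> A)\<^sup>2)"
    by (simp add: fr_comp_def power2_eq_square sum_product sum_distrib_left mult_ac)
  finally show ?thesis by (simp add: sum_4' sg_def)
qed

lemma vvec_inner: "a \<noteq> 0 \<Longrightarrow> vvec (g x) U \<phi> \<bullet> (g x *v e a) = fr_comp \<phi> a"
proof -
  assume "a \<noteq> 0"
  have ge: "(g x *v e a) $ \<mu> = low a \<mu>" for \<mu> by (simp add: matrix_vector_mult_def low_def)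
  have "vvec (g x) U \<phi> \<bullet> (g x *v e a) = (\<Sum>\<mu>\<in>UNIV. \<Sum>A\<in>UNIV. of_bool (A \<noteq> 0) * fr_comp \<phi> A * (e A $ \<mu> * low a \<mu>))"
    by (simp add: inner_vec_def ge vvec_frame sum_distrib_left sum_distrib_right mult_ac)
  also have "\<dots> = (\<Sum>A\<in>UNIV. of_bool (A \<noteq> 0) * fr_comp \<phi> A * (\<Sum>\<mu>\<in>UNIV. e A $ \<mu> * low a \<mu>))"
    by (subst sum.swap) (simp add: sum_distrib_left)
  also have "\<dots> = fr_comp \<phi> a"
    using exhaust_4'[of a] \<open>a \<noteq> 0\<close> by (elim disjE) (simp_all add: orth sum_4' sg_def)
  finally show ?thesis .
qed

lemma vsq_frame: "vsq (g x) U \<phi> = (fr_comp \<phi> 1)\<^sup>2 + (fr_comp \<phi> 2)\<^sup>2 + (fr_comp \<phi> 3)\<^sup>2"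
proof -
  have "vvec (g x) U \<phi> = (\<Sum>A\<in>UNIV. (of_bool (A \<noteq> 0) * fr_comp \<phi> A) *\<^sub>R e A)"
    by (simp add: vec_eq_iff vvec_frame)
  hence "g x *v vvec (g x) U \<phi> = (\<Sum>A\<in>UNIV. (of_bool (A \<noteq> 0) * fr_comp \<phi> A) *\<^sub>R (g x *v e A))"
    by (simp add: sum_4' matrix_vector_right_distrib matrix_vector_mult_scaleR)
  hence "vsq (g x) U \<phi> = (\<Sum>A\<in>UNIV. (of_bool (A \<noteq> 0) * fr_comp \<phi> A) * (vvec (g x) U \<phi> \<bullet> (g x *v e A)))"
    unfolding vsq_def by (simp add: inner_sum_right)
  thus ?thesis by (simp add: sum_4' vvec_inner power2_eq_square)
qed

lemma det_princ_cvec: "det (princ g x M U (cvec \<phi>)) = of_real (det (princ g x M U \<phi>))"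
  by (simp add: det_def princ_def)

text \<open>Shows that the definite description in \<open>cubic_coeffs\<close> has exactly one
  solution, and that this real triple also decides the vanishing of the determinant at complex
  covectors. The prefactors are nonzero and drop out.\<close>

lemma cubic_coeffs_direction:
  assumes ck: "c \<in> {0..1}" "k \<in> {0..1}"
  shows "\<exists>a0 a1 a2. cubic_coeffs g x M U e \<Lambda> c k = (a0, a1, a2) \<and>
    (\<forall>\<phi> \<zeta> v. aligned c k v \<zeta> \<phi> \<and> v > 0 \<longrightarrow>
     (det (princ g x M U \<phi>) = 0 \<longleftrightarrow> \<zeta> = 0 \<or> \<zeta>\<^sup>2 = of_real (quad_root (g x) M U \<Lambda> c k) \<or>
        (\<zeta>\<^sup>2) ^ 3 - of_real a2 * (\<zeta>\<^sup>2)\<^sup>2 + of_real a1 * \<zeta>\<^sup>2 - of_real a0 = 0))"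
proof -
  obtain a0 a1 a2 where det: "\<forall>\<phi> \<zeta> v. aligned c k v \<zeta> \<phi> \<longrightarrow>
     det (princ g x M U \<phi>) =
       of_real ((\<Prod>A\<in>UNIV. enth M U + \<Lambda> A) * v ^ 23 * val (tau_bulk M) (g x) U * val (tau_shear M) (g x) U ^ 16)
       * \<zeta> ^ 15 * (\<zeta>\<^sup>2 - of_real (quad_root (g x) M U \<Lambda> c k))
       * ((\<zeta>\<^sup>2) ^ 3 - of_real a2 * (\<zeta>\<^sup>2)\<^sup>2 + of_real a1 * \<zeta>\<^sup>2 - of_real a0)"
    using det_princ_direction[of c k] by (elim exE) (rule that)
  have prod: "(\<Prod>A\<in>UNIV. enth M U + \<Lambda> A) \<noteq> 0" using nz by simp
  define q where "q = quad_root (g x) M U \<Lambda> c k"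
  have detR: "det (princ g x M U \<phi>) = (\<Prod>A\<in>UNIV. enth M U + \<Lambda> A) * v ^ 23
           * val (tau_bulk M) (g x) U * val (tau_shear M) (g x) U ^ 16 * z ^ 15
           * (z\<^sup>2 - q) * (z ^ 6 - a2 * z ^ 4 + a1 * z\<^sup>2 - a0)"
    if "fr_comp \<phi> 0 = v * z" "\<And>a. a \<noteq> 0 \<Longrightarrow> (fr_comp \<phi> a)\<^sup>2 = v\<^sup>2 * dirsq c k a" for \<phi> v z
  proof -
    have al: "aligned c k v (of_real z) (cvec \<phi>)"
      using that by (simp add: aligned_def cfr_comp_cvec flip: of_real_power)
    have "complex_of_real (det (princ g x M U \<phi>)) = of_real ((\<Prod>A\<in>UNIV. enth M U + \<Lambda> A) * v ^ 23
           * val (tau_bulk M) (g x) U * val (tau_shear M) (g x) U ^ 16 * z ^ 15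
           * (z\<^sup>2 - q) * (z ^ 6 - a2 * z ^ 4 + a1 * z\<^sup>2 - a0))"
      unfolding det_princ_cvec[symmetric]
      unfolding det[rule_format, OF al] by (simp add: q_def flip: power_mult)
    thus ?thesis by (simp only: of_real_eq_iff)
  qed
  have fact: "cubic_factorization g x M U e \<Lambda> c k a0 a1 a2"
    unfolding cubic_factorization_def Let_def
  proof (intro allI impI)
    fix \<phi> assume A: "vsq (g x) U \<phi> > 0 \<and>
        (\<forall>a\<in>{1, 2, 3}. (vvec (g x) U \<phi> \<bullet> (g x *v e a))\<^sup>2 / vsq (g x) U \<phi> = dirsq c k a)"
    have "(fr_comp \<phi> a)\<^sup>2 = (sqrt (vsq (g x) U \<phi>))\<^sup>2 * dirsq c k a" if "a \<noteq> 0" for a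
      using A that exhaust_4'[of a] by (auto simp: vvec_inner field_simps)
    moreover have "fr_comp \<phi> 0 = sqrt (vsq (g x) U \<phi>) * (zc U \<phi> / sqrt (vsq (g x) U \<phi>))"
      using A by (simp add: zc_frame)
    ultimately show "det (princ g x M U \<phi>) = (\<Prod>A\<in>UNIV. enth M U + \<Lambda> A) * sqrt (vsq (g x) U \<phi>) ^ 23
           * val (tau_bulk M) (g x) U * val (tau_shear M) (g x) U ^ 16 * (zc U \<phi> / sqrt (vsq (g x) U \<phi>)) ^ 15
           * ((zc U \<phi> / sqrt (vsq (g x) U \<phi>))\<^sup>2 - quad_root (g x) M U \<Lambda> c k)
           * ((zc U \<phi> / sqrt (vsq (g x) U \<phi>)) ^ 6 - a2 * (zc U \<phi> / sqrt (vsq (g x) U \<phi>)) ^ 4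
              + a1 * (zc U \<phi> / sqrt (vsq (g x) U \<phi>))\<^sup>2 - a0)"
      unfolding q_def[symmetric] by (intro detR) auto
  qed
  have uniq: "b0 = a0 \<and> b1 = a1 \<and> b2 = a2" if b: "cubic_factorization g x M U e \<Lambda> c k b0 b1 b2" for b0 b1 b2
  proof -
    \<comment> \<open>The test covector has v = 1 and z^2 = s. Taking s above \<bar>q\<bar> keeps z
      and s - q away from 0, so that both factorizations can be divided by their common
      prefactor.\<close>
    have eq: "(b2 - a2) * s\<^sup>2 - (b1 - a1) * s + (b0 - a0) = 0" if s: "s > \<bar>q\<bar>" for s
    proof -
      define r where "r A = (if A = 0 then sqrt s else sqrt (dirsq c k A))" for A
      define \<phi> where "\<phi> = cov r"
      have fr_comp: "fr_comp \<phi> A = r A" for A by (simp add: \<phi>_def fr_comp_cov)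
      have f2: "(fr_comp \<phi> a)\<^sup>2 = dirsq c k a" if "a \<noteq> 0" for a
        using that dirsq_nonneg[OF ck] by (simp add: fr_comp r_def)
      have vs: "vsq (g x) U \<phi> = 1" unfolding vsq_frame by (simp add: f2 sum_dirsq)
      have z: "zc U \<phi> = sqrt s" by (simp add: zc_frame fr_comp r_def)
      have s2: "(sqrt s)\<^sup>2 = s" "sqrt s \<noteq> 0" using s by auto
      have s4: "sqrt s ^ 4 = s\<^sup>2" "sqrt s ^ 6 = s ^ 3"
        using s2(1) power_mult[of "sqrt s" 2 2] power_mult[of "sqrt s" 2 3] by simp_all
      have "det (princ g x M U \<phi>) = (\<Prod>A\<in>UNIV. enth M U + \<Lambda> A)
           * val (tau_bulk M) (g x) U * val (tau_shear M) (g x) U ^ 16 * sqrt s ^ 15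
           * (s - q) * (s ^ 3 - b2 * s\<^sup>2 + b1 * s - b0)"
        using b[unfolded cubic_factorization_def Let_def, rule_format, of \<phi>]
        by (simp add: vs z f2 vvec_inner s2 s4 q_def)
      moreover have "det (princ g x M U \<phi>) = (\<Prod>A\<in>UNIV. enth M U + \<Lambda> A)
           * val (tau_bulk M) (g x) U * val (tau_shear M) (g x) U ^ 16 * sqrt s ^ 15
           * (s - q) * (s ^ 3 - a2 * s\<^sup>2 + a1 * s - a0)"
        using detR[of \<phi> 1 "sqrt s"] by (simp add: fr_comp[of 0] r_def[of 0] f2 s2 s4)
      moreover have "(\<Prod>A\<in>UNIV. enth M U + \<Lambda> A)
           * val (tau_bulk M) (g x) U * val (tau_shear M) (g x) U ^ 16 * sqrt s ^ 15 * (s - q) \<noteq> 0"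
        using prod tau s2 s by auto
      ultimately have "s ^ 3 - b2 * s\<^sup>2 + b1 * s - b0 = s ^ 3 - a2 * s\<^sup>2 + a1 * s - a0"
        by (metis mult_cancel_left)
      thus ?thesis by (simp add: algebra_simps)
    qed
    define w where "w = \<bar>q\<bar> + 1"
    define d2 d1 d0 where "d2 = b2 - a2" and "d1 = b1 - a1" and "d0 = b0 - a0"
    have 1: "d2 * w\<^sup>2 - d1 * w + d0 = 0" using eq[of w] by (simp add: w_def d2_def d1_def d0_def)
    have 2: "d2 * (w + 1)\<^sup>2 - d1 * (w + 1) + d0 = 0" using eq[of "w + 1"] by (simp add: w_def d2_def d1_def d0_def)
    have 3: "d2 * (w + 2)\<^sup>2 - d1 * (w + 2) + d0 = 0" using eq[of "w + 2"] by (simp add: w_def d2_def d1_def d0_def)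
    \<comment> \<open>The second difference over w, w + 1, w + 2 isolates the leading
      coefficient.\<close>
    have "2 * d2 = (d2 * (w + 2)\<^sup>2 - d1 * (w + 2) + d0) - 2 * (d2 * (w + 1)\<^sup>2 - d1 * (w + 1) + d0) + (d2 * w\<^sup>2 - d1 * w + d0)"
      by (simp add: power2_eq_square algebra_simps)
    hence "d2 = 0" using 1 2 3 by simp
    moreover from this have "d1 = 0" using 1 2 by (simp add: algebra_simps)
    ultimately show ?thesis using 1 by (simp add: d2_def d1_def d0_def)
  qed
  have "cubic_coeffs g x M U e \<Lambda> c k = (a0, a1, a2)"
    unfolding cubic_coeffs_def
  proof (rule the_equality)
    fix t assume "case t of (b0, b1, b2) \<Rightarrow> cubic_factorization g x M U e \<Lambda> c k b0 b1 b2"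
    thus "t = (a0, a1, a2)" by (cases t) (use uniq in auto)
  qed (use fact in simp)
  moreover have "det (princ g x M U \<phi>) = 0 \<longleftrightarrow> \<zeta> = 0 \<or> \<zeta>\<^sup>2 = of_real (quad_root (g x) M U \<Lambda> c k) \<or>
        (\<zeta>\<^sup>2) ^ 3 - of_real a2 * (\<zeta>\<^sup>2)\<^sup>2 + of_real a1 * \<zeta>\<^sup>2 - of_real a0 = 0"
    if "aligned c k v \<zeta> \<phi>" "v > 0" for \<phi> \<zeta> v
  proof -
    have "of_real ((\<Prod>A\<in>UNIV. enth M U + \<Lambda> A) * v ^ 23 * val (tau_bulk M) (g x) U * val (tau_shear M) (g x) U ^ 16) \<noteq> (0::complex)"
      unfolding of_real_eq_0_iff using prod tau that(2) by simp
    thus ?thesis unfolding det[rule_format, OF that(1)] by simp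
  qed
  ultimately show ?thesis by blast
qed

text \<open>(CI) and (CII) with u as time direction: for real spatial frame components all roots z
  are real, and z^2 \<le> v^2 says that the covector is not timelike.\<close>

definition rest_hyperbolic :: bool where
  "rest_hyperbolic \<longleftrightarrow> (\<forall>\<phi>. (\<forall>a. a \<noteq> 0 \<longrightarrow> cfr_comp \<phi> a \<in> \<real>) \<and> det (princ g x M U \<phi>) = 0 \<longrightarrow>
     cfr_comp \<phi> 0 \<in> \<real> \<and> (Re (cfr_comp \<phi> 0))\<^sup>2 \<le> (Re (cfr_comp \<phi> 1))\<^sup>2 + (Re (cfr_comp \<phi> 2))\<^sup>2 + (Re (cfr_comp \<phi> 3))\<^sup>2)"

text \<open>A real spatial part v \<noteq> 0 determines \<open>c\<close> and \<open>k\<close> up to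
  the pole, and every pair arises. For each pair the condition on z is that the squared ratios
  (z/v)^2 solving the factors lie in the unit interval.\<close>

lemma rest_hyperbolic_iff:
  "rest_hyperbolic \<longleftrightarrow>
    (\<forall>c\<in>{0..1}. \<forall>k\<in>{0..1}.
       case cubic_coeffs g x M U e \<Lambda> c k of (A0, A1, A2) \<Rightarrow>
         0 \<le> cubic_disc A0 A1 A2 \<and>
         0 \<le> A2 / 3 \<and> A2 / 3 \<le> 1 \<and> 0 \<le> A1 \<and> 0 \<le> A0 \<and>
         0 \<le> 1 - A2 + A1 - A0 \<and>
         0 \<le> 1 - 2 / 3 * A2 + 1 / 3 * A1 \<and>
         0 \<le> quad_root (g x) M U \<Lambda> c k \<and> quad_root (g x) M U \<Lambda> c k \<le> 1)"
    (is "_ \<longleftrightarrow> (\<forall>c\<in>_. \<forall>k\<in>_. ?ineq c k)")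
proof -
  have roots: "?ineq c k \<longleftrightarrow> (\<forall>\<zeta>. \<zeta> = 0 \<or> \<zeta>\<^sup>2 = of_real (quad_root (g x) M U \<Lambda> c k) \<or>
        (\<zeta>\<^sup>2) ^ 3 - of_real a2 * (\<zeta>\<^sup>2)\<^sup>2 + of_real a1 * \<zeta>\<^sup>2 - of_real a0 = 0 \<longrightarrow> \<zeta> \<in> \<real> \<and> (Re \<zeta>)\<^sup>2 \<le> 1)"
    (is "_ \<longleftrightarrow> ?roots")
    if "cubic_coeffs g x M U e \<Lambda> c k = (a0, a1, a2)" for c k a0 a1 a2
  proof -
    have "?ineq c k \<longleftrightarrow> (\<forall>y::complex. y ^ 3 - of_real a2 * y\<^sup>2 + of_real a1 * y - of_real a0 = 0 \<longrightarrow>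
       (\<exists>r::real. y = of_real r \<and> 0 \<le> r \<and> r \<le> 1)) \<and>
       (\<exists>r. complex_of_real (quad_root (g x) M U \<Lambda> c k) = of_real r \<and> 0 \<le> r \<and> r \<le> 1)"
      unfolding that cubic_roots_unit_interval by auto
    also have "\<dots> \<longleftrightarrow> ?roots"
    proof -
      have "(0::complex) \<in> \<real> \<and> (Re 0)\<^sup>2 \<le> 1" by simp
      thus ?thesis unfolding csquare_unit_interval[symmetric] by blast
    qed
    finally show ?thesis .
  qed
  show ?thesis
  proof
    assume D: rest_hyperbolic
    show "\<forall>c\<in>{0..1}. \<forall>k\<in>{0..1}. ?ineq c k"
    proof (intro ballI)
      fix c k :: real assume ck: "c \<in> {0..1}" "k \<in> {0..1}"
      obtain a0 a1 a2 where cc: "cubic_coeffs g x M U e \<Lambda> c k = (a0, a1, a2)"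
        and det: "\<forall>\<phi> \<zeta> v. aligned c k v \<zeta> \<phi> \<and> v > 0 \<longrightarrow>
     (det (princ g x M U \<phi>) = 0 \<longleftrightarrow> \<zeta> = 0 \<or> \<zeta>\<^sup>2 = of_real (quad_root (g x) M U \<Lambda> c k) \<or>
        (\<zeta>\<^sup>2) ^ 3 - of_real a2 * (\<zeta>\<^sup>2)\<^sup>2 + of_real a1 * \<zeta>\<^sup>2 - of_real a0 = 0)"
        using cubic_coeffs_direction[OF ck] by (elim exE conjE) (rule that)
      show "?ineq c k"
        unfolding roots[OF cc]
      proof (intro allI impI)
        fix \<zeta> :: complex assume \<zeta>: "\<zeta> = 0 \<or> \<zeta>\<^sup>2 = of_real (quad_root (g x) M U \<Lambda> c k) \<or>
          (\<zeta>\<^sup>2) ^ 3 - of_real a2 * (\<zeta>\<^sup>2)\<^sup>2 + of_real a1 * \<zeta>\<^sup>2 - of_real a0 = 0"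
        \<comment> \<open>A covector with v = 1 in the direction given by \<open>c\<close>,
          \<open>k\<close>, and with z = \<zeta>.\<close>
        define \<phi> where "\<phi> = cvec (cov (\<lambda>A. if A = 0 then 0 else sqrt (dirsq c k A)))
          + \<zeta> *s cvec (cov (\<lambda>A. if A = 0 then 1 else 0))"
        have F: "cfr_comp \<phi> 0 = \<zeta>" "\<And>a. a \<noteq> 0 \<Longrightarrow> cfr_comp \<phi> a = of_real (sqrt (dirsq c k a))"
          by (simp_all add: \<phi>_def cfr_comp_add cfr_comp_scale cfr_comp_cvec fr_comp_cov)
        have "det (princ g x M U \<phi>) = 0"
          using det[rule_format, of 1 \<zeta> \<phi>] F \<zeta> dirsq_nonneg[OF ck]
          by (simp add: aligned_def flip: of_real_power)
        hence "\<zeta> \<in> \<real> \<and> (Re \<zeta>)\<^sup>2 \<le> dirsq c k 1 + dirsq c k 2 + dirsq c k 3"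
          using D[unfolded rest_hyperbolic_def, rule_format, of \<phi>] dirsq_nonneg[OF ck] by (simp add: F)
        thus "\<zeta> \<in> \<real> \<and> (Re \<zeta>)\<^sup>2 \<le> 1" by (simp only: sum_dirsq)
      qed
    qed
  next
    assume ineq: "\<forall>c\<in>{0..1}. \<forall>k\<in>{0..1}. ?ineq c k"
    show rest_hyperbolic
      unfolding rest_hyperbolic_def
    proof (intro allI impI)
      fix \<phi> assume A: "(\<forall>a. a \<noteq> 0 \<longrightarrow> cfr_comp \<phi> a \<in> \<real>) \<and> det (princ g x M U \<phi>) = 0"
      define r where "r a = Re (cfr_comp \<phi> a)" for a
      have r: "cfr_comp \<phi> a = of_real (r a)" if "a \<noteq> 0" for a
        using A that by (simp add: r_def)
      define w where "w = (r 1)\<^sup>2 + (r 2)\<^sup>2 + (r 3)\<^sup>2"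
      have "cfr_comp \<phi> 0 \<in> \<real> \<and> (Re (cfr_comp \<phi> 0))\<^sup>2 \<le> w"
      proof (cases "w = 0")
        case True
        have "(r 1)\<^sup>2 + ((r 2)\<^sup>2 + (r 3)\<^sup>2) = 0" using True by (simp add: w_def)
        hence "r 1 = 0" "r 2 = 0" "r 3 = 0"
          by (smt (verit) zero_le_power2 zero_eq_power2)+
        hence "cfr_comp \<phi> 1 = 0" "cfr_comp \<phi> 2 = 0" "cfr_comp \<phi> 3 = 0" by (simp_all add: r)
        \<comment> \<open>At v = 0 there is no direction to speak of, but the determinant is a
          nonzero constant times z^23.\<close>
        hence "det (princ g x M U \<phi>) = of_real (val (tau_bulk M) (g x) U) * of_real (val (tau_shear M) (g x) U) ^ 16
          * cfr_comp \<phi> 0 ^ 15 * (of_real (enth M U + \<Lambda> 0) * (cfr_comp \<phi> 0)\<^sup>2)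
          * ((cfr_comp \<phi> 0)\<^sup>2 * of_real (enth M U + \<Lambda> 1) * ((cfr_comp \<phi> 0)\<^sup>2 * of_real (enth M U + \<Lambda> 2))
             * ((cfr_comp \<phi> 0)\<^sup>2 * of_real (enth M U + \<Lambda> 3)))"
          by (simp add: det_princ[OF tau] C.quad_def C.V_def C.W_def C.diag_entry_def det3_update_def Lam0)
        hence "cfr_comp \<phi> 0 = 0" using A tau nz by (auto simp del: of_real_add)
        thus ?thesis using True by simp
      next
        case False
        hence w: "w > 0" unfolding w_def by (smt (verit) zero_le_power2)
        obtain c k where ck: "c \<in> {0..1}" "k \<in> {0..1}" "dirsq c k 1 = (r 1)\<^sup>2 / w" "dirsq c k 2 = (r 2)\<^sup>2 / w"
          "dirsq c k 3 = (r 3)\<^sup>2 / w"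
        proof (rule dirsq_surj)
          show "(r 1)\<^sup>2 / w + (r 2)\<^sup>2 / w + (r 3)\<^sup>2 / w = 1"
            using w unfolding add_divide_distrib[symmetric] w_def by simp
        qed (use w in auto)
        obtain a0 a1 a2 where cc: "cubic_coeffs g x M U e \<Lambda> c k = (a0, a1, a2)"
          and det: "\<forall>\<phi> \<zeta> v. aligned c k v \<zeta> \<phi> \<and> v > 0 \<longrightarrow>
     (det (princ g x M U \<phi>) = 0 \<longleftrightarrow> \<zeta> = 0 \<or> \<zeta>\<^sup>2 = of_real (quad_root (g x) M U \<Lambda> c k) \<or>
        (\<zeta>\<^sup>2) ^ 3 - of_real a2 * (\<zeta>\<^sup>2)\<^sup>2 + of_real a1 * \<zeta>\<^sup>2 - of_real a0 = 0)"
          using cubic_coeffs_direction[OF ck(1,2)] by (elim exE conjE) (rule that)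
        define \<zeta> where "\<zeta> = cfr_comp \<phi> 0 / of_real (sqrt w)"
        have z: "cfr_comp \<phi> 0 = of_real (sqrt w) * \<zeta>" using w by (simp add: \<zeta>_def)
        have "(r a)\<^sup>2 = (sqrt w)\<^sup>2 * dirsq c k a" if "a \<noteq> 0" for a
          using exhaust_4'[of a] that ck w by auto
        hence "aligned c k (sqrt w) \<zeta> \<phi>"
          unfolding aligned_def by (simp add: z[symmetric] r flip: of_real_power)
        hence "\<zeta> = 0 \<or> \<zeta>\<^sup>2 = of_real (quad_root (g x) M U \<Lambda> c k) \<or>
           (\<zeta>\<^sup>2) ^ 3 - of_real a2 * (\<zeta>\<^sup>2)\<^sup>2 + of_real a1 * \<zeta>\<^sup>2 - of_real a0 = 0"
          using det A real_sqrt_gt_zero[OF w] by blast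
        moreover have "?ineq c k" by (rule bspec[OF bspec[OF ineq ck(1)] ck(2)])
        ultimately have "\<zeta> \<in> \<real>" "(Re \<zeta>)\<^sup>2 \<le> 1" unfolding roots[OF cc] by blast+
        moreover from this have "(Re (cfr_comp \<phi> 0))\<^sup>2 = w * (Re \<zeta>)\<^sup>2"
          unfolding z using w by (simp add: power_mult_distrib)
        ultimately show ?thesis
          using w z by (auto simp: mult_left_le)
      qed
      thus "cfr_comp \<phi> 0 \<in> \<real> \<and> (Re (cfr_comp \<phi> 0))\<^sup>2 \<le> (Re (cfr_comp \<phi> 1))\<^sup>2 + (Re (cfr_comp \<phi> 2))\<^sup>2 + (Re (cfr_comp \<phi> 3))\<^sup>2"
        by (simp add: w_def r_def)
    qed
  qed
qed

section \<open>From the rest frame to the coordinate time direction\<close>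

lemma det_princ_cong:
  assumes "\<And>A. cfr_comp \<phi> A = cfr_comp \<psi> A"
  shows "det (princ g x M U \<phi>) = det (princ g x M U \<psi>)"
proof -
  have "cfr_comp \<phi> = cfr_comp \<psi>" using assms by (simp add: fun_eq_iff)
  thus ?thesis by (simp only: det_princ[OF tau])
qed

text \<open>The numbers e_A^0 are the frame components of dx^0, so this says that dx^0 is timelike,
  which is what spacelike level sets should give.\<close>

lemma slice_timelike: "(vel U 0)\<^sup>2 > (e 1 $ 0)\<^sup>2 + (e 2 $ 0)\<^sup>2 + (e 3 $ 0)\<^sup>2"
proof (rule ccontr)
  assume neg: "\<not> ?thesis"
  define s where "s = (e 1 $ 0)\<^sup>2 + (e 2 $ 0)\<^sup>2 + (e 3 $ 0)\<^sup>2"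
  \<comment> \<open>If dx^0 were not timelike, X = s u - u^0 (sum of e_a^0 e_a) would be tangent to
    the level set, as its 0-component cancels, and g(X, X) = s ((u^0)^2 - s) \<le> 0.\<close>
  define r where "r A = (if A = 0 then s else - vel U 0 * e A $ 0)" for A
  define X where "X = (\<Sum>A\<in>UNIV. r A *\<^sub>R e A)"
  have in_e: "X \<bullet> (g x *v e B) = sg B * r B" for B
  proof -
    have "X \<bullet> (g x *v e B) = (\<Sum>A\<in>UNIV. r A * (sg A * of_bool (A = B)))"
      using frame unfolding X_def inner_sum_left eigenframe_def
      by (intro sum.cong refl) (auto simp: minkowski_def sg_def)
    thus ?thesis using exhaust_4'[of B] by (elim disjE) (simp_all add: sum_4')
  qed
  have "g x *v X = (\<Sum>A\<in>UNIV. r A *\<^sub>R (g x *v e A))"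
    by (simp add: X_def sum_4' matrix_vector_right_distrib matrix_vector_mult_scaleR)
  hence "X \<bullet> (g x *v X) = (\<Sum>A\<in>UNIV. r A * (sg A * r A))"
    by (simp add: inner_sum_right in_e)
  also have "\<dots> = - s\<^sup>2 + (vel U 0)\<^sup>2 * s"
    by (simp add: sum_4' r_def sg_def s_def power2_eq_square algebra_simps)
  also have "\<dots> \<le> 0"
  proof -
    have "s \<ge> 0" "(vel U 0)\<^sup>2 \<le> s" using neg by (auto simp: s_def)
    hence "(vel U 0)\<^sup>2 * s \<le> s * s" by (intro mult_right_mono)
    thus ?thesis by (simp add: power2_eq_square)
  qed
  finally have "\<not> X \<bullet> (g x *v X) > 0" by simp
  moreover have "X $ 0 = 0"
    by (simp add: X_def sum_4' r_def s_def e0 power2_eq_square algebra_simps)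
  ultimately have "X = 0" using slices by (auto simp: spacelike_time_slices_def)
  \<comment> \<open>X = 0 forces s = 0, hence u^0 = 0. Then no frame vector has a 0-component, which
    contradicts completeness.\<close>
  hence "s = 0" using in_e[of 0] by (simp add: r_def sg_def)
  hence z: "e 1 $ 0 = 0" "e 2 $ 0 = 0" "e 3 $ 0 = 0" "vel U 0 = 0"
    using neg unfolding s_def by (smt (verit) zero_le_power2 zero_eq_power2)+
  have "(\<Sum>A\<in>UNIV. sg A * e A $ 0 * low A 0) = 0" by (simp add: sum_4' z e0)
  thus False using complete[of 0 0] by simp
qed

text \<open>Both sides split into hyperbolicity in a direction, \<theta> = dx^0 or \<omega> along
  the rest frame, and the condition \<open>N\<close>, which is (CII) in frame components.
  \<open>N\<close> is the same on both sides and supplies the cone hypothesis for moving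
  hyperbolicity either way.\<close>

lemma causal_iff_rest_hyperbolic: "causal g x M U \<longleftrightarrow> rest_hyperbolic"
proof -
  define p where "p = (\<lambda>\<phi>. det (pencil (Amat g x M U) \<phi> :: complex^fld^fld))"
  have p: "p \<phi> = det (princ g x M U \<phi>)" for \<phi>
    by (simp add: p_def pencil_def princ_def)
  define \<theta> :: "real^4" where "\<theta> = axis 0 1"
  \<comment> \<open>The time orientation of u is not fixed. The sign of u^0 puts \<omega> in the
    same half of the light cone as dx^0.\<close>
  define s0 where "s0 = sgn (vel U 0)"
  define \<omega> where "\<omega> = cov (\<lambda>A. if A = 0 then s0 else 0)"
  have u0: "vel U 0 \<noteq> 0" using slice_timelike
    by (smt (verit) power_zero_numeral zero_le_power2)
  hence s0: "s0 * s0 = 1" "s0 * vel U 0 = \<bar>vel U 0\<bar>" "s0\<^sup>2 = 1"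
    by (auto simp: s0_def sgn_if power2_eq_square)
  have fr_comp\<theta>: "fr_comp \<theta> A = e A $ 0" for A
    by (simp add: fr_comp_def \<theta>_def axis_def if_distrib cong: if_cong)
  have fr_comp\<omega>: "fr_comp \<omega> 0 = s0" "\<And>a. a \<noteq> 0 \<Longrightarrow> fr_comp \<omega> a = 0" by (simp_all add: \<omega>_def fr_comp_cov)
  define N where "N \<longleftrightarrow> (\<forall>\<phi>. p (cvec \<phi>) = 0 \<longrightarrow> (fr_comp \<phi> 0)\<^sup>2 \<le> (fr_comp \<phi> 1)\<^sup>2 + (fr_comp \<phi> 2)\<^sup>2 + (fr_comp \<phi> 3)\<^sup>2)"
  define hyp where "hyp \<xi> \<longleftrightarrow> (\<forall>\<psi> t. p (cvec \<psi> + t *s cvec \<xi>) = 0 \<longrightarrow> t \<in> \<real>)" for \<xi>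
  \<comment> \<open>Nonnegative combinations of \<theta> and \<omega>, not both coefficients zero,
    stay timelike: by the choice of \<open>s0\<close> the mixed term 2 \<alpha> \<beta>
    \<bar>u^0\<bar> has the favourable sign.\<close>
  have cone: "p (cvec (\<alpha> *\<^sub>R \<theta> + \<beta> *\<^sub>R \<omega>)) \<noteq> 0" if N "\<alpha> \<ge> 0" "\<beta> \<ge> 0" "\<alpha> > 0 \<or> \<beta> > 0" for \<alpha> \<beta>
  proof -
    define S where "S = (e 1 $ 0)\<^sup>2 + (e 2 $ 0)\<^sup>2 + (e 3 $ 0)\<^sup>2"
    have "(\<alpha> * vel U 0 + \<beta> * s0)\<^sup>2 = (s0 * (\<alpha> * vel U 0 + \<beta> * s0))\<^sup>2"
      by (simp only: power_mult_distrib s0 mult_1)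
    also have "s0 * (\<alpha> * vel U 0 + \<beta> * s0) = \<alpha> * (s0 * vel U 0) + \<beta> * (s0 * s0)"
      by (simp add: algebra_simps)
    also have "\<dots> = \<alpha> * \<bar>vel U 0\<bar> + \<beta>" unfolding s0 by simp
    finally have 0: "(\<alpha> * vel U 0 + \<beta> * s0)\<^sup>2 = \<alpha>\<^sup>2 * (vel U 0)\<^sup>2 + 2 * \<alpha> * \<beta> * \<bar>vel U 0\<bar> + \<beta>\<^sup>2"
      by (simp add: power2_sum power_mult_distrib)
    have "\<alpha>\<^sup>2 * S < \<alpha>\<^sup>2 * (vel U 0)\<^sup>2 + \<beta>\<^sup>2"
    proof (cases "\<alpha> = 0")
      case True thus ?thesis using that by simp
    next
      case False
      hence "\<alpha>\<^sup>2 * S < \<alpha>\<^sup>2 * (vel U 0)\<^sup>2" using slice_timelike by (simp add: S_def)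
      thus ?thesis by (smt (verit) zero_le_power2)
    qed
    moreover have "2 * \<alpha> * \<beta> * \<bar>vel U 0\<bar> \<ge> 0" using that by simp
    ultimately have "\<alpha>\<^sup>2 * S < (\<alpha> * vel U 0 + \<beta> * s0)\<^sup>2" unfolding 0 by linarith
    hence "\<not> (fr_comp (\<alpha> *\<^sub>R \<theta> + \<beta> *\<^sub>R \<omega>) 0)\<^sup>2 \<le> (fr_comp (\<alpha> *\<^sub>R \<theta> + \<beta> *\<^sub>R \<omega>) 1)\<^sup>2
       + (fr_comp (\<alpha> *\<^sub>R \<theta> + \<beta> *\<^sub>R \<omega>) 2)\<^sup>2 + (fr_comp (\<alpha> *\<^sub>R \<theta> + \<beta> *\<^sub>R \<omega>) 3)\<^sup>2"
      by (simp add: fr_comp_add fr_comp_scale fr_comp\<theta> fr_comp\<omega> e0 S_def power_mult_distrib distrib_left)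
    thus ?thesis using \<open>N\<close> unfolding N_def by blast
  qed
  have "causal g x M U \<longleftrightarrow> hyp \<theta> \<and> N"
  proof -
    \<comment> \<open>A covector with real \<phi>_1, \<phi>_2, \<phi>_3 is a real covector plus a
      complex multiple of dx^0. A real part of \<phi>_0 may be put into either summand without
      affecting reality of the coefficient.\<close>
    have "(\<forall>\<phi>::complex^4. (\<forall>i. i \<noteq> 0 \<longrightarrow> \<phi> $ i \<in> \<real>) \<and> p \<phi> = 0 \<longrightarrow> \<phi> $ 0 \<in> \<real>) \<longleftrightarrow> hyp \<theta>" (is "?CI \<longleftrightarrow> _")
    proof
      assume CI: ?CI
      show "hyp \<theta>" unfolding hyp_def
      proof (intro allI impI)
        fix \<psi> t assume "p (cvec \<psi> + t *s cvec \<theta>) = 0"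
        moreover have "\<forall>i. i \<noteq> 0 \<longrightarrow> (cvec \<psi> + t *s cvec \<theta>) $ i \<in> \<real>" by (simp add: \<theta>_def axis_def)
        ultimately have "(cvec \<psi> + t *s cvec \<theta>) $ 0 \<in> \<real>" using CI by blast
        hence "of_real (\<psi> $ 0) + t \<in> \<real>" by (simp add: \<theta>_def)
        hence "of_real (\<psi> $ 0) + t - of_real (\<psi> $ 0) \<in> \<real>" by (intro Reals_diff Reals_of_real)
        thus "t \<in> \<real>" by simp
      qed
    next
      assume h: "hyp \<theta>"
      show ?CI
      proof (intro allI impI)
        fix \<phi> :: "complex^4" assume A: "(\<forall>i. i \<noteq> 0 \<longrightarrow> \<phi> $ i \<in> \<real>) \<and> p \<phi> = 0"
        have "\<phi> = cvec (\<chi> i. if i = 0 then 0 else Re (\<phi> $ i)) + \<phi> $ 0 *s cvec \<theta>"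
          using A by (simp add: vec_eq_iff \<theta>_def axis_def)
        thus "\<phi> $ 0 \<in> \<real>" using h A unfolding hyp_def by metis
      qed
    qed
    moreover have "(\<forall>\<phi>::real^4. det (princ g x M U \<phi>) = 0 \<longrightarrow> \<phi> \<bullet> (matrix_inv (g x) *v \<phi>) \<ge> 0) \<longleftrightarrow> N"
      unfolding N_def p det_princ_cvec norm_frame of_real_eq_0_iff by (auto simp: algebra_simps)
    ultimately show ?thesis unfolding causal_def p[symmetric] by simp
  qed
  also have "\<dots> \<longleftrightarrow> hyp \<omega> \<and> N"
  proof -
    have transfer: "hyp \<xi>" if h: "hyp \<eta>" and c: "\<And>\<sigma>. \<sigma> \<ge> 0 \<Longrightarrow> p (cvec (\<eta> + \<sigma> *\<^sub>R \<xi>)) \<noteq> 0"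
      and nz: "p (cvec \<xi>) \<noteq> 0" for \<eta> \<xi>
      unfolding hyp_def
    proof (intro allI impI)
      fix \<psi> t assume root: "p (cvec \<psi> + t *s cvec \<xi>) = 0"
      show "t \<in> \<real>"
        using hyperbolic_direction_transfer[of "Amat g x M U" \<eta> \<xi> \<psi> t] h c nz root
        unfolding p_def hyp_def by blast
    qed
    have "hyp \<omega>" if "hyp \<theta>" N
      using cone[OF \<open>N\<close>, of 1] cone[OF \<open>N\<close>, of 0 1] by (intro transfer[OF \<open>hyp \<theta>\<close>]) simp_all
    moreover have "hyp \<theta>" if "hyp \<omega>" N
      using cone[OF \<open>N\<close>, of _ 1] cone[OF \<open>N\<close>, of 1 0]
      by (intro transfer[OF \<open>hyp \<omega>\<close>]) (simp_all add: add.commute)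
    ultimately show ?thesis by blast
  qed
  also have "\<dots> \<longleftrightarrow> rest_hyperbolic"
  proof
    assume A: "hyp \<omega> \<and> N"
    show rest_hyperbolic unfolding rest_hyperbolic_def p[symmetric]
    proof (intro allI impI)
      fix \<phi> assume \<phi>: "(\<forall>a. a \<noteq> 0 \<longrightarrow> cfr_comp \<phi> a \<in> \<real>) \<and> p \<phi> = 0"
      define \<psi> where "\<psi> = cov (\<lambda>A. if A = 0 then 0 else Re (cfr_comp \<phi> A))"
      define t where "t = of_real s0 * cfr_comp \<phi> 0"
      have s0C: "of_real s0 * (of_real s0 * y) = y" for y :: complex
        using s0(1) by (metis mult.assoc mult_1 of_real_1 of_real_mult)
      have "cfr_comp (cvec \<psi> + t *s cvec \<omega>) A = cfr_comp \<phi> A" for A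
        using \<phi> s0C[of "cfr_comp \<phi> 0"] by (cases "A = 0") (simp_all add: cfr_comp_add cfr_comp_scale cfr_comp_cvec fr_comp\<omega> \<psi>_def fr_comp_cov t_def mult_ac)
      hence root: "p (cvec \<psi> + t *s cvec \<omega>) = 0" using \<phi> det_princ_cong p by metis
      hence t: "t \<in> \<real>" using A by (auto simp: hyp_def)
      have F0: "cfr_comp \<phi> 0 = of_real s0 * t" using s0C[of "cfr_comp \<phi> 0"] by (simp add: t_def)
      have "cvec \<psi> + t *s cvec \<omega> = cvec (\<psi> + Re t *\<^sub>R \<omega>)"
        using t by (simp add: vec_eq_iff)
      hence "p (cvec (\<psi> + Re t *\<^sub>R \<omega>)) = 0" using root by simp
      hence "(fr_comp (\<psi> + Re t *\<^sub>R \<omega>) 0)\<^sup>2 \<le> (fr_comp (\<psi> + Re t *\<^sub>R \<omega>) 1)\<^sup>2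
         + (fr_comp (\<psi> + Re t *\<^sub>R \<omega>) 2)\<^sup>2 + (fr_comp (\<psi> + Re t *\<^sub>R \<omega>) 3)\<^sup>2"
        using A unfolding N_def by blast
      hence "(Re (cfr_comp \<phi> 0))\<^sup>2 \<le> (Re (cfr_comp \<phi> 1))\<^sup>2 + (Re (cfr_comp \<phi> 2))\<^sup>2 + (Re (cfr_comp \<phi> 3))\<^sup>2"
        by (simp add: fr_comp_add fr_comp_scale fr_comp\<omega> \<psi>_def fr_comp_cov F0 mult.commute)
      moreover have "cfr_comp \<phi> 0 \<in> \<real>" unfolding F0 using t by simp
      ultimately show "cfr_comp \<phi> 0 \<in> \<real> \<and> (Re (cfr_comp \<phi> 0))\<^sup>2 \<le> (Re (cfr_comp \<phi> 1))\<^sup>2 + (Re (cfr_comp \<phi> 2))\<^sup>2 + (Re (cfr_comp \<phi> 3))\<^sup>2"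
        by blast
    qed
  next
    assume D: rest_hyperbolic
    have "t \<in> \<real>" if "p (cvec \<psi> + t *s cvec \<omega>) = 0" for \<psi> t
    proof -
      have "cfr_comp (cvec \<psi> + t *s cvec \<omega>) 0 \<in> \<real>"
        using D[unfolded rest_hyperbolic_def, rule_format, of "cvec \<psi> + t *s cvec \<omega>"] that
        by (simp add: p cfr_comp_add cfr_comp_scale cfr_comp_cvec fr_comp\<omega>)
      hence "of_real (fr_comp \<psi> 0) + t * of_real s0 - of_real (fr_comp \<psi> 0) \<in> \<real>"
        by (intro Reals_diff) (simp_all add: cfr_comp_add cfr_comp_scale cfr_comp_cvec fr_comp\<omega>)
      hence "t * of_real s0 \<in> \<real>" by simp
      hence "t * of_real s0 * of_real s0 \<in> \<real>" by (rule Reals_mult[OF _ Reals_of_real])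
      also have "t * of_real s0 * of_real s0 = t"
        using s0(1) by (metis mult.assoc mult_1_right of_real_1 of_real_mult)
      finally show ?thesis .
    qed
    hence "hyp \<omega>" by (auto simp: hyp_def)
    moreover have N
      unfolding N_def
    proof (intro allI impI)
      fix \<phi> assume "p (cvec \<phi>) = 0"
      thus "(fr_comp \<phi> 0)\<^sup>2 \<le> (fr_comp \<phi> 1)\<^sup>2 + (fr_comp \<phi> 2)\<^sup>2 + (fr_comp \<phi> 3)\<^sup>2"
        using D[unfolded rest_hyperbolic_def, rule_format, of "cvec \<phi>"] by (simp add: p cfr_comp_cvec)
    qed
    ultimately show "hyp \<omega> \<and> N" ..
  qed
  finally show ?thesis .
qed

end

theorem theorem1:
  fixes D :: "(real^4) set" and g :: "real^4 \<Rightarrow> real^4^4" and x :: "real^4"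
    and M :: fluid and U :: state and e :: "4 \<Rightarrow> real^4" and \<Lambda> :: "4 \<Rightarrow> real"
  assumes "open D" and "x \<in> D"
    and "\<And>y. y \<in> D \<Longrightarrow> lorentzian (g y)"
    and "\<And>y. y \<in> D \<Longrightarrow> g differentiable (at y)"
    and "\<And>y. y \<in> D \<Longrightarrow> spacelike_time_slices (g y)"
    and "(\<lambda>(s, n). pressure_fn M s n) differentiable (at (energy U, particle U))"
    and "constrained (g x) U"
    and "eigenframe (g x) U e \<Lambda>"
    and "val (tau_bulk M) (g x) U \<noteq> 0" and "val (tau_shear M) (g x) U \<noteq> 0"
    and "\<And>A. enth M U + \<Lambda> A \<noteq> 0"
  shows "causal g x M U \<longleftrightarrow>
    (\<forall>c\<in>{0..1}. \<forall>k\<in>{0..1}.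
       case cubic_coeffs g x M U e \<Lambda> c k of (A0, A1, A2) \<Rightarrow>
         0 \<le> cubic_disc A0 A1 A2 \<and>
         0 \<le> A2 / 3 \<and> A2 / 3 \<le> 1 \<and> 0 \<le> A1 \<and> 0 \<le> A0 \<and>
         0 \<le> 1 - A2 + A1 - A0 \<and>
         0 \<le> 1 - 2 / 3 * A2 + 1 / 3 * A1 \<and>
         0 \<le> quad_root (g x) M U \<Lambda> c k \<and> quad_root (g x) M U \<Lambda> c k \<le> 1)"
proof -
  interpret causal_frame g x M U e \<Lambda>
    by unfold_locales (use assms in auto)
  show ?thesis
    unfolding causal_iff_rest_hyperbolic by (rule rest_hyperbolic_iff)
qed

end
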